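(* Let $X$ be a local isometric immersion of $\mathbb R^n$ in $\mathbb R^{n+m}$ with flat and non-degenerate normal bundle, and $(x_1,\dots,x_n)$ a line of curvature coordinate system, with parallel normal frame $e_{n+1},\dots,e_{n+m}$, such that $$I=\sum_ib_i^2dx_i^2,\quad II=\sum_{i=1}^n\sum_{j=1}^mb_ia_{ji}dx_i^2e_{n+j},\quad A_1=(a_{ij}),\ A_1^tA_1=I.$$ Let $(A_1,F)$ be the corresponding solution of the $G_{m,n}$-system I, i.e. $F=(f_{ij})$ with $f_{ij}=(b_i)_{x_j}/b_j$ ($i\ne j$), $f_{ii}=0$; let $e_i=\frac1{b_i}X_{x_i}$, $g=(e_{n+1},\dots,e_{n+m},e_1,\dots,e_n)$, and $E^I$ a frame of $(A_1,F)$ with $E^I(x,1)=g(x)$. Let $A,G,E$, $\tilde W,\tilde Z$, $\hat W,\hat Z$ and $(\tilde A_1,\tilde F,\tilde E^I)=g_{s,\pi}\cdot(A_1,F,E^I)$ be as in the context. Write $$E^I(x,1)=(e_{n+1}(x),\dots,e_{n+m}(x),e_1(x),\dots,e_n(x)),\quad \tilde E^I(x,1)=(\tilde e_{n+1}(x),\dots,\tilde e_{n+m}(x),\tilde e_1(x),\dots,\tilde e_n(x)).$$ Set $$\gamma=(\gamma_{n+1},\dots,\gamma_{m+n},\gamma_1,\dots,\gamma_n):=(\sin\rho\,\hat W^tA^t,\ \cos\rho\,\hat Z^t),\qquad \eta(x)=E^I(x,1)\gamma(x)^t,\qquad\rho=\cot^{-1}s.$$ Then: (1) There exists $\phi$ such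 that $\phi_{x_i}=-s\,b_i\tilde z_i$ for all $i=1,\dots,n$, where $\tilde z_i$ is the $i$-th coordinate of $\tilde Z$. (2) Let $\tilde X=X+\dfrac{2\cos\rho}{s}\,\dfrac{\phi}{\|\tilde W\|}\,\eta$. Then $\tilde X$ is again an immersed flat submanifold in $\mathbb R^{n+m}$ with flat and non-degenerate normal bundle. (3) The bundle morphism $P(e_\alpha(x))=\tilde e_\alpha(x)$ for $n+1\le\alpha\le n+m$ is a Ribaucour transformation covering the map $X(x)\mapsto\tilde X(x)$. (4) The solution of the $G_{m,n}$-system I corresponding to $\tilde X$ is $(\tilde A_1,\tilde F)$.
   Context: Throughout $m\ge n$. $\mathcal M_{p\times q}$: real $p\times q$ matrices; $gl_*(n)$: real $n\times n$ matrices with zero diagonal; $C_i$: the $n\times n$ matrix whose only non-zero entry is a $1$ at $(i,i)$; $D_i=\begin{pmatrix}C_i\\0\end{pmatrix}\in\mathcal M_{m\times n}$; $I_{m,n}=\mathrm{diag}(I_m,-I_n)$. Flat means $d\theta+\theta\wedge\theta=0$. $G_{m,n}$-reality condition: $\overline{E(x,\bar\lambda)}=E(x,\lambda)$, $I_{m,n}E(x,\lambda)I_{m,n}^{-1}=E(x,-\lambda)$, $EE^t=I$. $G_{m,n}$-system: $\xi$ with values in $\mathcal M_{m\times n}$, $\xi_{ii}=0$, is a solution if $\theta_\lambda=\sum_i\left\{\lambda\begin{pmatrix}0&-D_i\\ D_i^t&0\end{pmatrix}+\begin{pmatrix}D_i\xi^t-\xi D_i^t&0\\0&-\xi^tD_i+D_i^t\xi\end{pmatrix}\right\}dx_i$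 is flat for all $\lambda\in\mathbb C$. $G_{m,n}$-system I: $(A_1,F)$ with $A_1^tA_1=I$, $F\in gl_*(n)$ is a solution if $\theta^I_\lambda=\sum_i\begin{pmatrix}0&-A_1C_i\lambda\\ C_iA_1^t\lambda&-F^tC_i+C_iF\end{pmatrix}dx_i$ is flat for all $\lambda\in\mathbb C$. A frame of a solution is a trivialization of its Lax connection ($E^{-1}dE=\theta_\lambda$, resp. $(E^I)^{-1}dE^I=\theta^I_\lambda$) satisfying the $G_{m,n}$-reality condition. The action: $0\ne s\in\mathbb R$, $W\in\mathbb R^m$, $Z\in\mathbb R^n$ are unit vectors, $\pi$ is the Hermitian projection of $\mathbb C^{m+n}$ onto $\mathbb C\binom W{iZ}$, and $g_{s,\pi}(\lambda)=\left(\pi+\frac{\lambda-is}{\lambda+is}(I-\pi)\right)\left(\bar\pi+\frac{\lambda+is}{\lambda-is}(I-\bar\pi)\right)$. $A=(A_1,A_2)$ has values in $O(m)$ and $G$ in $\mathcal M_{(m-n)\times n}$, chosen such that $\xi=\binom FG$ is a solution of the $G_{m,n}$-system with frame $E=E^I\begin{pmatrix}A&0\\0&I_n\end{pmatrix}$ (these exist); $E(x,\lambda)$ is taken holomorphic for $\lambda\in\mathbb C$. Put $\binom{\tilde W}{i\tilde Z}(x)=E(x,-is)^{-1}\binom W{iZ}$ ($\tilde W,\tilde Z$ are real, of equal norm), $\hat W=\tilde W/\|\tilde W\|$, $\hat Z=\tilde Z/\|\tilde Z\|$. Then $\tilde F$ has zero diagonal and entries $\tilde f_{ij}=f_{ij}-2s\hat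 w_i\hat z_j$ ($i\ne j$), $\tilde A_1$ consists of the first $n$ columns of $A(I-2\hat W\hat W^t)$, and $$\tilde E^I(x,\lambda)=E^I(x,\lambda)\left(I-\frac2{\lambda^2+s^2}\begin{pmatrix}\lambda A\hat W\\ s\hat Z\end{pmatrix}\begin{pmatrix}\lambda\hat W^tA^t&s\hat Z^t\end{pmatrix}\right).$$ The solution corresponding to an immersion is the one obtained from its fundamental forms, relative to a parallel normal frame, exactly as $(A_1,F)$ is obtained from $X$ in the claim (for $\tilde X$ the normal frame is $\tilde e_{n+1},\dots,\tilde e_{n+m}$). Conventions: $I=\sum\omega_i^2$, $II=\sum\omega_{i\alpha}\omega_ie_\alpha$ with $\omega_i=\langle dX,e_i\rangle$, $\omega_{i\alpha}=\langle e_i,de_\alpha\rangle$. Non-degenerate normal bundle: the space of shape operators at each point has dimension $n$. Line of curvature coordinates: $I$ and $II$ are diagonal in $dx_1,\dots,dx_n$. Ribaucour transformation: for $n$-dimensional submanifolds $M,\tilde M$ of a space form, let $\gamma_{x,v}(t)=\exp_x(tv)$ (straight lines in Euclidean space). A sphere congruence is a vector bundle isomorphism $P:\nu(M)\to\nu(\tilde M)$ of normal bundles covering a diffeomorphism $\ell:M\to\tilde M$ such that (a) if $\zeta$ is a parallel normal field of $M$, then $P\circ\zeta\circ\ell^{-1}$ is a parallel normal field of $\tilde M$; (b) for any non-zero $\zeta\in\nu_x(M)$, the geodesics $\gamma_{x,\zeta}$ and $\gamma_{\ell(x),P(\zeta)}$ intersect at a point equidistant from $x$ and $\ell(x)$ (the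 distance depends on $x$). It is a Ribaucour transformation if in addition (c) if $e$ is an eigenvector of the shape operator $A_\zeta$ of $M$, then $\ell_*(e)$ is an eigenvector of the shape operator $A_{P(\zeta)}$ of $\tilde M$; (d) the geodesics $\gamma_{x,e}$ and $\gamma_{\ell(x),\ell_*(e)}$ intersect at a point equidistant from $x$ and $\ell(x)$.
   Formalization: On a simply connected domain, (2)–(4) hold where X̃ is immersive (at each x only finitely many values φ(x) fail). In (b),(d) the lines may instead be parallel and orthogonal to X̃−X (meeting at infinity); in (c),(d) e is a common eigenvector of all shape operators. *)

theory Defs
  imports "HOL-Analysis.Analysis"
begin

section \<open>Smooth maps on open sets\<close>

abbreviation dif :: "('a::real_normed_vector \<Rightarrow> 'b::real_normed_vector) \<Rightarrow> 'a \<Rightarrow> 'a \<Rightarrow> 'b"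
  where "dif f x \<equiv> frechet_derivative f (at x)"

abbreviation pdif :: "'n \<Rightarrow> (real^'n \<Rightarrow> 'b::real_normed_vector) \<Rightarrow> real^'n \<Rightarrow> 'b"
  where "pdif i f x \<equiv> dif f x (axis i 1)"

primrec cont_diff :: "nat \<Rightarrow> 'a::real_normed_vector set \<Rightarrow> ('a \<Rightarrow> 'b::real_normed_vector) \<Rightarrow> bool"
  where
    "cont_diff 0 U f \<longleftrightarrow> continuous_on U f"
  | "cont_diff (Suc k) U f \<longleftrightarrow>
       (\<forall>x\<in>U. f differentiable at x) \<and> (\<forall>v. cont_diff k U (\<lambda>x. dif f x v))"

definition smooth_on :: "'a::real_normed_vector set \<Rightarrow> ('a \<Rightarrow> 'b::real_normed_vector) \<Rightarrow> bool"
  where "smooth_on U f \<longleftrightarrow> (\<forall>k. cont_diff k U f)"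

definition diffeomorphism_on :: "'a::real_normed_vector set \<Rightarrow> 'b::real_normed_vector set \<Rightarrow> ('a \<Rightarrow> 'b) \<Rightarrow> bool"
  where "diffeomorphism_on V V' l \<longleftrightarrow>
    bij_betw l V V' \<and> smooth_on V l \<and> smooth_on V' (inv_into V l)"

section \<open>Immersed submanifolds of Euclidean space\<close>

text \<open>An immersed n-dimensional submanifold is a parameter domain U, open in R^n, with an
  immersion X of U. The parameter vector u stands for the tangent vector dX(u).\<close>

definition immersion_on :: "(real^'n) set \<Rightarrow> (real^'n \<Rightarrow> 'e::euclidean_space) \<Rightarrow> bool"
  where "immersion_on U X \<longleftrightarrow> smooth_on U X \<and> (\<forall>x\<in>U. inj (dif X x))"

definition tangent_space :: "(real^'n \<Rightarrow> 'e::euclidean_space) \<Rightarrow> real^'n \<Rightarrow> 'e set"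
  where "tangent_space X x = range (dif X x)"

definition normal_space :: "(real^'n \<Rightarrow> 'e::euclidean_space) \<Rightarrow> real^'n \<Rightarrow> 'e set"
  where "normal_space X x = orthogonal_comp (tangent_space X x)"

definition normal_part :: "(real^'n \<Rightarrow> 'e::euclidean_space) \<Rightarrow> real^'n \<Rightarrow> 'e \<Rightarrow> 'e"
  where "normal_part X x w = (THE z. z \<in> normal_space X x \<and> w - z \<in> tangent_space X x)"

text \<open>The induced metric is flat: locally there is an isometry y into R^n, so that X is, in the
  coordinates y, an isometric immersion of an open part of R^n. The equation makes dy injective.\<close>

definition flat_metric :: "(real^'n) set \<Rightarrow> (real^'n \<Rightarrow> 'e::euclidean_space) \<Rightarrow> bool"
  where "flat_metric U X \<longleftrightarrow>
    (\<forall>x\<in>U. \<exists>V (y :: real^'n \<Rightarrow> real^'n). open V \<and> x \<in> V \<and> V \<subseteq> U \<and> smooth_on V y \<and>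
       (\<forall>p\<in>V. \<forall>u v. dif X p u \<bullet> dif X p v = dif y p u \<bullet> dif y p v))"

definition normal_field ::
  "(real^'n) set \<Rightarrow> (real^'n \<Rightarrow> 'e::euclidean_space) \<Rightarrow> (real^'n \<Rightarrow> 'e) \<Rightarrow> bool"
  where "normal_field V X \<zeta> \<longleftrightarrow> smooth_on V \<zeta> \<and> (\<forall>x\<in>V. \<zeta> x \<in> normal_space X x)"

definition normal_deriv ::
  "(real^'n \<Rightarrow> 'e::euclidean_space) \<Rightarrow> real^'n \<Rightarrow> (real^'n \<Rightarrow> 'e) \<Rightarrow> real^'n \<Rightarrow> 'e"
  where "normal_deriv X v \<zeta> x = normal_part X x (dif \<zeta> x v)"

definition parallel_normal_field ::
  "(real^'n) set \<Rightarrow> (real^'n \<Rightarrow> 'e::euclidean_space) \<Rightarrow> (real^'n \<Rightarrow> 'e) \<Rightarrow> bool"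
  where "parallel_normal_field V X \<zeta> \<longleftrightarrow>
    normal_field V X \<zeta> \<and> (\<forall>x\<in>V. \<forall>v. normal_deriv X v \<zeta> x = 0)"

text \<open>The curvature of the normal connection vanishes. The constant vector fields u and v commute,
  so there is no bracket term.\<close>

definition flat_normal_bundle :: "(real^'n) set \<Rightarrow> (real^'n \<Rightarrow> 'e::euclidean_space) \<Rightarrow> bool"
  where "flat_normal_bundle U X \<longleftrightarrow>
    (\<forall>V \<zeta>. open V \<and> V \<subseteq> U \<and> normal_field V X \<zeta> \<longrightarrow>
      (\<forall>x\<in>V. \<forall>u v. normal_deriv X u (normal_deriv X v \<zeta>) x
                   = normal_deriv X v (normal_deriv X u \<zeta>) x))"

text \<open>The shape operator at x in the normal direction \<open>\<zeta>\<close>, as the matrix S of an operator on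
  parameter vectors. If \<open>\<zeta>\<close> is extended to a normal field, the right hand side below is
  \<open>\<langle>dX(u), d\<zeta>(v)\<rangle>\<close>, so that the sign agrees with \<open>second_form\<close>.\<close>

definition shape_op :: "(real^'n \<Rightarrow> 'e::euclidean_space) \<Rightarrow> real^'n \<Rightarrow> 'e \<Rightarrow> real^'n^'n"
  where "shape_op X x \<zeta> =
    (THE S. \<forall>u v. dif X x (S *v u) \<bullet> dif X x v = - (\<zeta> \<bullet> dif (\<lambda>y. dif X y u) x v))"

definition nondegenerate_normal_bundle :: "(real^'n) set \<Rightarrow> (real^'n \<Rightarrow> 'e::euclidean_space) \<Rightarrow> bool"
  where "nondegenerate_normal_bundle U X \<longleftrightarrow>
    (\<forall>x\<in>U. dim (shape_op X x ` normal_space X x) = CARD('n))"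

text \<open>A simultaneous eigenvector of all shape operators at x.\<close>

definition principal_direction :: "(real^'n \<Rightarrow> 'e::euclidean_space) \<Rightarrow> real^'n \<Rightarrow> real^'n \<Rightarrow> bool"
  where "principal_direction X x u \<longleftrightarrow>
    u \<noteq> 0 \<and> (\<forall>\<zeta>\<in>normal_space X x. \<exists>\<kappa>. shape_op X x \<zeta> *v u = \<kappa> *\<^sub>R u)"

text \<open>For a normal frame \<open>N\<^sub>\<alpha>\<close> and an orthonormal tangent frame \<open>e\<^sub>i\<close>, this is
  \<open>\<Sum> \<omega>\<^sub>i\<^sub>\<alpha> \<omega>\<^sub>i N\<^sub>\<alpha>\<close> with \<open>\<omega>\<^sub>i = \<langle>dX, e\<^sub>i\<rangle>\<close> and \<open>\<omega>\<^sub>i\<^sub>\<alpha> = \<langle>e\<^sub>i, dN\<^sub>\<alpha>\<rangle>\<close>: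
  since dX(u) is tangent, the sum over i is \<open>\<langle>dX(u), dN\<^sub>\<alpha>(v)\<rangle>\<close>.\<close>

definition second_form ::
  "(real^'n \<Rightarrow> 'e::euclidean_space) \<Rightarrow> ('m::finite \<Rightarrow> real^'n \<Rightarrow> 'e) \<Rightarrow> real^'n \<Rightarrow> real^'n \<Rightarrow> real^'n \<Rightarrow> 'e"
  where "second_form X N x u v = (\<Sum>j\<in>UNIV. (dif X x u \<bullet> dif (N j) x v) *\<^sub>R N j x)"

section \<open>Ribaucour transformations\<close>

text \<open>The lines p + tv and q + tw meet at a point equidistant from p and q. The second case is
  intersection at infinity, where the sphere through p and q with its centre on both lines
  degenerates to a hyperplane. It is needed because typically P reflects in the hyperplane
  orthogonal to \<open>\<ell>(x) - x\<close>, so that the two lines are parallel for the \<open>\<zeta>\<close> in that hyperplane.\<close>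

definition meet_equidistant :: "'e::euclidean_space \<Rightarrow> 'e \<Rightarrow> 'e \<Rightarrow> 'e \<Rightarrow> bool"
  where "meet_equidistant p v q w \<longleftrightarrow>
    (\<exists>t t'. p + t *\<^sub>R v = q + t' *\<^sub>R w \<and> dist (p + t *\<^sub>R v) p = dist (p + t *\<^sub>R v) q) \<or>
    ((\<exists>c. c \<noteq> 0 \<and> w = c *\<^sub>R v) \<and> v \<bullet> (q - p) = 0)"

text \<open>Only the values of P x on the normal space at x matter.\<close>

definition fibre_linear ::
  "(real^'n) set \<Rightarrow> (real^'n \<Rightarrow> 'e::euclidean_space) \<Rightarrow> (real^'n \<Rightarrow> 'e \<Rightarrow> 'e) \<Rightarrow> bool"
  where "fibre_linear V X P \<longleftrightarrow>
    (\<forall>x\<in>V. \<forall>\<zeta>\<in>normal_space X x. \<forall>\<zeta>'\<in>normal_space X x. \<forall>c.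
       P x (\<zeta> + c *\<^sub>R \<zeta>') = P x \<zeta> + c *\<^sub>R P x \<zeta>')"

definition normal_bundle_iso ::
  "(real^'n) set \<Rightarrow> (real^'n \<Rightarrow> 'e::euclidean_space) \<Rightarrow> (real^'n) set \<Rightarrow> (real^'n \<Rightarrow> 'e)
    \<Rightarrow> (real^'n \<Rightarrow> real^'n) \<Rightarrow> (real^'n \<Rightarrow> 'e \<Rightarrow> 'e) \<Rightarrow> bool"
  where "normal_bundle_iso V X V' X' l P \<longleftrightarrow>
    diffeomorphism_on V V' l \<and> fibre_linear V X P \<and>
    (\<forall>x\<in>V. bij_betw (P x) (normal_space X x) (normal_space X' (l x))) \<and>
    (\<forall>V0 \<zeta>. open V0 \<and> V0 \<subseteq> V \<and> normal_field V0 X \<zeta> \<longrightarrow> smooth_on V0 (\<lambda>x. P x (\<zeta> x)))"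

definition sphere_congruence ::
  "(real^'n) set \<Rightarrow> (real^'n \<Rightarrow> 'e::euclidean_space) \<Rightarrow> (real^'n) set \<Rightarrow> (real^'n \<Rightarrow> 'e)
    \<Rightarrow> (real^'n \<Rightarrow> real^'n) \<Rightarrow> (real^'n \<Rightarrow> 'e \<Rightarrow> 'e) \<Rightarrow> bool"
  where "sphere_congruence V X V' X' l P \<longleftrightarrow>
    open V \<and> immersion_on V X \<and> open V' \<and> immersion_on V' X' \<and>
    normal_bundle_iso V X V' X' l P \<and>
    (\<forall>V0 \<zeta>. open V0 \<and> V0 \<subseteq> V \<and> parallel_normal_field V0 X \<zeta> \<longrightarrow>
       parallel_normal_field (l ` V0) X' (\<lambda>y. P (inv_into V l y) (\<zeta> (inv_into V l y)))) \<and>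
    (\<forall>x\<in>V. \<forall>\<zeta>\<in>normal_space X x. \<zeta> \<noteq> 0 \<longrightarrow> meet_equidistant (X x) \<zeta> (X' (l x)) (P x \<zeta>))"

text \<open>The eigenvector e of the shape operators is a simultaneous one. For an arbitrary eigenvector of
  a single shape operator with a multiple eigenvalue the property is too strong: the Clifford torus in
  R^4 has an umbilic normal direction at every point, which P need not map to an umbilic one.\<close>

definition ribaucour_transformation ::
  "(real^'n) set \<Rightarrow> (real^'n \<Rightarrow> 'e::euclidean_space) \<Rightarrow> (real^'n) set \<Rightarrow> (real^'n \<Rightarrow> 'e)
    \<Rightarrow> (real^'n \<Rightarrow> real^'n) \<Rightarrow> (real^'n \<Rightarrow> 'e \<Rightarrow> 'e) \<Rightarrow> bool"
  where "ribaucour_transformation V X V' X' l P \<longleftrightarrow>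
    sphere_congruence V X V' X' l P \<and>
    (\<forall>x\<in>V. \<forall>u. principal_direction X x u \<longrightarrow>
       dif l x u \<noteq> 0 \<and>
       (\<forall>\<zeta>\<in>normal_space X x. \<exists>\<kappa>. shape_op X' (l x) (P x \<zeta>) *v dif l x u = \<kappa> *\<^sub>R dif l x u) \<and>
       meet_equidistant (X x) (dif X x u) (X' (l x)) (dif X' (l x) (dif l x u)))"

section \<open>The systems and their frames\<close>

text \<open>\<open>\<mu>\<close> is the spectral parameter.\<close>

definition block :: "'a^'m^'m \<Rightarrow> 'a^'n^'m \<Rightarrow> 'a^'m^'n \<Rightarrow> 'a^'n^'n \<Rightarrow> 'a^('m::finite+'n::finite)^('m+'n)"
  where "block P Q R S = (\<chi> k l.
    case k of
      Inl i \<Rightarrow> (case l of Inl j \<Rightarrow> P $ i $ j | Inr j \<Rightarrow> Q $ i $ j)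
    | Inr i \<Rightarrow> (case l of Inl j \<Rightarrow> R $ i $ j | Inr j \<Rightarrow> S $ i $ j))"

definition stack_vec :: "'a^'m \<Rightarrow> 'a^'n \<Rightarrow> 'a^('m::finite+'n::finite)"
  where "stack_vec p q = (\<chi> k. case k of Inl j \<Rightarrow> p $ j | Inr i \<Rightarrow> q $ i)"

abbreviation cmat :: "real^'c^'r \<Rightarrow> complex^'c^'r"
  where "cmat \<equiv> map_matrix complex_of_real"

definition cvec :: "real^'c \<Rightarrow> complex^'c"
  where "cvec v = (\<chi> i. complex_of_real (v $ i))"

definition cscale :: "complex \<Rightarrow> complex^'c^'r \<Rightarrow> complex^'c^'r"
  where "cscale c M = (\<chi> i j. c * M $ i $ j)"

definition C_mat :: "'n \<Rightarrow> real^'n^'n"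
  where "C_mat i = (\<chi> k l. if k = i \<and> l = i then 1 else 0)"

text \<open>An injection \<open>\<iota>\<close> of the index type of R^n into that of R^m tells which n of the m indices
  are the first ones; it carries the assumption that n is at most m. The last m - n rows (columns)
  are those with index outside the range of \<open>\<iota>\<close>.\<close>

definition D_mat :: "('n \<Rightarrow> 'm) \<Rightarrow> 'n \<Rightarrow> real^'n^'m"
  where "D_mat \<iota> i = (\<chi> k l. if k = \<iota> i \<and> l = i then 1 else 0)"

text \<open>F on top of G; the rows of G with index in the range of \<open>\<iota>\<close> are not used.\<close>

definition stack_mat :: "('n \<Rightarrow> 'm) \<Rightarrow> real^'n^'n \<Rightarrow> real^'n^'m \<Rightarrow> real^'n^'m"
  where "stack_mat \<iota> F G = (\<chi> k. if k \<in> range \<iota> then F $ (inv \<iota> k) else G $ k)"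

definition first_columns :: "('n \<Rightarrow> 'm) \<Rightarrow> real^'m^'m \<Rightarrow> real^'n^'m"
  where "first_columns \<iota> A = (\<chi> k l. A $ k $ (\<iota> l))"

definition I_mn :: "complex^('m::finite+'n::finite)^('m+'n)"
  where "I_mn = block (mat 1) 0 0 (- mat 1)"

definition flat_connection :: "(real^'n) set \<Rightarrow> ('n \<Rightarrow> real^'n \<Rightarrow> complex^'k^'k) \<Rightarrow> bool"
  where "flat_connection U \<theta> \<longleftrightarrow>
    (\<forall>x\<in>U. \<forall>i. \<theta> i differentiable at x) \<and>
    (\<forall>x\<in>U. \<forall>i j. pdif i (\<theta> j) x - pdif j (\<theta> i) x + (\<theta> i x ** \<theta> j x - \<theta> j x ** \<theta> i x) = 0)"

definition lax :: "('n::finite \<Rightarrow> 'm::finite) \<Rightarrow> (real^'n \<Rightarrow> real^'n^'m) \<Rightarrow> complex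
    \<Rightarrow> 'n \<Rightarrow> real^'n \<Rightarrow> complex^('m+'n)^('m+'n)"
  where "lax \<iota> \<xi> \<mu> i x =
    cscale \<mu> (cmat (block 0 (- D_mat \<iota> i) (transpose (D_mat \<iota> i)) 0)) +
    cmat (block (D_mat \<iota> i ** transpose (\<xi> x) - \<xi> x ** transpose (D_mat \<iota> i)) 0 0
                (- (transpose (\<xi> x) ** D_mat \<iota> i) + transpose (D_mat \<iota> i) ** \<xi> x))"

definition lax_I :: "(real^'n::finite \<Rightarrow> real^'n^'m::finite) \<Rightarrow> (real^'n \<Rightarrow> real^'n^'n) \<Rightarrow> complex
    \<Rightarrow> 'n \<Rightarrow> real^'n \<Rightarrow> complex^('m+'n)^('m+'n)"
  where "lax_I A1 F \<mu> i x =
    block 0 (- cscale \<mu> (cmat (A1 x ** C_mat i)))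
          (cscale \<mu> (cmat (C_mat i ** transpose (A1 x))))
          (cmat (- (transpose (F x) ** C_mat i) + C_mat i ** F x))"

definition Gmn_solution ::
  "('n::finite \<Rightarrow> 'm::finite) \<Rightarrow> (real^'n) set \<Rightarrow> (real^'n \<Rightarrow> real^'n^'m) \<Rightarrow> bool"
  where "Gmn_solution \<iota> U \<xi> \<longleftrightarrow>
    smooth_on U \<xi> \<and> (\<forall>x\<in>U. \<forall>i. \<xi> x $ \<iota> i $ i = 0) \<and> (\<forall>\<mu>. flat_connection U (lax \<iota> \<xi> \<mu>))"

definition GmnI_solution ::
  "(real^'n::finite) set \<Rightarrow> (real^'n \<Rightarrow> real^'n^'m::finite) \<Rightarrow> (real^'n \<Rightarrow> real^'n^'n) \<Rightarrow> bool"
  where "GmnI_solution U A1 F \<longleftrightarrow>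
    smooth_on U A1 \<and> smooth_on U F \<and>
    (\<forall>x\<in>U. transpose (A1 x) ** A1 x = mat 1) \<and> (\<forall>x\<in>U. \<forall>i. F x $ i $ i = 0) \<and>
    (\<forall>\<mu>. flat_connection U (lax_I A1 F \<mu>))"

definition reality_condition ::
  "(real^'n::finite) set \<Rightarrow> (real^'n \<Rightarrow> complex \<Rightarrow> complex^('m::finite+'n)^('m+'n)) \<Rightarrow> bool"
  where "reality_condition U E \<longleftrightarrow> (\<forall>x\<in>U. \<forall>\<mu>.
    (\<chi> k l. cnj (E x (cnj \<mu>) $ k $ l)) = E x \<mu> \<and>
    I_mn ** E x \<mu> ** matrix_inv I_mn = E x (- \<mu>) \<and>
    E x \<mu> ** transpose (E x \<mu>) = mat 1)"

definition frame_of ::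
  "(real^'n::finite) set \<Rightarrow> (complex \<Rightarrow> 'n \<Rightarrow> real^'n \<Rightarrow> complex^('m::finite+'n)^('m+'n))
    \<Rightarrow> (real^'n \<Rightarrow> complex \<Rightarrow> complex^('m+'n)^('m+'n)) \<Rightarrow> bool"
  where "frame_of U \<theta> E \<longleftrightarrow>
    (\<forall>x\<in>U. \<forall>\<mu>. invertible (E x \<mu>) \<and>
      ((\<lambda>y. E y \<mu>) has_derivative (\<lambda>v. E x \<mu> ** (\<Sum>i\<in>UNIV. v $ i *\<^sub>R \<theta> \<mu> i x))) (at x)) \<and>
    reality_condition U E"

text \<open>The functions b, \<open>A\<^sub>1\<close> and F read off from the fundamental forms of X relative to an orthonormal
  parallel normal frame N, in line of curvature coordinates. The \<open>b\<^sub>i\<close> need not be positive.\<close>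

definition GmnI_data ::
  "(real^'n) set \<Rightarrow> (real^'n \<Rightarrow> real^('m::finite+'n::finite)) \<Rightarrow> ('m \<Rightarrow> real^'n \<Rightarrow> real^('m+'n))
    \<Rightarrow> (real^'n \<Rightarrow> real^'n) \<Rightarrow> (real^'n \<Rightarrow> real^'n^'m) \<Rightarrow> (real^'n \<Rightarrow> real^'n^'n) \<Rightarrow> bool"
  where "GmnI_data U X N b A1 F \<longleftrightarrow>
    (\<forall>j. parallel_normal_field U X (N j)) \<and>
    (\<forall>x\<in>U. \<forall>j k. N j x \<bullet> N k x = (if j = k then 1 else 0)) \<and>
    smooth_on U b \<and> (\<forall>x\<in>U. \<forall>i. b x $ i \<noteq> 0) \<and>
    (\<forall>x\<in>U. \<forall>u v. dif X x u \<bullet> dif X x v = (\<Sum>i\<in>UNIV. (b x $ i)\<^sup>2 * u $ i * v $ i)) \<and>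
    (\<forall>x\<in>U. \<forall>u v. second_form X N x u v =
       (\<Sum>i\<in>UNIV. \<Sum>j\<in>UNIV. (b x $ i * A1 x $ j $ i * u $ i * v $ i) *\<^sub>R N j x)) \<and>
    (\<forall>x\<in>U. transpose (A1 x) ** A1 x = mat 1) \<and>
    (\<forall>x\<in>U. \<forall>i j. F x $ i $ j = (if i = j then 0 else pdif j (\<lambda>y. b y $ i) x / b x $ j))"

text \<open>The matrix with columns N_1, ..., N_m, (1/b_1) X_{x_1}, ..., (1/b_n) X_{x_n}.\<close>

definition adapted_frame ::
  "(real^'n \<Rightarrow> real^('m::finite+'n::finite)) \<Rightarrow> ('m \<Rightarrow> real^'n \<Rightarrow> real^('m+'n)) \<Rightarrow> (real^'n \<Rightarrow> real^'n)
    \<Rightarrow> real^'n \<Rightarrow> real^('m+'n)^('m+'n)"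
  where "adapted_frame X N b x = (\<chi> k l. case l of
      Inl j \<Rightarrow> N j x $ k
    | Inr i \<Rightarrow> ((1 / b x $ i) *\<^sub>R pdif i X x) $ k)"

section \<open>The dressing action\<close>

text \<open>\<open>E(x,-is)\<^sup>-\<^sup>1\<close> applied to the vector (W, iZ); by the reality condition on E the first block of the
  result is real and the second one is i times a real vector.\<close>

definition dressed :: "(real^'n::finite \<Rightarrow> complex \<Rightarrow> complex^('m::finite+'n)^('m+'n))
    \<Rightarrow> real \<Rightarrow> real^'m \<Rightarrow> real^'n \<Rightarrow> real^'n \<Rightarrow> complex^('m+'n)"
  where "dressed E s W Z x =
    matrix_inv (E x (- \<i> * complex_of_real s)) *v stack_vec (cvec W) (\<chi> i. \<i> * complex_of_real (Z $ i))"

definition W_tilde :: "(real^'n::finite \<Rightarrow> complex \<Rightarrow> complex^('m::finite+'n)^('m+'n))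
    \<Rightarrow> real \<Rightarrow> real^'m \<Rightarrow> real^'n \<Rightarrow> real^'n \<Rightarrow> real^'m"
  where "W_tilde E s W Z x = (\<chi> j. Re (dressed E s W Z x $ Inl j))"

definition Z_tilde :: "(real^'n::finite \<Rightarrow> complex \<Rightarrow> complex^('m::finite+'n)^('m+'n))
    \<Rightarrow> real \<Rightarrow> real^'m \<Rightarrow> real^'n \<Rightarrow> real^'n \<Rightarrow> real^'n"
  where "Z_tilde E s W Z x = (\<chi> i. Im (dressed E s W Z x $ Inr i))"

definition A1_tilde :: "('n::finite \<Rightarrow> 'm::finite) \<Rightarrow> (real^'n \<Rightarrow> real^'m^'m) \<Rightarrow> (real^'n \<Rightarrow> real^'m)
    \<Rightarrow> real^'n \<Rightarrow> real^'n^'m"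
  where "A1_tilde \<iota> A Wh x =
    first_columns \<iota> (A x ** (mat 1 - 2 *\<^sub>R (\<chi> k l. Wh x $ k * Wh x $ l)))"

definition F_tilde :: "('n::finite \<Rightarrow> 'm::finite) \<Rightarrow> real \<Rightarrow> (real^'n \<Rightarrow> real^'n^'n) \<Rightarrow> (real^'n \<Rightarrow> real^'m)
    \<Rightarrow> (real^'n \<Rightarrow> real^'n) \<Rightarrow> real^'n \<Rightarrow> real^'n^'n"
  where "F_tilde \<iota> s F Wh Zh x =
    (\<chi> i j. if i = j then 0 else F x $ i $ j - 2 * s * Wh x $ \<iota> i * Zh x $ j)"

definition EI_tilde :: "real \<Rightarrow> (real^'n::finite \<Rightarrow> complex \<Rightarrow> complex^('m::finite+'n)^('m+'n))
    \<Rightarrow> (real^'n \<Rightarrow> real^'m^'m) \<Rightarrow> (real^'n \<Rightarrow> real^'m) \<Rightarrow> (real^'n \<Rightarrow> real^'n)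
    \<Rightarrow> real^'n \<Rightarrow> complex \<Rightarrow> complex^('m+'n)^('m+'n)"
  where "EI_tilde s EI A Wh Zh x \<mu> =
    (let p = stack_vec (\<mu> *s cvec (A x *v Wh x)) (complex_of_real s *s cvec (Zh x))
     in EI x \<mu> ** (mat 1 - cscale (2 / (\<mu>\<^sup>2 + (complex_of_real s)\<^sup>2)) (\<chi> k l. p $ k * p $ l)))"

end

theory Submission
  imports Defs
begin

text \<open>Put \<open>y = A Wt\<close> and \<open>z = Zt\<close>, so that \<open>(y, iz) = E\<^sup>I(x,-is)\<^sup>-\<^sup>1(W, iZ)\<close>, let \<open>w\<^sub>i\<close> be the
  i-th coordinate of Wt and \<open>r = \<parallel>y\<parallel> = \<parallel>z\<parallel>\<close>. The vector \<open>h = (\<Sum>y\<^sub>j N\<^sub>j + s \<Sum>z\<^sub>k e\<^sub>k)/(1 + s\<^sup>2)\<close> is a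
  multiple of \<open>\<eta>\<close> with \<open>\<partial>\<^sub>i h = w\<^sub>i e\<^sub>i\<close>. Hence \<open>X' = X + (2\<phi>/r\<^sup>2) h\<close> has \<open>\<partial>\<^sub>i X' = b'\<^sub>i R e\<^sub>i\<close>, where R
  is the reflection in the hyperplane orthogonal to h and \<open>b'\<^sub>i = b\<^sub>i + 2\<phi> w\<^sub>i/r\<^sup>2\<close>. The normal vectors
  \<open>N'\<^sub>j = R N\<^sub>j\<close> have derivatives \<open>\<partial>\<^sub>i N'\<^sub>j = a'\<^sub>j\<^sub>i R e\<^sub>i\<close> without normal component, so that \<open>(N', R e)\<close> is again
  an adapted frame, and the Ribaucour property holds because \<open>X' - X\<close> is parallel to h. The same
  transformation, applied to an isometry from the metric of X to flat space, gives one for the metric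
  of X'. The potential \<open>\<phi>\<close> exists because line integrals of closed forms are invariant under
  polynomial homotopies, which approximate arbitrary ones.\<close>

section \<open>Calculus of smooth maps\<close>

text \<open>Three values of the frame \<open>EI\<close> do the work. At \<open>1\<close> it is the
  adapted frame; at \<open>-is\<close> it relates \<open>(W, iZ)\<close> to \<open>(y, iz)\<close>;
  at \<open>0\<close> it is block diagonal, and the columns \<open>B\<close> of its lower right
  block obey the equations of the tangent frame with the normal terms deleted, so that they unroll
  the metric onto R^n. The frame \<open>E\<close> enters only through \<open>Wt = A^t y\<close>; as
  the first columns of \<open>A\<close> are \<open>A1\<close>, this makes \<open>w = A1^t y\<close>.
  All equations are then real and linear, and the new solution is verified on its coefficients,
  without differentiating the dressed frame. The factor \<open>1/(1 + s^2)\<close> in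
  \<open>h\<close> arises because \<open>y\<close> and \<open>s z\<close> contribute
  \<open>w_i e_i\<close> and \<open>s^2 w_i e_i\<close> to the derivative. Since \<open>y\<close>
  and \<open>z\<close> have equal norm \<open>r\<close>, this gives
  \<open>2/|h|^2 = (1 + s^2) q\<close> with \<open>q = 2/r^2\<close>. At parameter \<open>0\<close>
  the counterpart of \<open>h\<close> has no \<open>y\<close>-part, and its factor is
  \<open>1/s\<close>. The obstacle is that \<open>X'\<close> is singular where some
  \<open>b'_i\<close> vanishes, which depends on the free additive constant in
  \<open>\<phi>\<close>. The geometry is therefore stated on an open subset \<open>V \<phi>\<close>,
  and only finitely many values of \<open>\<phi>\<close> at a point exclude that point.\<close>

lemma cont_diff_cong:
  assumes "open U" "\<And>x. x \<in> U \<Longrightarrow> f x = g x" "cont_diff k U f"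
  shows "cont_diff k U g"
  using assms(2,3)
proof (induction k arbitrary: f g)
  case 0
  then show ?case by (metis cont_diff.simps(1) continuous_on_cong)
next
  case (Suc k)
  have D: "(f has_derivative dif f x) (at x)" if "x \<in> U" for x
    using Suc.prems(2) that by (simp add: frechet_derivative_works)
  have D': "(g has_derivative dif f x) (at x)" if "x \<in> U" for x
    using has_derivative_transform_within_open[OF D[OF that] assms(1) that] Suc.prems(1) by blast
  have "cont_diff k U (\<lambda>x. dif g x v)" for v
  proof (rule Suc.IH)
    show "cont_diff k U (\<lambda>x. dif f x v)" using Suc.prems(2) by simp
    show "dif f x v = dif g x v" if "x \<in> U" for x
      using frechet_derivative_at[OF D'[OF that]] by simp
  qed
  then show ?case
    using D' by (auto simp: differentiable_def)
qed

lemma cont_diff_subset: "cont_diff k U f \<Longrightarrow> V \<subseteq> U \<Longrightarrow> cont_diff k V f"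
  by (induction k arbitrary: f) (auto intro: continuous_on_subset)

text \<open>The recursion in \<open>cont_diff\<close> refers to the chosen
  \<open>frechet_derivative\<close>; by uniqueness any derivative delivered by a differentiation
  rule may stand in for it.\<close>

lemma cont_diff_SucI:
  assumes "open U" "\<And>x. x \<in> U \<Longrightarrow> (f has_derivative f' x) (at x)"
    and "\<And>v. cont_diff k U (\<lambda>x. f' x v)"
  shows "cont_diff (Suc k) U f"
proof -
  have "cont_diff k U (\<lambda>x. dif f x v)" for v
    by (rule cont_diff_cong[OF assms(1) _ assms(3)[of v]])
      (simp flip: frechet_derivative_at[OF assms(2)])
  then show ?thesis using assms(2) by (auto simp: differentiable_def)
qed

lemma cont_diff_imp_continuous_on: "cont_diff k U f \<Longrightarrow> continuous_on U f"
  by (cases k)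
    (auto intro!: continuous_at_imp_continuous_on differentiable_imp_continuous_within)

text \<open>Product rules leave undifferentiated factors beside differentiated ones, so inductions
  on the order need the hypothesis one order lower as well.\<close>

lemma cont_diff_mono_order: "cont_diff (Suc k) U f \<Longrightarrow> cont_diff k U f"
proof (induction k arbitrary: f)
  case 0
  then show ?case using cont_diff_imp_continuous_on[of "Suc 0" U f] by simp
next
  case (Suc k)
  then have "cont_diff k U (\<lambda>x. dif f x v)" for v
    by (metis cont_diff.simps(2))
  moreover have "\<forall>x\<in>U. f differentiable at x"
    using Suc.prems by (meson cont_diff.simps(2))
  ultimately show ?case by simp
qed

lemma cont_diff_const: "cont_diff k U (\<lambda>x. c)"
  by (induction k arbitrary: c) simp_all

lemma cont_diff_has_derivative:
  "cont_diff (Suc k) U f \<Longrightarrow> x \<in> U \<Longrightarrow> (f has_derivative dif f x) (at x)"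
  by (simp add: frechet_derivative_works)

lemma cont_diff_bounded_linear:
  assumes L: "bounded_linear L" and U: "open U" and f: "cont_diff k U f"
  shows "cont_diff k U (\<lambda>x. L (f x))"
  using f
proof (induction k arbitrary: f)
  case 0
  then show ?case using L by (simp add: linear_continuous_on_compose linear_conv_bounded_linear
        bounded_linear.continuous_on)
next
  case (Suc k)
  show ?case
    by (rule cont_diff_SucI[OF U, of _ "\<lambda>x v. L (dif f x v)"])
      (use Suc in \<open>auto intro!: bounded_linear.has_derivative[OF L] simp flip: frechet_derivative_works\<close>)
qed

lemma cont_diff_id:
  assumes "open U"
  shows "cont_diff k U (\<lambda>x. x)"
proof (cases k)
  case (Suc l)
  then show ?thesis
    using cont_diff_SucI[OF assms has_derivative_ident cont_diff_const] by simp
qed simp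

lemma cont_diff_add:
  assumes U: "open U" and "cont_diff k U f" "cont_diff k U g"
  shows "cont_diff k U (\<lambda>x. f x + g x)"
  using assms(2,3)
proof (induction k arbitrary: f g)
  case 0
  then show ?case by (simp add: continuous_on_add)
next
  case (Suc k)
  show ?case
    by (rule cont_diff_SucI[OF U, of _ "\<lambda>x v. dif f x v + dif g x v"])
      (use Suc in \<open>auto intro!: has_derivative_add simp flip: frechet_derivative_works\<close>)
qed

lemma cont_diff_bilinear:
  assumes p: "bounded_bilinear p" and U: "open U" and "cont_diff k U f" "cont_diff k U g"
  shows "cont_diff k U (\<lambda>x. p (f x) (g x))"
  using assms(3,4)
proof (induction k arbitrary: f g)
  case 0
  then show ?case by (simp add: bounded_bilinear.continuous_on[OF p])
next
  case (Suc k)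
  have "cont_diff k U f" "cont_diff k U g"
    using Suc.prems cont_diff_mono_order by blast+
  moreover have "cont_diff k U (\<lambda>x. dif f x v)" "cont_diff k U (\<lambda>x. dif g x v)" for v
    using Suc.prems by simp_all
  ultimately show ?case
    by (intro cont_diff_SucI[OF U bounded_bilinear.FDERIV[OF p cont_diff_has_derivative[OF Suc.prems(1)]
            cont_diff_has_derivative[OF Suc.prems(2)]]] cont_diff_add[OF U] Suc.IH)
qed

text \<open>The derivative \<open>- inverse f * f' * inverse f\<close> contains the inverse
  undifferentiated, so the induction hypothesis covers it.\<close>

lemma cont_diff_inverse:
  fixes f :: "'a::real_normed_vector \<Rightarrow> real"
  assumes U: "open U" and "cont_diff k U f" and nz: "\<And>x. x \<in> U \<Longrightarrow> f x \<noteq> 0"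
  shows "cont_diff k U (\<lambda>x. inverse (f x))"
  using assms(2)
proof (induction k)
  case 0
  then show ?case using nz by (auto intro: continuous_on_inverse)
next
  case (Suc k)
  have "cont_diff k U (\<lambda>x. inverse (f x))"
    using Suc cont_diff_mono_order by blast
  moreover have "cont_diff k U (\<lambda>x. (- 1) * dif f x v)" for v
    using Suc.prems cont_diff_const[of k U "-1"]
    by (intro cont_diff_bilinear[OF bounded_bilinear_mult U]) simp_all
  ultimately have "cont_diff k U (\<lambda>x. inverse (f x) * ((- 1) * dif f x v) * inverse (f x))" for v
    by (intro cont_diff_bilinear[OF bounded_bilinear_mult U
          cont_diff_bilinear[OF bounded_bilinear_mult U, of _ "\<lambda>x. inverse (f x)"]])
  then have "cont_diff k U (\<lambda>x. - (inverse (f x) * dif f x v * inverse (f x)))" for v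
    by simp
  then show ?case
    by (intro cont_diff_SucI[OF U Deriv.has_derivative_inverse[OF _ cont_diff_has_derivative[OF Suc.prems]]] nz)
qed

section \<open>Rules for smoothness of all orders\<close>

lemma smooth_on_cong: "open U \<Longrightarrow> smooth_on U f \<Longrightarrow> (\<And>x. x \<in> U \<Longrightarrow> f x = g x) \<Longrightarrow> smooth_on U g"
  unfolding smooth_on_def using cont_diff_cong by blast

lemma smooth_on_subset: "smooth_on U f \<Longrightarrow> V \<subseteq> U \<Longrightarrow> smooth_on V f"
  unfolding smooth_on_def using cont_diff_subset by blast

lemma smooth_on_const: "smooth_on U (\<lambda>x. c)"
  by (simp add: smooth_on_def cont_diff_const)

lemma smooth_on_id: "open U \<Longrightarrow> smooth_on U (\<lambda>x. x)"
  by (simp add: smooth_on_def cont_diff_id)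

lemma smooth_on_bounded_linear:
  "bounded_linear L \<Longrightarrow> open U \<Longrightarrow> smooth_on U f \<Longrightarrow> smooth_on U (\<lambda>x. L (f x))"
  by (simp add: smooth_on_def cont_diff_bounded_linear)

lemma smooth_on_add: "open U \<Longrightarrow> smooth_on U f \<Longrightarrow> smooth_on U g \<Longrightarrow> smooth_on U (\<lambda>x. f x + g x)"
  by (simp add: smooth_on_def cont_diff_add)

lemma smooth_on_bilinear:
  "bounded_bilinear p \<Longrightarrow> open U \<Longrightarrow> smooth_on U f \<Longrightarrow> smooth_on U g \<Longrightarrow>
    smooth_on U (\<lambda>x. p (f x) (g x))"
  by (simp add: smooth_on_def cont_diff_bilinear)

lemmas smooth_on_scaleR = smooth_on_bilinear[OF bounded_bilinear_scaleR]
lemmas smooth_on_inner = smooth_on_bilinear[OF bounded_bilinear_inner]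

lemma smooth_on_mult:
  fixes f g :: "'a::real_normed_vector \<Rightarrow> 'b::real_normed_algebra"
  shows "open U \<Longrightarrow> smooth_on U f \<Longrightarrow> smooth_on U g \<Longrightarrow> smooth_on U (\<lambda>x. f x * g x)"
  by (rule smooth_on_bilinear[OF bounded_bilinear_mult])

lemma smooth_on_minus: "open U \<Longrightarrow> smooth_on U f \<Longrightarrow> smooth_on U (\<lambda>x. - f x)"
  by (rule smooth_on_bounded_linear[OF bounded_linear_minus[OF bounded_linear_ident]])

lemma smooth_on_diff:
  "open U \<Longrightarrow> smooth_on U f \<Longrightarrow> smooth_on U g \<Longrightarrow> smooth_on U (\<lambda>x. f x - g x)"
  using smooth_on_add[OF _ _ smooth_on_minus] by fastforce

lemma smooth_on_divide:
  fixes f g :: "'a::real_normed_vector \<Rightarrow> real"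
  assumes "open U" "smooth_on U f" "smooth_on U g" "\<And>x. x \<in> U \<Longrightarrow> g x \<noteq> 0"
  shows "smooth_on U (\<lambda>x. f x / g x)"
proof -
  have "smooth_on U (\<lambda>x. inverse (g x))"
    using assms by (simp add: smooth_on_def cont_diff_inverse)
  then show ?thesis
    using smooth_on_mult assms by (fastforce simp: divide_inverse)
qed

lemma smooth_on_sum:
  assumes "open U" "\<And>i. i \<in> I \<Longrightarrow> smooth_on U (f i)"
  shows "smooth_on U (\<lambda>x. \<Sum>i\<in>I. f i x)"
  using assms(2)
  by (induction I rule: infinite_finite_induct)
    (simp_all add: smooth_on_const smooth_on_add assms(1))

lemma smooth_on_nth: "open U \<Longrightarrow> smooth_on U f \<Longrightarrow> smooth_on U (\<lambda>x. f x $ i)"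
  by (rule smooth_on_bounded_linear[OF bounded_linear_vec_nth])

lemma smooth_on_vec_iff:
  fixes f :: "'a::real_normed_vector \<Rightarrow> 'b::real_normed_vector^'k::finite"
  assumes U: "open U"
  shows "smooth_on U f \<longleftrightarrow> (\<forall>i. smooth_on U (\<lambda>x. f x $ i))"
proof safe
  assume *: "\<forall>i. smooth_on U (\<lambda>x. f x $ i)"
  have axis: "bounded_linear (axis i :: 'b \<Rightarrow> 'b^'k)" for i
  proof (rule bounded_linear_intro[of _ 1])
    show "norm (axis i y :: 'b^'k) \<le> norm y * 1" for y :: 'b
      unfolding norm_vec_def
      by (rule order_trans[OF L2_set_le_sum]) (simp_all add: axis_def if_distrib cong: if_cong)
  qed (auto simp: axis_def vec_eq_iff)
  have "smooth_on U (\<lambda>x. \<Sum>i\<in>UNIV. axis i (f x $ i))"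
    by (rule smooth_on_sum[OF U], rule smooth_on_bounded_linear[OF _ U]) (simp_all add: * axis)
  moreover have "(\<Sum>i\<in>UNIV. axis i (v $ i)) = v" for v :: "'b^'k"
    by (auto simp: vec_eq_iff axis_def if_distrib cong: if_cong)
  ultimately show "smooth_on U f" by simp
qed (rule smooth_on_nth[OF U])

lemma smooth_on_dif:
  "smooth_on U f \<Longrightarrow> smooth_on U (\<lambda>x. dif f x v)"
  unfolding smooth_on_def by (metis cont_diff.simps(2))

lemma smooth_on_has_derivative:
  "smooth_on U f \<Longrightarrow> x \<in> U \<Longrightarrow> (f has_derivative dif f x) (at x)"
  unfolding smooth_on_def using cont_diff_has_derivative by blast

lemma smooth_on_imp_continuous_on: "smooth_on U f \<Longrightarrow> continuous_on U f"
  unfolding smooth_on_def using cont_diff_imp_continuous_on by blast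

lemma real_polynomial_function_smooth_on:
  "real_polynomial_function f \<Longrightarrow> smooth_on UNIV f"
proof (induction rule: real_polynomial_function.induct)
  case (linear h)
  then show ?case
    by (intro smooth_on_bounded_linear[of h, OF _ open_UNIV smooth_on_id]) auto
qed (auto intro: smooth_on_const smooth_on_add smooth_on_mult)

lemma polynomial_function_smooth_on:
  fixes f :: "'a::real_normed_vector \<Rightarrow> 'b::euclidean_space"
  assumes "polynomial_function f"
  shows "smooth_on UNIV f"
proof -
  have "smooth_on UNIV (\<lambda>x. \<Sum>b\<in>Basis. (f x \<bullet> b) *\<^sub>R b)"
    using assms
    by (intro smooth_on_sum smooth_on_scaleR smooth_on_const real_polynomial_function_smooth_on)
      (auto simp: polynomial_function_iff_Basis_inner)
  then show ?thesis by (simp add: euclidean_representation)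
qed

lemma smooth_on_has_vector_derivative_line:
  assumes "smooth_on U k" "y + t *\<^sub>R v \<in> U"
  shows "((\<lambda>t. k (y + t *\<^sub>R v)) has_vector_derivative dif k (y + t *\<^sub>R v) v) (at t within S)"
proof -
  have k: "(k has_derivative dif k (y + t *\<^sub>R v)) (at (y + t *\<^sub>R v))"
    using smooth_on_has_derivative assms by blast
  have "((\<lambda>t. y + t *\<^sub>R v) has_derivative (\<lambda>c. c *\<^sub>R v)) (at t within S)"
    by (auto intro!: derivative_eq_intros)
  from has_derivative_compose[OF this k] show ?thesis
    unfolding has_vector_derivative_def
    by (simp add: linear_scale[OF has_derivative_linear[OF k]])
qed

text \<open>Both sides are the derivative in t at 0 of
  \<open>f(x + tv + su) = f(x + su) + \<integral>\<^sub>0\<^sup>t \<partial>\<^sub>v f(x + \<tau>v + su) d\<tau>\<close>, differentiated in s at 0.\<close>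
lemma dif_commute:
  fixes f :: "'a::real_normed_vector \<Rightarrow> 'b::banach"
  assumes U: "open U" "x \<in> U" and f: "smooth_on U f"
  shows "dif (\<lambda>y. dif f y u) x v = dif (\<lambda>y. dif f y v) x u"
proof -
  obtain r where r: "r > 0" "ball x r \<subseteq> U"
    using U openE by blast
  obtain d where d: "d > 0" "d * (norm u + norm v) < r"
  proof
    show "0 < r / (norm u + norm v + 1)" using r(1) by (simp add: add_nonneg_pos)
    have "0 \<le> norm u + norm v" by simp
    then show "r / (norm u + norm v + 1) * (norm u + norm v) < r"
      using r(1) mult_strict_left_mono[of "norm u + norm v" "norm u + norm v + 1" r]
      by (simp add: divide_less_eq add_nonneg_pos)
  qed
  have inU: "x + a *\<^sub>R u + b *\<^sub>R v \<in> U" if "\<bar>a\<bar> \<le> d" "\<bar>b\<bar> \<le> d" for a b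
  proof -
    have "norm (a *\<^sub>R u + b *\<^sub>R v) \<le> d * norm u + d * norm v"
      using that by (intro norm_triangle_le add_mono) (auto intro!: mult_right_mono)
    then have "dist x (x + a *\<^sub>R u + b *\<^sub>R v) < r"
      using d(2) norm_minus_commute[of x "x + a *\<^sub>R u + b *\<^sub>R v"]
      by (simp add: dist_norm add.assoc distrib_left)
    then show ?thesis using r by auto
  qed
  define g where "g y = dif f y v" for y
  have g: "smooth_on U g" unfolding g_def by (rule smooth_on_dif[OF f])
  define h where "h y = dif f y u" for y
  have h: "smooth_on U h" unfolding h_def by (rule smooth_on_dif[OF f])
  have lin': "((\<lambda>b. k (x + a *\<^sub>R u + b *\<^sub>R v)) has_vector_derivative dif k (x + a *\<^sub>R u + b *\<^sub>R v) v)
     (at b within S)"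
    if "\<bar>a\<bar> \<le> d" "\<bar>b\<bar> \<le> d" "smooth_on U k" for a b S and k :: "'a \<Rightarrow> 'b"
    using that by (intro smooth_on_has_vector_derivative_line[of U] inU)
  have lin: "((\<lambda>a. k (x + a *\<^sub>R u + b *\<^sub>R v)) has_vector_derivative dif k (x + a *\<^sub>R u + b *\<^sub>R v) u)
     (at a within S)"
    if "\<bar>a\<bar> \<le> d" "\<bar>b\<bar> \<le> d" "smooth_on U k" for a b S and k :: "'a \<Rightarrow> 'b"
  proof -
    have eq: "x + c *\<^sub>R u + b *\<^sub>R v = (x + b *\<^sub>R v) + c *\<^sub>R u" for c by simp
    have "((\<lambda>a. k (x + b *\<^sub>R v + a *\<^sub>R u)) has_vector_derivative dif k (x + b *\<^sub>R v + a *\<^sub>R u) u)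
       (at a within S)"
      using that inU[of a b] by (intro smooth_on_has_vector_derivative_line[of U]) (simp_all only: eq)
    then show ?thesis by (simp only: eq)
  qed
  have cont: "continuous_on S (\<lambda>p. k (x + fst p *\<^sub>R u + snd p *\<^sub>R v))"
    if "\<And>p. p \<in> S \<Longrightarrow> \<bar>fst p\<bar> \<le> d \<and> \<bar>snd p\<bar> \<le> d" "continuous_on U k" for S and k :: "'a \<Rightarrow> 'b"
  proof (rule continuous_on_compose2[OF that(2)])
    show "continuous_on S (\<lambda>p. x + fst p *\<^sub>R u + snd p *\<^sub>R v)"
      by (intro continuous_intros)
  qed (use that(1) inU in blast)
  have cont1: "continuous_on S (\<lambda>t. k (x + a *\<^sub>R u + t *\<^sub>R v))"
    if "\<And>t. t \<in> S \<Longrightarrow> \<bar>t\<bar> \<le> d" "\<bar>a\<bar> \<le> d" "continuous_on U k" for S a and k :: "'a \<Rightarrow> 'b"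
  proof (rule continuous_on_compose2[OF that(3)])
    show "continuous_on S (\<lambda>t. x + a *\<^sub>R u + t *\<^sub>R v)"
      by (intro continuous_intros)
  qed (use that(1,2) inU in blast)
  have I: "f (x + a *\<^sub>R u + b *\<^sub>R v) = f (x + a *\<^sub>R u) + integral (cbox 0 b) (\<lambda>t. g (x + a *\<^sub>R u + t *\<^sub>R v))"
    if "\<bar>a\<bar> \<le> d" "0 \<le> b" "b \<le> d" for a b
  proof -
    have "((\<lambda>t. g (x + a *\<^sub>R u + t *\<^sub>R v)) has_integral
       f (x + a *\<^sub>R u + b *\<^sub>R v) - f (x + a *\<^sub>R u + 0 *\<^sub>R v)) {0..b}"
      unfolding g_def using that
      by (intro fundamental_theorem_of_calculus lin'[OF _ _ f]) auto
    then show ?thesis by (simp add: integral_unique)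
  qed
  \<comment> \<open>Differentiate \<open>I\<close> in \<open>a\<close> at 0: directly on the left,
    and by the Leibniz rule under the integral on the right.\<close>
  have J: "h (x + b *\<^sub>R v) = h x + integral {0..b} (\<lambda>t. dif g (x + t *\<^sub>R v) u)" if "0 \<le> b" "b \<le> d" for b
  proof -
    have "((\<lambda>a. integral (cbox 0 b) (\<lambda>t. g (x + a *\<^sub>R u + t *\<^sub>R v))) has_vector_derivative
       integral (cbox 0 b) (\<lambda>t. dif g (x + 0 *\<^sub>R u + t *\<^sub>R v) u)) (at 0 within {-d..d})"
      using that d(1)
      by (intro leibniz_rule_vector_derivative lin[OF _ _ g] integrable_continuous cont1)
        (auto intro!: smooth_on_imp_continuous_on[OF g] simp: split_beta
          intro!: cont[OF _ smooth_on_imp_continuous_on[OF smooth_on_dif[OF g]]])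
    moreover have "((\<lambda>a. f (x + a *\<^sub>R u + 0 *\<^sub>R v)) has_vector_derivative h (x + 0 *\<^sub>R u + 0 *\<^sub>R v)) (at 0 within {-d..d})"
      unfolding h_def using d(1) by (intro lin f) auto
    ultimately have *: "((\<lambda>a. f (x + a *\<^sub>R u) + integral (cbox 0 b) (\<lambda>t. g (x + a *\<^sub>R u + t *\<^sub>R v))) has_vector_derivative
       h x + integral {0..b} (\<lambda>t. dif g (x + t *\<^sub>R v) u)) (at 0 within {-d..d})"
      using has_vector_derivative_add by fastforce
    have **: "((\<lambda>a. f (x + a *\<^sub>R u + b *\<^sub>R v)) has_vector_derivative
       h x + integral {0..b} (\<lambda>t. dif g (x + t *\<^sub>R v) u)) (at 0 within {-d..d})"
      by (rule has_vector_derivative_transform[OF _ _ *]) (use that d(1) I in auto)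
    have "((\<lambda>a. f (x + a *\<^sub>R u + b *\<^sub>R v)) has_vector_derivative h (x + 0 *\<^sub>R u + b *\<^sub>R v)) (at 0 within {-d..d})"
      unfolding h_def using that d(1) by (intro lin f) auto
    then show ?thesis
      using vector_derivative_unique_within[OF _ ** ] d(1)
      by (smt (verit, best) add.right_neutral at_within_Icc_at scale_eq_0_iff trivial_limit_at)
  qed
  \<comment> \<open>The formula \<open>J\<close> is available only for \<open>b\<close> at least 0,
    so the derivatives in \<open>b\<close> are taken from the right; on an interval of positive
    length they are still unique.\<close>
  have "((\<lambda>b. integral {0..b} (\<lambda>t. dif g (x + t *\<^sub>R v) u)) has_vector_derivative dif g (x + 0 *\<^sub>R v) u)
     (at 0 within {0..d})"
    using cont1[of "{0..d}" 0, OF _ _ smooth_on_imp_continuous_on[OF smooth_on_dif[OF g]]] d(1)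
    by (intro integral_has_vector_derivative) auto
  from has_vector_derivative_add[OF has_vector_derivative_const[of "h x"] this]
  have "((\<lambda>b. h x + integral {0..b} (\<lambda>t. dif g (x + t *\<^sub>R v) u)) has_vector_derivative dif g x u)
     (at 0 within {0..d})"
    by simp
  then have *: "((\<lambda>b. h (x + b *\<^sub>R v)) has_vector_derivative dif g x u) (at 0 within {0..d})"
    by (rule has_vector_derivative_transform[rotated 2]) (use J d(1) in auto)
  have "((\<lambda>b. h (x + b *\<^sub>R v)) has_vector_derivative dif h x v) (at 0 within {0..d})"
    using smooth_on_has_vector_derivative_line[OF h, of x 0 v] U(2) by simp
  then have "dif h x v = dif g x u"
    using vector_derivative_unique_within[OF _ _ *] d(1)
    by (simp add: trivial_limit_within islimpt_Icc)
  then show ?thesis by (simp add: h_def[abs_def] g_def[abs_def])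
qed

section \<open>Potentials on simply connected domains\<close>

definition line_integral :: "('a::real_inner \<Rightarrow> 'a) \<Rightarrow> (real \<Rightarrow> 'a) \<Rightarrow> real"
  where "line_integral w p = integral {0..1} (\<lambda>t. w (p t) \<bullet> vector_derivative p (at t))"

text \<open>Smoothness gives continuity of the derivative in the base point for each fixed
  direction. Expanding the direction in a basis makes it jointly continuous.\<close>

lemma continuous_on_dif:
  fixes w :: "'a::euclidean_space \<Rightarrow> 'b::real_normed_vector"
  assumes w: "smooth_on U w" and g: "continuous_on S g" and h: "continuous_on S h"
    and U: "\<And>p. p \<in> S \<Longrightarrow> g p \<in> U"
  shows "continuous_on S (\<lambda>p. dif w (g p) (h p))"
proof -
  have "continuous_on S (\<lambda>p. \<Sum>b\<in>Basis. (h p \<bullet> b) *\<^sub>R dif w (g p) b)"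
    by (intro continuous_intros h
        continuous_on_compose2[OF smooth_on_imp_continuous_on[OF smooth_on_dif[OF w]] g])
      (use U in auto)
  moreover have "(\<Sum>b\<in>Basis. (h p \<bullet> b) *\<^sub>R dif w (g p) b) = dif w (g p) (h p)" if "p \<in> S" for p
  proof -
    have lin: "linear (dif w (g p))"
      using smooth_on_has_derivative[OF w U[OF that]] has_derivative_linear by blast
    have "dif w (g p) (h p) = dif w (g p) (\<Sum>b\<in>Basis. (h p \<bullet> b) *\<^sub>R b)"
      by (simp add: euclidean_representation)
    also have "\<dots> = (\<Sum>b\<in>Basis. (h p \<bullet> b) *\<^sub>R dif w (g p) b)"
      by (simp add: linear_sum[OF lin] linear_scale[OF lin])
    finally show ?thesis by simp
  qed
  ultimately show ?thesis
    using continuous_on_cong[of S S] by (smt (verit))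
qed

text \<open>Closedness makes the \<open>c\<close>-derivative of \<open>w(H) \<bullet> Ht\<close>
  equal to the \<open>t\<close>-derivative of \<open>w(H) \<bullet> Hs\<close>, so only boundary
  terms are left. The derivatives of \<open>H\<close> are passed as separate functions because the
  lemma serves two variations: a polynomial homotopy with fixed ends, and one that moves the end
  point along a straight line.\<close>

lemma line_integral_variation:
  fixes w :: "'a::euclidean_space \<Rightarrow> 'a" and H Hs Ht Hst :: "real \<Rightarrow> real \<Rightarrow> 'a"
  assumes w: "smooth_on U w"
    and closed: "\<And>x u v. x \<in> U \<Longrightarrow> dif w x u \<bullet> v = dif w x v \<bullet> u"
    and U: "\<And>c t. c \<in> {0..1} \<Longrightarrow> t \<in> {0..1} \<Longrightarrow> H c t \<in> U"
    and Hs: "\<And>c t. c \<in> {0..1} \<Longrightarrow> t \<in> {0..1} \<Longrightarrow>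
      ((\<lambda>c. H c t) has_vector_derivative Hs c t) (at c within {0..1})"
    and Ht: "\<And>c t. c \<in> {0..1} \<Longrightarrow> t \<in> {0..1} \<Longrightarrow>
      ((\<lambda>t. H c t) has_vector_derivative Ht c t) (at t within {0..1})"
    and Hts: "\<And>c t. c \<in> {0..1} \<Longrightarrow> t \<in> {0..1} \<Longrightarrow>
      ((\<lambda>c. Ht c t) has_vector_derivative Hst c t) (at c within {0..1})"
    and Hst: "\<And>c t. c \<in> {0..1} \<Longrightarrow> t \<in> {0..1} \<Longrightarrow>
      ((\<lambda>t. Hs c t) has_vector_derivative Hst c t) (at t within {0..1})"
    and cont: "continuous_on ({0..1} \<times> {0..1}) (\<lambda>p. H (fst p) (snd p))"
      "continuous_on ({0..1} \<times> {0..1}) (\<lambda>p. Hs (fst p) (snd p))"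
      "continuous_on ({0..1} \<times> {0..1}) (\<lambda>p. Ht (fst p) (snd p))"
      "continuous_on ({0..1} \<times> {0..1}) (\<lambda>p. Hst (fst p) (snd p))"
    and c: "c \<in> {0..1}"
  shows "((\<lambda>c. integral {0..1} (\<lambda>t. w (H c t) \<bullet> Ht c t)) has_vector_derivative
    w (H c 1) \<bullet> Hs c 1 - w (H c 0) \<bullet> Hs c 0) (at c within {0..1})"
proof -
  let ?I = "{0..1::real}"
  let ?D = "\<lambda>c t. dif w (H c t) (Hs c t) \<bullet> Ht c t + w (H c t) \<bullet> Hst c t"
  have der: "((\<lambda>c. w (H c t)) has_vector_derivative dif w (H c t) (Hs c t)) (at c within ?I)"
    if "c \<in> ?I" "t \<in> ?I" for c t
    using vector_derivative_diff_chain_within[OF Hs[OF that], of w "dif w (H c t)"]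
      smooth_on_has_derivative[OF w U[OF that]] has_derivative_at_withinI
    by (auto simp: o_def)
  have der': "((\<lambda>t. w (H c t)) has_vector_derivative dif w (H c t) (Ht c t)) (at t within ?I)"
    if "c \<in> ?I" "t \<in> ?I" for c t
    using vector_derivative_diff_chain_within[OF Ht[OF that], of w "dif w (H c t)"]
      smooth_on_has_derivative[OF w U[OF that]] has_derivative_at_withinI
    by (auto simp: o_def)
  have contw: "continuous_on (?I \<times> ?I) (\<lambda>p. w (H (fst p) (snd p)))"
    by (rule continuous_on_compose2[OF smooth_on_imp_continuous_on[OF w] cont(1)]) (use U in auto)
  have contF: "continuous_on (?I \<times> ?I) (\<lambda>p. w (H (fst p) (snd p)) \<bullet> Ht (fst p) (snd p))"
    by (intro continuous_intros contw cont)
  have "continuous_on (?I \<times> ?I) (\<lambda>p. ?D (fst p) (snd p))"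
    by (intro continuous_intros contw cont continuous_on_dif[OF w]) (use U in auto)
  then have "((\<lambda>c. integral (cbox 0 1) (\<lambda>t. w (H c t) \<bullet> Ht c t)) has_vector_derivative
      integral (cbox 0 1) (?D c)) (at c within ?I)"
  proof (intro leibniz_rule_vector_derivative c)
    show "((\<lambda>c. w (H c t) \<bullet> Ht c t) has_vector_derivative ?D c t) (at c within ?I)"
      if "c \<in> ?I" "t \<in> cbox 0 1" for c t
      using bounded_bilinear.has_vector_derivative[OF bounded_bilinear_inner der Hts, of c t] that
      by (simp add: add.commute)
    show "(\<lambda>t. w (H c t) \<bullet> Ht c t) integrable_on cbox 0 1" if "c \<in> ?I" for c
    proof (rule integrable_continuous)
      have "continuous_on ?I (\<lambda>t. (c, t))" by (intro continuous_intros)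
      from continuous_on_compose2[OF contF this]
      show "continuous_on (cbox 0 1) (\<lambda>t. w (H c t) \<bullet> Ht c t)" using that by (auto simp: image_subset_iff)
    qed
  qed (auto simp: split_beta)
  moreover have "(?D c has_integral w (H c 1) \<bullet> Hs c 1 - w (H c 0) \<bullet> Hs c 0) {0..1}"
  proof (rule fundamental_theorem_of_calculus)
    fix t :: real assume "t \<in> ?I"
    then show "((\<lambda>t. w (H c t) \<bullet> Hs c t) has_vector_derivative ?D c t) (at t within ?I)"
      using bounded_bilinear.has_vector_derivative[OF bounded_bilinear_inner der' Hst, of c t] c
        closed[OF U, of c t "Hs c t" "Ht c t"]
      by (simp add: add.commute)
  qed simp
  ultimately show ?thesis by (simp add: integral_unique)
qed

text \<open>The homotopy h is replaced by a polynomial one with the same boundary values. Its deviation D from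
  the straight homotopy vanishes on the boundary of the square, and so does the polynomial C that
  is obtained by interpolation from a polynomial Q close to D.\<close>
lemma line_integral_eq:
  fixes w :: "'a::euclidean_space \<Rightarrow> 'a"
  assumes U: "open U" "simply_connected U" and w: "smooth_on U w"
    and closed: "\<And>x u v. x \<in> U \<Longrightarrow> dif w x u \<bullet> v = dif w x v \<bullet> u"
    and p: "polynomial_function p" "path_image p \<subseteq> U"
    and q: "polynomial_function q" "path_image q \<subseteq> U"
    and ends: "pathstart p = pathstart q" "pathfinish p = pathfinish q"
  shows "line_integral w p = line_integral w q"
proof -
  let ?I = "{0..1::real}"
  have "homotopic_paths U p q"
    using U(2) p q ends path_polynomial_function
    unfolding simply_connected_eq_homotopic_paths by metis
  then obtain h where conth: "continuous_on (?I \<times> ?I) h"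
    and h: "h \<in> ?I \<times> ?I \<rightarrow> U" and h01: "\<And>t. t \<in> ?I \<Longrightarrow> h (0,t) = p t" "\<And>t. t \<in> ?I \<Longrightarrow> h (1,t) = q t"
    and hends: "\<And>c. c \<in> ?I \<Longrightarrow> h (c,0) = p 0" "\<And>c. c \<in> ?I \<Longrightarrow> h (c,1) = p 1"
    unfolding homotopic_paths by (auto simp: pathstart_def pathfinish_def)
  have pq: "p 0 = q 0" "p 1 = q 1"
    using ends by (auto simp: pathstart_def pathfinish_def)
  obtain e where e: "e > 0" "(\<Union>x\<in>h ` (?I \<times> ?I). ball x e) \<subseteq> U"
  proof (rule compact_subset_open_imp_ball_epsilon_subset)
    show "compact (h ` (?I \<times> ?I))"
      by (intro compact_continuous_image conth compact_Times compact_Icc)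
  qed (use h U in auto)
  define D where "D z = h z - ((1 - fst z) *\<^sub>R p (snd z) + fst z *\<^sub>R q (snd z))" for z
  have "continuous_on (?I \<times> ?I) D"
    unfolding D_def
    by (intro continuous_intros conth continuous_on_compose2[OF continuous_on_polymonial_function[OF p(1)]]
        continuous_on_compose2[OF continuous_on_polymonial_function[OF q(1)]]) auto
  then obtain Q where Q: "polynomial_function Q" "\<And>z. z \<in> ?I \<times> ?I \<Longrightarrow> norm (D z - Q z) < e / 4"
    using Stone_Weierstrass_polynomial_function[of "?I \<times> ?I" D "e / 4"] e(1)
    by (auto simp: compact_Times)
  \<comment> \<open>Subtracting the interpolation in the first variable makes \<open>R\<close>
    vanish on the sides 0 and 1 of that variable. The second correction uses values of
    \<open>R\<close> alone and therefore does not spoil this.\<close>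
  define R where "R z = Q z - ((1 - fst z) *\<^sub>R Q (0, snd z) + fst z *\<^sub>R Q (1, snd z))" for z
  define C where "C z = R z - ((1 - snd z) *\<^sub>R R (fst z, 0) + snd z *\<^sub>R R (fst z, 1))" for z
  define H where "H z = (1 - fst z) *\<^sub>R p (snd z) + fst z *\<^sub>R q (snd z) + C z" for z
  have fstp: "polynomial_function (\<lambda>z::real \<times> real. fst z)" "polynomial_function (\<lambda>z::real \<times> real. snd z)"
    by (auto intro: polynomial_function_bounded_linear bounded_linear_fst bounded_linear_snd)
  have comp: "polynomial_function (\<lambda>z. f (g z))" if "polynomial_function f" "polynomial_function g"
    for f :: "'c::real_normed_vector \<Rightarrow> 'b::real_normed_vector" and g :: "'d::real_normed_vector \<Rightarrow> 'c"
    using polynomial_function_compose[OF that(2,1)] by (simp add: o_def)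
  have pair: "polynomial_function (\<lambda>z::real \<times> real. (f z, g z))"
    if "polynomial_function f" "polynomial_function g" for f g :: "real \<times> real \<Rightarrow> real"
    using that by (auto simp: polynomial_function_iff_Basis_inner Basis_prod_def)
  have polyR: "polynomial_function R"
    unfolding R_def
    by (intro polynomial_function_diff polynomial_function_add polynomial_function_mult
        polynomial_function_const fstp Q(1) comp[OF Q(1)] pair)
  have polyH: "polynomial_function H"
    unfolding H_def C_def
    by (intro polynomial_function_diff polynomial_function_add polynomial_function_mult
        polynomial_function_const fstp comp[OF p(1)] comp[OF q(1)] polyR comp[OF polyR] pair)
  have bdry: "H (0, t) = p t" "H (1, t) = q t" "H (c, 0) = p 0" "H (c, 1) = p 1" for c t
    by (simp_all add: H_def C_def R_def algebra_simps flip: pq)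
  have convex_bound: "norm ((1 - c) *\<^sub>R u + c *\<^sub>R v) \<le> B"
    if "c \<in> ?I" "norm u \<le> B" "norm v \<le> B" for c B and u v :: 'a
  proof -
    have "norm ((1 - c) *\<^sub>R u + c *\<^sub>R v) \<le> (1 - c) * norm u + c * norm v"
      using that(1) by (intro norm_triangle_le) auto
    also have "\<dots> \<le> (1 - c) * B + c * B"
      using that by (intro add_mono mult_left_mono) auto
    finally show ?thesis by (simp add: algebra_simps)
  qed
  have D0: "D (0, t) = 0" "D (1, t) = 0" "D (t, 0) = 0" "D (t, 1) = 0" if "t \<in> ?I" for t
    using that h01 hends pq by (simp_all add: D_def algebra_simps)
  have Q0: "norm (Q (0, t)) \<le> e/4" "norm (Q (1, t)) \<le> e/4" "norm (Q (t, 0)) \<le> e/4" "norm (Q (t, 1)) \<le> e/4"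
    if "t \<in> ?I" for t
    using Q(2)[of "(0,t)"] Q(2)[of "(1,t)"] Q(2)[of "(t,0)"] Q(2)[of "(t,1)"] that D0[OF that] by auto
  \<comment> \<open>The error budget behind \<open>e / 4\<close>: on the boundary \<open>D\<close>
    is 0, so \<open>Q\<close> is at most \<open>e/4\<close> there. Hence \<open>Q - R\<close> is at
    most \<open>e/4\<close>, \<open>R\<close> is at most \<open>e/2\<close> on the remaining two
    sides, and \<open>R - C\<close> is at most \<open>e/2\<close>. With the strict
    \<open>e/4\<close> for \<open>D - Q\<close> the sum stays below \<open>e\<close>.\<close>
  have inU: "H (c, t) \<in> U" if ct: "c \<in> ?I" "t \<in> ?I" for c t
  proof -
    have QR: "norm (Q (c', t') - R (c', t')) \<le> e/4" if "c' \<in> ?I" "t' \<in> ?I" for c' t'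
      unfolding R_def using convex_bound[OF that(1) Q0(1,2)[OF that(2)]] by (simp add: add.commute)
    have R0: "norm (R (c, 0)) \<le> e/2" "norm (R (c, 1)) \<le> e/2"
      using QR[OF ct(1), of 0] QR[OF ct(1), of 1] Q0(3,4)[OF ct(1)]
        norm_triangle_sub[of "R (c, 0)" "Q (c, 0)"] norm_triangle_sub[of "R (c, 1)" "Q (c, 1)"]
        norm_minus_commute[of "R (c, 0)" "Q (c, 0)"] norm_minus_commute[of "R (c, 1)" "Q (c, 1)"]
      by simp_all
    have RC: "norm (R (c, t) - C (c, t)) \<le> e/2"
      unfolding C_def using convex_bound[OF ct(2) R0] by (simp add: add.commute)
    have "h (c,t) - H (c,t) = (D (c,t) - Q (c,t)) + (Q (c,t) - R (c,t)) + (R (c,t) - C (c,t))"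
      by (simp add: D_def H_def)
    then have "dist (h (c,t)) (H (c,t)) < e/4 + e/4 + e/2"
      unfolding dist_norm using Q(2)[of "(c,t)"] QR[OF ct] RC ct
      by (metis (no_types, lifting) SigmaI add_less_le_mono add_mono norm_triangle_lt norm_triangle_le)
    then show ?thesis using e(2) ct by fastforce
  qed
  have sm: "smooth_on UNIV H"
    by (rule polynomial_function_smooth_on[OF polyH])
  define Hs where "Hs z = dif H z (1, 0)" for z
  define Ht where "Ht z = dif H z (0, 1)" for z
  define Hst where "Hst z = dif Ht z (1, 0)" for z
  have smt: "smooth_on UNIV Ht" and sms: "smooth_on UNIV Hs"
    unfolding Ht_def Hs_def by (rule smooth_on_dif[OF sm])+
  have Hst': "Hst z = dif Hs z (0, 1)" for z
    unfolding Hst_def Hs_def[abs_def] Ht_def[abs_def] by (rule dif_commute[OF _ _ sm]) auto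
  have line_s: "((\<lambda>c. K (c, t)) has_vector_derivative dif K (c, t) (1, 0)) (at c within S)"
    if "smooth_on UNIV K" for K :: "real \<times> real \<Rightarrow> 'a" and c t S
    using smooth_on_has_vector_derivative_line[OF that, of "(0, t)" c "(1, 0)" S] by simp
  have line_t: "((\<lambda>t. K (c, t)) has_vector_derivative dif K (c, t) (0, 1)) (at t within S)"
    if "smooth_on UNIV K" for K :: "real \<times> real \<Rightarrow> 'a" and c t S
    using smooth_on_has_vector_derivative_line[OF that, of "(c, 0)" t "(0, 1)" S] by simp
  have Hs0: "Hs (c, 0) = 0" "Hs (c, 1) = 0" for c
    using line_s[OF sm, of 0 c UNIV] line_s[OF sm, of 1 c UNIV]
      vector_derivative_unique_at[OF has_vector_derivative_const]
    by (fastforce simp: Hs_def bdry)+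
  have cont: "continuous_on S K" if "smooth_on UNIV K" for K :: "real \<times> real \<Rightarrow> 'a" and S
    using smooth_on_imp_continuous_on[OF that] continuous_on_subset by blast
  let ?L = "\<lambda>c. integral ?I (\<lambda>t. w (H (c, t)) \<bullet> Ht (c, t))"
  have "(?L has_vector_derivative w (H (c, 1)) \<bullet> Hs (c, 1) - w (H (c, 0)) \<bullet> Hs (c, 0)) (at c within ?I)"
    if "c \<in> ?I" for c
  proof (rule line_integral_variation[where Hst = "\<lambda>c t. Hst (c, t)", OF w closed inU])
    fix c t
    show "((\<lambda>c. H (c, t)) has_vector_derivative Hs (c, t)) (at c within ?I)"
      unfolding Hs_def by (rule line_s[OF sm])
    show "((\<lambda>t. H (c, t)) has_vector_derivative Ht (c, t)) (at t within ?I)"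
      unfolding Ht_def by (rule line_t[OF sm])
    show "((\<lambda>c. Ht (c, t)) has_vector_derivative Hst (c, t)) (at c within ?I)"
      unfolding Hst_def by (rule line_s[OF smt])
    show "((\<lambda>t. Hs (c, t)) has_vector_derivative Hst (c, t)) (at t within ?I)"
      unfolding Hst' by (rule line_t[OF sms])
  next
    have "smooth_on UNIV Hst"
      unfolding Hst_def by (rule smooth_on_dif[OF smt])
    then show "continuous_on (?I \<times> ?I) (\<lambda>p. Hst (fst p, snd p))"
      by (simp add: cont)
  qed (use that cont sm sms smt in simp_all)
  then have "(?L has_vector_derivative 0) (at c within ?I)" if "c \<in> ?I" for c
    using that Hs0 by simp
  then obtain k where "\<And>c. c \<in> ?I \<Longrightarrow> ?L c = k"
    using has_vector_derivative_zero_constant[OF convex_real_interval(5), of 0 1 ?L] by blast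
  then have "?L 0 = ?L 1" by simp
  moreover have "vector_derivative p (at t) = Ht (0, t)" "vector_derivative q (at t) = Ht (1, t)" for t
    using line_t[OF sm, of 0 t UNIV] line_t[OF sm, of 1 t UNIV]
    by (auto simp: bdry Ht_def intro!: vector_derivative_at)
  ultimately show ?thesis by (simp add: line_integral_def bdry)
qed

text \<open>The potential is the integral along a chosen polynomial path to the point. By
  independence of the path its increment is computed on a variation of one path; the mean value
  theorem in the variation parameter turns the increment into
  \<open>w (x + c v) \<bullet> v\<close>, and continuity of \<open>w\<close> gives the
  derivative.\<close>

lemma simply_connected_potential:
  fixes w :: "'a::euclidean_space \<Rightarrow> 'a"
  assumes U: "open U" "simply_connected U" and w: "smooth_on U w"
    and closed: "\<And>x u v. x \<in> U \<Longrightarrow> dif w x u \<bullet> v = dif w x v \<bullet> u"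
  shows "\<exists>\<phi>. \<forall>x\<in>U. (\<phi> has_derivative (\<lambda>v. w x \<bullet> v)) (at x)"
proof (cases "U = {}")
  case False
  then obtain a where a: "a \<in> U" by blast
  have "\<exists>g. polynomial_function g \<and> path_image g \<subseteq> U \<and> pathstart g = a \<and> pathfinish g = x" if "x \<in> U" for x
    using connected_open_polynomial_connected[OF U(1) simply_connected_imp_connected[OF U(2)] a that] .
  then obtain P where P: "\<And>x. x \<in> U \<Longrightarrow> polynomial_function (P x) \<and> path_image (P x) \<subseteq> U \<and>
      pathstart (P x) = a \<and> pathfinish (P x) = x"
    by metis
  define \<phi> where "\<phi> x = line_integral w (P x)" for x
  have "(\<phi> has_derivative (\<lambda>v. w x \<bullet> v)) (at x)" if x: "x \<in> U" for x
  proof -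
    define p where "p = P x"
    have p: "polynomial_function p" "path_image p \<subseteq> U" "p 0 = a" "p 1 = x"
      using P[OF x] by (auto simp: p_def pathstart_def pathfinish_def)
    obtain p' where p': "polynomial_function p'" "\<And>t. (p has_vector_derivative p' t) (at t)"
      using has_vector_derivative_polynomial_function[OF p(1)] by blast
    obtain e where e: "e > 0" "(\<Union>x\<in>path_image p. ball x e) \<subseteq> U"
      using compact_subset_open_imp_ball_epsilon_subset[of "path_image p" U]
        compact_path_image[OF path_polynomial_function[OF p(1)]] U(1) p(2) by blast
    have mv: "\<exists>c\<in>{0<..<1}. \<phi> (x + v) - \<phi> x = w (x + c *\<^sub>R v) \<bullet> v" if v: "norm v < e" for v
    proof -
      have inU: "p t + (c * t) *\<^sub>R v \<in> U" if "c \<in> {0..1}" "t \<in> {0..1}" for c t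
      proof -
        have "\<bar>c * t\<bar> * norm v \<le> 1 * norm v"
          using that by (intro mult_right_mono) (auto simp: abs_mult mult_le_one)
        then have "p t + (c * t) *\<^sub>R v \<in> ball (p t) e"
          using v by (simp add: dist_norm)
        then show ?thesis using e(2) that unfolding path_image_def by blast
      qed
      have contp: "continuous_on S p" "continuous_on S p'" for S
        by (auto intro: continuous_on_polymonial_function p p')
      \<comment> \<open>The path \<open>p t + t v\<close> ends at \<open>x + v\<close> and is polynomial, unlike p followed by a segment.\<close>
      let ?L = "\<lambda>c. integral {0..1} (\<lambda>t. w (p t + (c * t) *\<^sub>R v) \<bullet> (p' t + c *\<^sub>R v))"
      have "(?L has_vector_derivative w (p 1 + (c * 1) *\<^sub>R v) \<bullet> (1 *\<^sub>R v) - w (p 0 + (c * 0) *\<^sub>R v) \<bullet> (0 *\<^sub>R v))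
         (at c within {0..1})"
        if "c \<in> {0..1}" for c
        by (rule line_integral_variation[where Hst = "\<lambda>c t. v" and Hs = "\<lambda>c t. t *\<^sub>R v", OF w closed inU])
          (use that in \<open>auto intro!: derivative_eq_intros has_vector_derivative_at_within[OF p'(2)] continuous_intros
             continuous_on_compose2[OF contp(1)] continuous_on_compose2[OF contp(2)]
             simp: scaleR_left_distrib\<close>)
      then have "(?L has_derivative (\<lambda>h. h *\<^sub>R (w (x + c *\<^sub>R v) \<bullet> v))) (at c within {0..1})"
        if "c \<in> {0..1}" for c
        using that p(4) by (simp add: has_vector_derivative_def)
      from mvt_simple[OF zero_less_one this]
      obtain c where c: "c \<in> {0<..<1}" "?L 1 - ?L 0 = w (x + c *\<^sub>R v) \<bullet> v"
        by auto
      have "x + v \<in> U"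
        using inU[of 1 1] p(4) by simp
      let ?q = "\<lambda>t. p t + t *\<^sub>R v"
      have q: "polynomial_function ?q"
        by (intro polynomial_function_add polynomial_function_mult p(1) polynomial_function_const polynomial_function_id)
      have "vector_derivative ?q (at t) = p' t + v" for t
        by (rule vector_derivative_at) (auto intro!: derivative_eq_intros p'(2))
      then have "line_integral w ?q = ?L 1"
        by (simp add: line_integral_def)
      moreover have "vector_derivative p (at t) = p' t" for t
        by (rule vector_derivative_at) (rule p'(2))
      then have "\<phi> x = ?L 0"
        by (simp add: \<phi>_def line_integral_def flip: p_def)
      moreover have "\<phi> (x + v) = line_integral w ?q"
        unfolding \<phi>_def
        by (rule line_integral_eq[OF U w closed _ _ q])
          (use P[OF \<open>x + v \<in> U\<close>] p inU[of 1] in \<open>auto simp: pathstart_def pathfinish_def path_image_def\<close>)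
      ultimately show ?thesis using c by auto
    qed
    show ?thesis
      unfolding has_derivative_within_alt
    proof safe
      show "bounded_linear ((\<bullet>) (w x))" by (rule bounded_linear_inner_right)
      fix d :: real assume d: "d > 0"
      have "isCont w x"
        using smooth_on_imp_continuous_on[OF w] U(1) x continuous_on_eq_continuous_at by blast
      then obtain r where r: "r > 0" "\<And>y. dist y x < r \<Longrightarrow> dist (w y) (w x) < d"
        using d unfolding continuous_at_eps_delta by metis
      show "\<exists>r>0. \<forall>y\<in>UNIV. norm (y - x) < r \<longrightarrow> norm (\<phi> y - \<phi> x - w x \<bullet> (y - x)) \<le> d * norm (y - x)"
      proof (intro exI[of _ "min r e"] conjI ballI impI)
        fix y assume y: "norm (y - x) < min r e"
        then obtain c where c: "c \<in> {0<..<1}" "\<phi> y - \<phi> x = w (x + c *\<^sub>R (y - x)) \<bullet> (y - x)"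
          using mv[of "y - x"] by auto
        have "c * norm (y - x) \<le> 1 * norm (y - x)"
          using c(1) by (intro mult_right_mono) auto
        then have "dist (w (x + c *\<^sub>R (y - x))) (w x) < d"
          using c(1) y by (intro r(2)) (simp add: dist_norm)
        then have "norm (w (x + c *\<^sub>R (y - x)) - w x) * norm (y - x) \<le> d * norm (y - x)"
          by (intro mult_right_mono) (auto simp: dist_norm)
        then show "norm (\<phi> y - \<phi> x - w x \<bullet> (y - x)) \<le> d * norm (y - x)"
          using Cauchy_Schwarz_ineq2[of "w (x + c *\<^sub>R (y - x)) - w x" "y - x"]
          by (simp add: c(2) inner_diff_left)
      qed (use r e in auto)
    qed
  qed
  then show ?thesis by blast
qed simp

section \<open>Partial derivatives\<close>

text \<open>Differentiability and the list of partial derivatives in one predicate, so that each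
  product rule settles both at once and \<open>has_pd_pdif\<close> reads off the value.\<close>

definition has_pd ::
  "(real^'n \<Rightarrow> 'b::real_normed_vector) \<Rightarrow> ('n::finite \<Rightarrow> 'b) \<Rightarrow> real^'n \<Rightarrow> bool"
  where "has_pd f D x \<longleftrightarrow> (f has_derivative (\<lambda>v. \<Sum>i\<in>UNIV. v $ i *\<^sub>R D i)) (at x)"

lemma sum_axis_scaleR:
  fixes D :: "'n::finite \<Rightarrow> 'b::real_vector"
  shows "(\<Sum>k\<in>UNIV. axis i (1::real) $ k *\<^sub>R D k) = D i"
proof -
  have "axis i (1::real) $ k *\<^sub>R D k = (if k = i then D k else 0)" for k
    by (simp add: axis_def)
  then show ?thesis by simp
qed

lemma sum_mult_axis: "(\<Sum>i\<in>UNIV. c i * axis k (1::real) $ i) = c k"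
proof -
  have "c i * axis k (1::real) $ i = (if i = k then c i else 0)" for i
    by (simp add: axis_def)
  then show ?thesis by simp
qed

lemma has_derivative_imp_has_pd:
  assumes "(f has_derivative f') (at x)"
  shows "has_pd f (\<lambda>i. f' (axis i 1)) x"
proof -
  have lin: "linear f'" using assms has_derivative_linear by blast
  have "f' v = (\<Sum>i\<in>UNIV. v $ i *\<^sub>R f' (axis i 1))" for v
  proof -
    have "f' v = f' (\<Sum>i\<in>UNIV. v $ i *\<^sub>R axis i 1)"
      using basis_expansion[of v] by (simp add: scalar_mult_eq_scaleR)
    then show ?thesis by (simp add: linear_sum[OF lin] linear_scale[OF lin])
  qed
  then show ?thesis
    unfolding has_pd_def by (intro has_derivative_eq_rhs[OF assms] ext)
qed

lemma has_pd_dif: "has_pd f D x \<Longrightarrow> dif f x v = (\<Sum>i\<in>UNIV. v $ i *\<^sub>R D i)"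
  unfolding has_pd_def by (drule frechet_derivative_at) (simp add: fun_eq_iff)

lemma has_pd_pdif: "has_pd f D x \<Longrightarrow> pdif i f x = D i"
  by (simp add: has_pd_dif sum_axis_scaleR)

lemma has_pd_imp_differentiable: "has_pd f D x \<Longrightarrow> f differentiable at x"
  unfolding has_pd_def differentiable_def by blast

lemma differentiable_imp_has_pd: "f differentiable at x \<Longrightarrow> has_pd f (\<lambda>i. pdif i f x) x"
  by (rule has_derivative_imp_has_pd) (simp add: frechet_derivative_works)

lemma smooth_on_imp_has_pd: "smooth_on U f \<Longrightarrow> x \<in> U \<Longrightarrow> has_pd f (\<lambda>i. pdif i f x) x"
  by (rule has_derivative_imp_has_pd[OF smooth_on_has_derivative])

lemma has_pd_transform:
  "open U \<Longrightarrow> x \<in> U \<Longrightarrow> has_pd f D x \<Longrightarrow> (\<And>y. y \<in> U \<Longrightarrow> f y = g y) \<Longrightarrow> has_pd g D x"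
  unfolding has_pd_def by (rule has_derivative_transform_within_open)

lemma has_pd_cong: "has_pd f D x \<Longrightarrow> (\<And>i. D i = D' i) \<Longrightarrow> has_pd f D' x"
  by (simp add: has_pd_def)

lemma has_pd_const: "has_pd (\<lambda>x. c) (\<lambda>i. 0) x"
  by (simp add: has_pd_def)

lemma has_pd_bounded_linear:
  assumes L: "bounded_linear L" and f: "has_pd f D x"
  shows "has_pd (\<lambda>x. L (f x)) (\<lambda>i. L (D i)) x"
  using has_derivative_imp_has_pd[OF bounded_linear.has_derivative[OF L f[unfolded has_pd_def]]]
  by (simp add: sum_axis_scaleR)

lemma has_pd_bilinear:
  assumes p: "bounded_bilinear p" and "has_pd f D x" "has_pd g D' x"
  shows "has_pd (\<lambda>x. p (f x) (g x)) (\<lambda>i. p (D i) (g x) + p (f x) (D' i)) x"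
proof -
  have "has_pd (\<lambda>x. p (f x) (g x)) (\<lambda>i. p (f x) (\<Sum>k\<in>UNIV. axis i 1 $ k *\<^sub>R D' k)
      + p (\<Sum>k\<in>UNIV. axis i 1 $ k *\<^sub>R D k) (g x)) x"
    by (rule has_derivative_imp_has_pd[OF bounded_bilinear.FDERIV[OF p assms(2,3)[unfolded has_pd_def]]])
  then show ?thesis by (simp add: sum_axis_scaleR add.commute)
qed

lemma has_pd_add: "has_pd f D x \<Longrightarrow> has_pd g D' x \<Longrightarrow> has_pd (\<lambda>x. f x + g x) (\<lambda>i. D i + D' i) x"
  unfolding has_pd_def by (drule (1) has_derivative_add) (simp add: scaleR_add_right sum.distrib)

lemma has_pd_minus: "has_pd f D x \<Longrightarrow> has_pd (\<lambda>x. - f x) (\<lambda>i. - D i) x"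
  by (rule has_pd_bounded_linear[OF bounded_linear_minus[OF bounded_linear_ident]])

lemma has_pd_diff: "has_pd f D x \<Longrightarrow> has_pd g D' x \<Longrightarrow> has_pd (\<lambda>x. f x - g x) (\<lambda>i. D i - D' i) x"
  unfolding has_pd_def by (drule (1) has_derivative_diff) (simp add: scaleR_diff_right sum_subtractf)

lemma has_pd_sum:
  "(\<And>k. k \<in> I \<Longrightarrow> has_pd (f k) (D k) x) \<Longrightarrow> has_pd (\<lambda>x. \<Sum>k\<in>I. f k x) (\<lambda>i. \<Sum>k\<in>I. D k i) x"
  by (induction I rule: infinite_finite_induct) (simp_all add: has_pd_const has_pd_add)

lemmas has_pd_scaleR = has_pd_bilinear[OF bounded_bilinear_scaleR]
lemmas has_pd_inner = has_pd_bilinear[OF bounded_bilinear_inner]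
lemmas has_pd_mult = has_pd_bilinear[OF bounded_bilinear_mult]
lemmas has_pd_cmult = has_pd_bounded_linear[OF bounded_linear_mult_right]
lemmas has_pd_cscaleR = has_pd_bounded_linear[OF bounded_linear_scaleR_right]
lemmas has_pd_nth = has_pd_bounded_linear[OF bounded_linear_vec_nth]

lemma has_pd_divide:
  fixes f g :: "real^'n::finite \<Rightarrow> real"
  assumes "has_pd f D x" "has_pd g D' x" "g x \<noteq> 0"
  shows "has_pd (\<lambda>x. f x / g x) (\<lambda>i. D i / g x - f x * D' i / (g x)\<^sup>2) x"
proof -
  have "has_pd (\<lambda>x. inverse (g x)) (\<lambda>i. - (inverse (g x) * D' i * inverse (g x))) x"
    using has_derivative_imp_has_pd[OF Deriv.has_derivative_inverse[OF assms(3) assms(2)[unfolded has_pd_def]]]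
    by (simp only: sum_axis_scaleR)
  from has_pd_mult[OF assms(1) this] show ?thesis
    by (simp add: power2_eq_square divide_inverse mult_ac)
qed

lemma has_pd_vec_iff:
  fixes f :: "real^'n::finite \<Rightarrow> real^'k::finite"
  shows "has_pd f D x \<longleftrightarrow> (\<forall>k. has_pd (\<lambda>x. f x $ k) (\<lambda>i. D i $ k) x)"
  unfolding has_pd_def has_derivative_componentwise_within[of f]
  by (auto simp: Basis_vec_def inner_axis)

lemma cont_diff_Suc_has_pd:
  fixes f :: "real^'n::finite \<Rightarrow> 'b::real_normed_vector"
  assumes U: "open U" and "\<And>x. x \<in> U \<Longrightarrow> has_pd f (\<lambda>i. D i x) x" and D: "\<And>i. cont_diff k U (D i)"
  shows "cont_diff (Suc k) U f"
proof (rule cont_diff_SucI[OF U])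
  have "cont_diff k U (\<lambda>x. \<Sum>i\<in>I. v $ i *\<^sub>R D i x)" if "finite I" for v :: "real^'n" and I
    using that
    by (induction I rule: finite_induct)
      (simp_all add: cont_diff_const cont_diff_add[OF U] cont_diff_bounded_linear[OF bounded_linear_scaleR_right U D])
  then show "cont_diff k U (\<lambda>x. \<Sum>i\<in>UNIV. v $ i *\<^sub>R D i x)" for v :: "real^'n"
    by simp
qed (use assms(2) in \<open>simp add: has_pd_def\<close>)

text \<open>Potentials arise only as functions with prescribed partial derivatives; their smoothness
  comes from here.\<close>

lemma smooth_on_has_pdI:
  assumes "open U" "\<And>x. x \<in> U \<Longrightarrow> has_pd f (\<lambda>i. D i x) x" "\<And>i. smooth_on U (D i)"
  shows "smooth_on U f"
  unfolding smooth_on_def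
proof
  fix k
  have "cont_diff (Suc k) U f"
    by (rule cont_diff_Suc_has_pd[OF assms(1,2)]) (use assms(3) in \<open>simp_all add: smooth_on_def\<close>)
  then show "cont_diff k U f" by (rule cont_diff_mono_order)
qed

text \<open>Bootstrapping: if all \<open>f l\<close> are of class r, so are the right hand sides,
  which makes the \<open>f k\<close> of class r + 1. It is meant for frames, of which
  \<open>frame_of\<close> asks only differentiability.\<close>

lemma linear_system_smooth_on:
  fixes f :: "'k::finite \<Rightarrow> real^'n::finite \<Rightarrow> 'b::real_normed_algebra"
  assumes U: "open U" and f: "\<And>k x. x \<in> U \<Longrightarrow> has_pd (f k) (\<lambda>i. \<Sum>l\<in>UNIV. f l x * M i l k x) x"
    and M: "\<And>i k l. smooth_on U (M i l k)"
  shows "smooth_on U (f k)"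
proof -
  have "cont_diff r U (f k)" for r k
  proof (induction r arbitrary: k)
    case 0
    show ?case
      using has_pd_imp_differentiable[OF f]
      by (auto intro!: continuous_at_imp_continuous_on differentiable_imp_continuous_within)
  next
    case (Suc r)
    have "cont_diff r U (\<lambda>x. \<Sum>l\<in>I. f l x * M i l k x)" if "finite I" for i I
      using that
      by (induction I rule: finite_induct)
        (simp_all add: cont_diff_const cont_diff_add[OF U]
          cont_diff_bilinear[OF bounded_bilinear_mult U Suc M[unfolded smooth_on_def, rule_format]])
    then show ?case by (intro cont_diff_Suc_has_pd[OF U f]) simp_all
  qed
  then show ?thesis by (simp add: smooth_on_def)
qed

section \<open>Submanifolds with an adapted moving frame\<close>

text \<open>\<open>dX\<close> and \<open>dN\<close> carry the geometry: that the derivative of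
  \<open>N j\<close> has no normal component says that the normal frame is parallel, and that its
  i-th partial is a multiple of \<open>T i\<close> alone says that the coordinates are lines of
  curvature. \<open>complete\<close> takes the place of a dimension count.\<close>

locale moving_frame =
  fixes U :: "(real^'n::finite) set" and X :: "real^'n \<Rightarrow> 'e::euclidean_space"
    and N :: "'m::finite \<Rightarrow> real^'n \<Rightarrow> 'e" and T :: "'n \<Rightarrow> real^'n \<Rightarrow> 'e"
    and b :: "real^'n \<Rightarrow> real^'n" and A :: "real^'n \<Rightarrow> real^'n^'m"
  assumes U: "open U"
    and smooth_X: "smooth_on U X" and smooth_N: "\<And>j. smooth_on U (N j)" and smooth_b: "smooth_on U b"
    and dX: "\<And>x. x \<in> U \<Longrightarrow> has_pd X (\<lambda>i. (b x $ i) *\<^sub>R T i x) x"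
    and dN: "\<And>x j. x \<in> U \<Longrightarrow> has_pd (N j) (\<lambda>i. (A x $ j $ i) *\<^sub>R T i x) x"
    and b: "\<And>x i. x \<in> U \<Longrightarrow> b x $ i \<noteq> 0"
    and TT: "\<And>x i k. x \<in> U \<Longrightarrow> T i x \<bullet> T k x = (if i = k then 1 else 0)"
    and NN: "\<And>x j k. x \<in> U \<Longrightarrow> N j x \<bullet> N k x = (if j = k then 1 else 0)"
    and TN: "\<And>x i j. x \<in> U \<Longrightarrow> T i x \<bullet> N j x = 0"
    and complete: "\<And>x w. x \<in> U \<Longrightarrow> w = (\<Sum>i\<in>UNIV. (w \<bullet> T i x) *\<^sub>R T i x) + (\<Sum>j\<in>UNIV. (w \<bullet> N j x) *\<^sub>R N j x)"
    and A: "\<And>x. x \<in> U \<Longrightarrow> transpose (A x) ** A x = mat 1"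
begin

lemma A_orthonormal: "x \<in> U \<Longrightarrow> (\<Sum>j\<in>UNIV. A x $ j $ i * A x $ j $ k) = (if i = k then 1 else 0)"
  using A[of x] by (simp add: vec_eq_iff matrix_matrix_mult_def transpose_def mat_def)

lemma dif_X: "x \<in> U \<Longrightarrow> dif X x u = (\<Sum>i\<in>UNIV. (u $ i * b x $ i) *\<^sub>R T i x)"
  by (simp add: has_pd_dif[OF dX])

lemma dif_N: "x \<in> U \<Longrightarrow> dif (N j) x u = (\<Sum>i\<in>UNIV. (u $ i * A x $ j $ i) *\<^sub>R T i x)"
  by (simp add: has_pd_dif[OF dN])

lemma inner_tangent:
  "x \<in> U \<Longrightarrow> (\<Sum>i\<in>UNIV. p i *\<^sub>R T i x) \<bullet> (\<Sum>i\<in>UNIV. q i *\<^sub>R T i x) = (\<Sum>i\<in>UNIV. p i * q i)"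
  by (simp add: inner_sum_left inner_sum_right TT if_distrib mult.commute cong: if_cong)

lemma inner_T: "x \<in> U \<Longrightarrow> (\<Sum>i\<in>UNIV. p i *\<^sub>R T i x) \<bullet> T k x = p k"
  by (simp add: inner_sum_left TT if_distrib cong: if_cong)

lemma inner_N: "x \<in> U \<Longrightarrow> (\<Sum>j\<in>UNIV. p j *\<^sub>R N j x) \<bullet> N k x = p k"
  by (simp add: inner_sum_left NN if_distrib cong: if_cong)

lemma inner_T_N [simp]: "x \<in> U \<Longrightarrow> (\<Sum>i\<in>UNIV. p i *\<^sub>R T i x) \<bullet> N k x = 0"
  by (simp add: inner_sum_left TN)

lemma inner_N_T [simp]: "x \<in> U \<Longrightarrow> (\<Sum>j\<in>UNIV. p j *\<^sub>R N j x) \<bullet> T k x = 0"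
  by (simp add: inner_sum_left TN inner_commute[of "N _ x"])

section \<open>Tangent space, normal space and fundamental forms\<close>

lemma tangent_space_eq: "x \<in> U \<Longrightarrow> tangent_space X x = {w. \<forall>j. w \<bullet> N j x = 0}"
proof safe
  fix w j assume "x \<in> U" "w \<in> tangent_space X x"
  then show "w \<bullet> N j x = 0" by (auto simp: tangent_space_def dif_X)
next
  fix w assume x: "x \<in> U" and w: "\<forall>j. w \<bullet> N j x = 0"
  have "w = (\<Sum>i\<in>UNIV. (w \<bullet> T i x) *\<^sub>R T i x)"
    using complete[OF x, of w] w by simp
  also have "\<dots> = dif X x (\<chi> i. (w \<bullet> T i x) / b x $ i)"
    using b[OF x] by (simp add: dif_X[OF x])
  finally show "w \<in> tangent_space X x" by (auto simp: tangent_space_def)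
qed

lemma normal_space_eq: "x \<in> U \<Longrightarrow> normal_space X x = {w. \<forall>i. w \<bullet> T i x = 0}"
proof safe
  fix w i assume x: "x \<in> U" and "w \<in> normal_space X x"
  moreover have "T i x \<in> tangent_space X x" using x by (simp add: tangent_space_eq TN)
  ultimately show "w \<bullet> T i x = 0"
    by (simp add: normal_space_def orthogonal_comp_def orthogonal_def inner_commute[of w])
next
  fix w assume x: "x \<in> U" and "\<forall>i. w \<bullet> T i x = 0"
  then show "w \<in> normal_space X x"
    by (auto simp: normal_space_def orthogonal_comp_def orthogonal_def tangent_space_def dif_X
        inner_sum_left inner_commute[of "T _ x"])
qed

lemma N_in_normal_space: "x \<in> U \<Longrightarrow> N j x \<in> normal_space X x"
  by (simp add: normal_space_eq inner_commute[of "N j x"] TN)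

lemma sum_N_in_normal_space: "x \<in> U \<Longrightarrow> (\<Sum>j\<in>UNIV. c j *\<^sub>R N j x) \<in> normal_space X x"
  by (simp add: normal_space_eq)

lemma normal_expansion: "x \<in> U \<Longrightarrow> z \<in> normal_space X x \<Longrightarrow> z = (\<Sum>j\<in>UNIV. (z \<bullet> N j x) *\<^sub>R N j x)"
  using complete[of x z] by (simp add: normal_space_eq)

lemma normal_part_eq:
  assumes x: "x \<in> U"
  shows "normal_part X x w = (\<Sum>j\<in>UNIV. (w \<bullet> N j x) *\<^sub>R N j x)"
  unfolding normal_part_def
proof (rule the_equality)
  show "(\<Sum>j\<in>UNIV. (w \<bullet> N j x) *\<^sub>R N j x) \<in> normal_space X x \<and>
      w - (\<Sum>j\<in>UNIV. (w \<bullet> N j x) *\<^sub>R N j x) \<in> tangent_space X x"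
    using x by (simp add: sum_N_in_normal_space tangent_space_eq inner_diff_left inner_N)
next
  fix z assume z: "z \<in> normal_space X x \<and> w - z \<in> tangent_space X x"
  then have "z \<bullet> N j x = w \<bullet> N j x" for j
    using x by (simp add: tangent_space_eq inner_diff_left)
  then show "z = (\<Sum>j\<in>UNIV. (w \<bullet> N j x) *\<^sub>R N j x)"
    using normal_expansion[OF x, of z] z by simp
qed

lemma immersion: "immersion_on U X"
  unfolding immersion_on_def
proof (intro conjI ballI smooth_X)
  fix x assume x: "x \<in> U"
  show "inj (dif X x)"
  proof (rule injI)
    fix u v assume eq: "dif X x u = dif X x v"
    have "u $ i * b x $ i = v $ i * b x $ i" for i
      using arg_cong[OF eq, of "\<lambda>w. w \<bullet> T i x"] x by (simp add: dif_X inner_T)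
    then show "u = v" using b[OF x] by (simp add: vec_eq_iff)
  qed
qed

lemma metric: "x \<in> U \<Longrightarrow> dif X x u \<bullet> dif X x v = (\<Sum>i\<in>UNIV. (b x $ i)\<^sup>2 * u $ i * v $ i)"
  by (simp add: dif_X inner_tangent power2_eq_square mult_ac)

lemma second_form_eq:
  "x \<in> U \<Longrightarrow> second_form X N x u v =
     (\<Sum>i\<in>UNIV. \<Sum>j\<in>UNIV. (b x $ i * A x $ j $ i * u $ i * v $ i) *\<^sub>R N j x)"
  unfolding second_form_def
  by (subst sum.swap) (simp add: dif_X dif_N inner_tangent mult_ac flip: scaleR_sum_left)

section \<open>The normal connection\<close>

lemma normal_field_sum_N:
  assumes "open V" "V \<subseteq> U" "\<And>j. smooth_on V (c j)"
  shows "normal_field V X (\<lambda>x. \<Sum>j\<in>UNIV. c j x *\<^sub>R N j x)"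
  unfolding normal_field_def
proof (intro conjI ballI)
  show "smooth_on V (\<lambda>x. \<Sum>j\<in>UNIV. c j x *\<^sub>R N j x)"
    by (intro smooth_on_sum smooth_on_scaleR assms smooth_on_subset[OF smooth_N])
next
  fix x assume "x \<in> V"
  then show "(\<Sum>j\<in>UNIV. c j x *\<^sub>R N j x) \<in> normal_space X x"
    by (intro sum_N_in_normal_space subsetD[OF assms(2)])
qed

lemma normal_field_coeff_smooth:
  assumes "open V" "V \<subseteq> U" "normal_field V X z"
  shows "smooth_on V (\<lambda>x. z x \<bullet> N j x)"
  using assms unfolding normal_field_def by (intro smooth_on_inner smooth_on_subset[OF smooth_N]) simp_all

text \<open>The frame N is parallel: the normal derivative acts on the coefficients only.\<close>
lemma normal_deriv_eq:
  assumes V: "open V" "V \<subseteq> U" and z: "normal_field V X z" and x: "x \<in> V"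
  shows "normal_deriv X v z x = (\<Sum>j\<in>UNIV. dif (\<lambda>y. z y \<bullet> N j y) x v *\<^sub>R N j x)"
proof -
  have xU: "x \<in> U" using V x by blast
  have "dif z x v \<bullet> N j x = dif (\<lambda>y. z y \<bullet> N j y) x v" for j
  proof -
    have dz: "has_pd z (\<lambda>i. pdif i z x) x"
      using z x smooth_on_imp_has_pd by (auto simp: normal_field_def)
    note d = has_pd_inner[OF dz dN[OF xU, of j]]
    have "z x \<bullet> T i x = 0" for i
      using z x xU by (auto simp: normal_field_def normal_space_eq)
    then have "dif (\<lambda>y. z y \<bullet> N j y) x v = (\<Sum>i\<in>UNIV. v $ i * (pdif i z x \<bullet> N j x))"
      by (simp add: has_pd_dif[OF d])
    also have "\<dots> = dif z x v \<bullet> N j x"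
      by (subst has_pd_dif[OF dz, of v]) (simp add: inner_sum_left)
    finally show ?thesis by simp
  qed
  then show ?thesis by (simp add: normal_deriv_def normal_part_eq[OF xU])
qed

lemma parallel_N: "parallel_normal_field U X (N j)"
  unfolding parallel_normal_field_def normal_field_def
proof safe
  fix x v assume x: "x \<in> U"
  show "normal_deriv X v (N j) x = 0"
    by (simp add: normal_deriv_def normal_part_eq[OF x] dif_N[OF x] x)
qed (use smooth_N N_in_normal_space in auto)

lemma parallel_normal_field_iff:
  assumes V: "open V" "V \<subseteq> U"
  shows "parallel_normal_field V X z \<longleftrightarrow>
    normal_field V X z \<and> (\<forall>x\<in>V. \<forall>v j. dif (\<lambda>y. z y \<bullet> N j y) x v = 0)"
proof -
  have "(\<Sum>j\<in>UNIV. c j *\<^sub>R N j x) = 0 \<longleftrightarrow> (\<forall>j. c j = 0)" if "x \<in> V" for c x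
    using inner_N[of x c] that V by fastforce
  then show ?thesis
    unfolding parallel_normal_field_def using normal_deriv_eq[OF V] by auto
qed

text \<open>In a parallel frame the curvature is the commutator of second partial derivatives of the
  coefficients, which vanishes by \<open>dif_commute\<close>.\<close>

lemma flat_normal: "flat_normal_bundle U X"
  unfolding flat_normal_bundle_def
proof safe
  fix V z x u v assume V: "open V" "V \<subseteq> U" and z: "normal_field V X z" and x: "x \<in> V"
  define c where "c j = (\<lambda>y. z y \<bullet> N j y)" for j
  have c: "smooth_on V (c j)" for j
    unfolding c_def by (rule normal_field_coeff_smooth[OF V z])
  have eq: "normal_deriv X u (normal_deriv X v z) x = (\<Sum>j\<in>UNIV. dif (\<lambda>y. dif (c j) y v) x u *\<^sub>R N j x)" for u v
  proof -
    have d: "normal_deriv X v z y = (\<Sum>j\<in>UNIV. dif (c j) y v *\<^sub>R N j y)" if "y \<in> V" for y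
      unfolding c_def by (rule normal_deriv_eq[OF V z that])
    have nf: "normal_field V X (normal_deriv X v z)"
      using normal_field_sum_N[OF V, of "\<lambda>j y. dif (c j) y v"] smooth_on_dif[OF c] V(1) d
      by (auto simp: normal_field_def intro: smooth_on_cong)
    have "dif (\<lambda>y. normal_deriv X v z y \<bullet> N j y) x u = dif (\<lambda>y. dif (c j) y v) x u" for j
    proof (rule fun_cong[OF frechet_derivative_at, symmetric])
      have "((\<lambda>y. dif (c j) y v) has_derivative dif (\<lambda>y. dif (c j) y v) x) (at x)"
        by (rule smooth_on_has_derivative[OF smooth_on_dif[OF c] x])
      then show "((\<lambda>y. normal_deriv X v z y \<bullet> N j y) has_derivative dif (\<lambda>y. dif (c j) y v) x) (at x)"
        by (rule has_derivative_transform_within_open[OF _ V(1) x])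
          (use V in \<open>auto simp: d inner_N\<close>)
    qed
    then show ?thesis by (simp add: normal_deriv_eq[OF V nf x])
  qed
  show "normal_deriv X u (normal_deriv X v z) x = normal_deriv X v (normal_deriv X u z) x"
    unfolding eq using dif_commute[OF V(1) x c] by simp
qed

section \<open>Shape operators and principal directions\<close>

lemma second_derivative_inner_N:
  assumes x: "x \<in> U"
  shows "N j x \<bullet> dif (\<lambda>y. dif X y u) x v = - (\<Sum>i\<in>UNIV. b x $ i * A x $ j $ i * u $ i * v $ i)"
proof -
  \<comment> \<open>Differentiating the identity \<open>N j y \<bullet> dif X y u = 0\<close> trades
    the second derivative of \<open>X\<close> in \<open>shape_op\<close> for the first derivative of
    \<open>N j\<close>.\<close>
  have "((\<lambda>y. N j y \<bullet> dif X y u) has_derivative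
      (\<lambda>v. N j x \<bullet> dif (\<lambda>y. dif X y u) x v + dif (N j) x v \<bullet> dif X x u)) (at x)"
    by (intro has_derivative_inner smooth_on_has_derivative[OF _ x] smooth_N smooth_on_dif[OF smooth_X])
  moreover have "((\<lambda>y. N j y \<bullet> dif X y u) has_derivative (\<lambda>v. 0)) (at x)"
    by (rule has_derivative_transform_within_open[OF has_derivative_const U x, of 0])
      (simp add: dif_X inner_commute[of "N j _"])
  ultimately have "N j x \<bullet> dif (\<lambda>y. dif X y u) x v + dif (N j) x v \<bullet> dif X x u = 0"
    using fun_cong[OF has_derivative_unique, of _ _ _ _ v] by blast
  then show ?thesis by (simp add: dif_N[OF x] dif_X[OF x] inner_tangent[OF x] mult_ac add_eq_0_iff)
qed

text \<open>The metric and every second fundamental form are diagonal in the coordinates, with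
  entries \<open>b^2\<close> and \<open>b \<kappa>\<close>. Their quotient is the principal
  curvature \<open>\<kappa> / b\<close>.\<close>

lemma shape_op_eq:
  assumes x: "x \<in> U" and z: "z \<in> normal_space X x"
  shows "shape_op X x z = (\<chi> k l. if k = l then (\<Sum>j\<in>UNIV. (z \<bullet> N j x) * A x $ j $ k) / b x $ k else 0)"
    (is "_ = ?S")
proof -
  define \<kappa> where "\<kappa> i = (\<Sum>j\<in>UNIV. (z \<bullet> N j x) * A x $ j $ i)" for i
  have rhs: "- (z \<bullet> dif (\<lambda>y. dif X y u) x v) = (\<Sum>i\<in>UNIV. b x $ i * \<kappa> i * u $ i * v $ i)" for u v
  proof -
    have "z \<bullet> dif (\<lambda>y. dif X y u) x v
        = (\<Sum>j\<in>UNIV. (z \<bullet> N j x) * (N j x \<bullet> dif (\<lambda>y. dif X y u) x v))"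
      by (subst normal_expansion[OF x z]) (simp add: inner_sum_left)
    also have "\<dots> = - (\<Sum>j\<in>UNIV. \<Sum>i\<in>UNIV. b x $ i * (z \<bullet> N j x) * A x $ j $ i * u $ i * v $ i)"
      by (simp add: second_derivative_inner_N[OF x] sum_negf sum_distrib_left mult_ac)
    also have "\<dots> = - (\<Sum>i\<in>UNIV. b x $ i * \<kappa> i * u $ i * v $ i)"
      by (subst sum.swap) (simp add: \<kappa>_def sum_distrib_left sum_distrib_right mult_ac)
    finally show ?thesis by simp
  qed
  have lhs: "dif X x (S *v u) \<bullet> dif X x v = (\<Sum>i\<in>UNIV. (b x $ i)\<^sup>2 * (S *v u) $ i * v $ i)" for S u v
    by (rule metric[OF x])
  have S: "?S = (\<chi> k l. if k = l then \<kappa> k / b x $ k else 0)"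
    by (simp add: \<kappa>_def vec_eq_iff)
  show ?thesis
    unfolding shape_op_def rhs lhs S
  proof (rule the_equality)
    have "((\<chi> k l. if k = l then \<kappa> k / b x $ k else 0) *v u) $ i = \<kappa> i / b x $ i * u $ i" for u i
      by (simp add: matrix_vector_mult_def if_distrib[of "\<lambda>c. c * _"] cong: if_cong)
    then show "\<forall>u v. (\<Sum>i\<in>UNIV. (b x $ i)\<^sup>2 * ((\<chi> k l. if k = l then \<kappa> k / b x $ k else 0) *v u) $ i * v $ i)
        = (\<Sum>i\<in>UNIV. b x $ i * \<kappa> i * u $ i * v $ i)"
      using b[OF x] by (auto intro!: sum.cong simp: power2_eq_square)
  next
    fix S assume *: "\<forall>u v. (\<Sum>i\<in>UNIV. (b x $ i)\<^sup>2 * (S *v u) $ i * v $ i) = (\<Sum>i\<in>UNIV. b x $ i * \<kappa> i * u $ i * v $ i)"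
    \<comment> \<open>Basis vectors isolate single entries of \<open>S\<close>; as \<open>b\<close>
      has no zeros, this gives the uniqueness that \<open>THE\<close> requires.\<close>
    have e: "(b x $ k)\<^sup>2 * S $ k $ l = (if k = l then b x $ k * \<kappa> k else 0)" for k l
      using *[rule_format, of "axis l 1" "axis k 1"]
      by (simp add: sum_mult_axis matrix_vector_mult_basis column_def) (simp add: axis_def)
    have "S $ k $ l = (if k = l then \<kappa> k / b x $ k else 0)" for k l
      using b[OF x, of k] e[of k l] by (cases "k = l") (simp_all add: power2_eq_square field_simps)
    then show "S = (\<chi> k l. if k = l then \<kappa> k / b x $ k else 0)"
      by (simp add: vec_eq_iff)
  qed
qed

lemma shape_op_mult:
  assumes "x \<in> U" "z \<in> normal_space X x"
  shows "shape_op X x z *v u = (\<chi> k. (\<Sum>j\<in>UNIV. (z \<bullet> N j x) * A x $ j $ k) / b x $ k * u $ k)"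
  by (simp add: shape_op_eq[OF assms] matrix_vector_mult_def vec_eq_iff if_distrib[of "\<lambda>c. c * _"] cong: if_cong)

lemma shape_op_axis:
  assumes "x \<in> U" "z \<in> normal_space X x"
  shows "\<exists>\<kappa>. shape_op X x z *v axis i c = \<kappa> *\<^sub>R axis i c"
  by (rule exI[of _ "(\<Sum>j\<in>UNIV. (z \<bullet> N j x) * A x $ j $ i) / b x $ i"])
    (simp add: shape_op_mult[OF assms] vec_eq_iff axis_def)

text \<open>The eigenvalues \<open>d\<close> require a normal vector with coefficients
  \<open>c\<close> solving \<open>A^t c = d b\<close>, and \<open>c = A (d b)\<close> does so
  because the columns of \<open>A\<close> are orthonormal. Both non-degeneracy and the determination
  of the principal directions rest on this.\<close>

lemma shape_op_surj:
  assumes x: "x \<in> U"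
  obtains z where "z \<in> normal_space X x" "shape_op X x z = (\<chi> k l. if k = l then d k else 0)"
proof
  define c where "c j = (\<Sum>i\<in>UNIV. d i * b x $ i * A x $ j $ i)" for j
  show z: "(\<Sum>j\<in>UNIV. c j *\<^sub>R N j x) \<in> normal_space X x"
    by (rule sum_N_in_normal_space[OF x])
  have "(\<Sum>j\<in>UNIV. c j * A x $ j $ k) = (\<Sum>i\<in>UNIV. d i * b x $ i * (\<Sum>j\<in>UNIV. A x $ j $ i * A x $ j $ k))" for k
    by (simp add: c_def sum_distrib_right sum_distrib_left mult_ac) (rule sum.swap)
  then have "(\<Sum>j\<in>UNIV. c j * A x $ j $ k) = d k * b x $ k" for k
    by (simp add: A_orthonormal[OF x] if_distrib cong: if_cong)
  then show "shape_op X x (\<Sum>j\<in>UNIV. c j *\<^sub>R N j x) = (\<chi> k l. if k = l then d k else 0)"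
    unfolding shape_op_eq[OF x z] using b[OF x] by (simp add: inner_N[OF x] vec_eq_iff)
qed

text \<open>The shape operators at a point are exactly the diagonal matrices, a space of dimension
  n.\<close>

lemma nondegenerate: "nondegenerate_normal_bundle U X"
  unfolding nondegenerate_normal_bundle_def
proof
  fix x assume x: "x \<in> U"
  let ?f = "\<lambda>d::real^'n. (\<chi> k l. if k = l then d $ k else 0) :: real^'n^'n"
  have "shape_op X x ` normal_space X x = range ?f"
  proof safe
    fix z assume "z \<in> normal_space X x"
    from shape_op_eq[OF x this]
    have "shape_op X x z = ?f (\<chi> k. (\<Sum>j\<in>UNIV. (z \<bullet> N j x) * A x $ j $ k) / b x $ k)" by (simp add: vec_eq_iff)
    then show "shape_op X x z \<in> range ?f" by blast
  next
    fix d
    obtain z where "z \<in> normal_space X x" "shape_op X x z = ?f d"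
      using shape_op_surj[OF x, of "\<lambda>i. d $ i"] by blast
    then show "?f d \<in> shape_op X x ` normal_space X x"
      by (metis imageI)
  qed
  moreover have "linear ?f"
    by (rule linearI) (simp_all add: vec_eq_iff)
  moreover have "inj ?f"
  proof (rule injI)
    fix d d' assume "?f d = ?f d'"
    then have "?f d $ k $ k = ?f d' $ k $ k" for k by simp
    then show "d = d'" by (simp add: vec_eq_iff)
  qed
  ultimately show "dim (shape_op X x ` normal_space X x) = CARD('n)"
    using dim_image_eq[of ?f UNIV] by simp
qed

text \<open>Some shape operator is the projection to the i-th axis, where \<open>u $ i\<close> is
  not 0. Its eigenvalue on \<open>u\<close> must be 1, which kills all other coordinates. So
  although the shape operators may share eigenvalues, the common eigenvectors are only the
  axes.\<close>

lemma principal_direction_axis: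
  assumes x: "x \<in> U" and u: "principal_direction X x u"
  obtains i c where "c \<noteq> 0" "u = axis i c"
proof -
  from u obtain i where i: "u $ i \<noteq> 0"
    by (auto simp: principal_direction_def vec_eq_iff)
  obtain z where z: "z \<in> normal_space X x" "shape_op X x z = (\<chi> k l. if k = l then (if k = i then 1 else 0) else 0)"
    using shape_op_surj[OF x] .
  then obtain \<kappa> where k: "shape_op X x z *v u = \<kappa> *\<^sub>R u"
    using u by (auto simp: principal_direction_def)
  have "(if k = i then u $ k else 0) = \<kappa> * u $ k" for k
    using arg_cong[OF k, of "\<lambda>w. w $ k"]
    by (simp add: z(2) matrix_vector_mult_def if_distrib[of "\<lambda>c. c * _"] cong: if_cong)
  from this[of i] this have "u $ k = 0" if "k \<noteq> i" for k
    using i that by (metis mult_cancel_right1 mult_eq_0_iff zero_neq_one)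
  then have "u = axis i (u $ i)"
    by (simp add: vec_eq_iff axis_def)
  with i show ?thesis using that by blast
qed

end

section \<open>Reflections and Ribaucour transformations\<close>

definition reflection :: "'e::real_inner \<Rightarrow> 'e \<Rightarrow> 'e"
  where "reflection h v = v - (2 * (v \<bullet> h) / (h \<bullet> h)) *\<^sub>R h"

lemma linear_reflection: "linear (reflection h)"
  by (rule linearI) (simp_all add: reflection_def inner_add_left add_divide_distrib algebra_simps)

lemma inner_reflection: "h \<noteq> 0 \<Longrightarrow> reflection h v \<bullet> reflection h w = v \<bullet> w"
  by (simp add: reflection_def inner_diff_left inner_diff_right inner_commute field_simps)

lemma reflection_reflection: "h \<noteq> 0 \<Longrightarrow> reflection h (reflection h v) = v"
  by (simp add: reflection_def inner_diff_left)

lemma norm_reflection: "h \<noteq> 0 \<Longrightarrow> norm (reflection h v) = norm v"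
  by (simp add: norm_eq_sqrt_inner inner_reflection)

lemma inner_reflection_swap: "h \<noteq> 0 \<Longrightarrow> reflection h v \<bullet> w = v \<bullet> reflection h w"
  by (simp add: reflection_def inner_diff_left inner_diff_right inner_commute)

text \<open>The reflection in the perpendicular bisector hyperplane of p and q exchanges p and q and
  maps the line \<open>p + t v\<close> to the line of \<open>w\<close> through q. The two lines
  therefore meet on the mirror, at the parameter \<open>t\<close> below; for \<open>v\<close>
  orthogonal to \<open>h\<close> they are parallel to it, which is the intersection at
  infinity.\<close>

lemma meet_equidistant_reflection:
  fixes h :: "'e::euclidean_space"
  assumes h: "h \<noteq> 0" and q: "q = p + k *\<^sub>R h" and w: "w = c *\<^sub>R reflection h v" and c: "c \<noteq> 0"
  shows "meet_equidistant p v q w"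
proof (cases "v \<bullet> h = 0")
  case True
  then have "w = c *\<^sub>R v" "v \<bullet> (q - p) = 0" by (simp_all add: w q reflection_def)
  then show ?thesis unfolding meet_equidistant_def using c by blast
next
  case False
  define t where "t = k * (h \<bullet> h) / (2 * (v \<bullet> h))"
  have "t * (2 * (v \<bullet> h) / (h \<bullet> h)) = k"
    using h False by (simp add: t_def)
  then have eq: "p + t *\<^sub>R v = q + t *\<^sub>R reflection h v"
    by (simp add: q reflection_def scaleR_diff_right)
  then have "p + t *\<^sub>R v = q + (t / c) *\<^sub>R w"
    using c by (simp add: w)
  moreover have "dist (p + t *\<^sub>R v) q = \<bar>t\<bar> * norm v"
    unfolding eq by (simp add: dist_norm norm_reflection[OF h])
  ultimately show ?thesis
    unfolding meet_equidistant_def by (metis dist_norm add_diff_cancel_left' norm_scaleR)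
qed

lemma dif_ident: "dif (\<lambda>x. x) x = (\<lambda>v. v)"
  using frechet_derivative_at[OF has_derivative_ident] by simp

text \<open>\<open>P\<close> is prescribed on the frame only; linearity makes it the reflection on
  the whole normal space and lets it keep the coefficients, which decide parallelism. Principal
  directions are coordinate axes, and the axes are eigenvectors for \<open>X'\<close> as well, so
  the identity of the parameter domain serves as the covering map.\<close>

lemma ribaucour_of_reflected_frames:
  fixes X X' :: "real^'n::finite \<Rightarrow> 'e::euclidean_space"
    and N N' :: "'m::finite \<Rightarrow> real^'n \<Rightarrow> 'e"
  assumes frame: "moving_frame V X N T b A" and frame': "moving_frame V X' N' T' b' A'"
    and h: "\<And>x. x \<in> V \<Longrightarrow> h x \<noteq> 0"
    and X': "\<And>x. x \<in> V \<Longrightarrow> X' x = X x + k x *\<^sub>R h x"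
    and N': "\<And>x j. x \<in> V \<Longrightarrow> N' j x = reflection (h x) (N j x)"
    and T': "\<And>x i. x \<in> V \<Longrightarrow> T' i x = reflection (h x) (T i x)"
    and P: "fibre_linear V X P" and PN: "\<And>x j. x \<in> V \<Longrightarrow> P x (N j x) = N' j x"
  shows "ribaucour_transformation V X V X' (\<lambda>x. x) P"
proof -
  interpret M: moving_frame V X N T b A by (rule frame)
  interpret M': moving_frame V X' N' T' b' A' by (rule frame')
  have P_sum: "P x (\<Sum>j\<in>I. c j *\<^sub>R N j x) = (\<Sum>j\<in>I. c j *\<^sub>R N' j x)" if "finite I" "x \<in> V" for x c I
    using that(1)
  proof (induction I rule: finite_induct)
    have P_add: "P x (z + r *\<^sub>R z') = P x z + r *\<^sub>R P x z'"
      if "z \<in> normal_space X x" "z' \<in> normal_space X x" for z z' r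
      using P that \<open>x \<in> V\<close> unfolding fibre_linear_def by blast
    {
      case empty
      have "0 \<in> normal_space X x" using M.sum_N_in_normal_space[of x "\<lambda>_. 0"] that by simp
      from P_add[OF this this, of 1] show ?case by simp
    next
      case (insert j I)
      have "(\<Sum>j\<in>I. c j *\<^sub>R N j x) \<in> normal_space X x"
        using that(2) by (simp add: M.normal_space_eq inner_sum_left M.TN inner_commute[of "N _ x"])
      then show ?case
        using P_add[OF _ M.N_in_normal_space, of "\<Sum>j\<in>I. c j *\<^sub>R N j x" "c j" j] insert that(2)
        by (simp add: PN add.commute)
    }
  qed
  have P_eq: "P x z = (\<Sum>j\<in>UNIV. (z \<bullet> N j x) *\<^sub>R N' j x)" if "x \<in> V" "z \<in> normal_space X x" for x z
    using P_sum[of UNIV x "\<lambda>j. z \<bullet> N j x"] M.normal_expansion[OF that] that(1) by simp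
  have P_refl: "P x z = reflection (h x) z" if "x \<in> V" "z \<in> normal_space X x" for x z
    by (subst (2) M.normal_expansion[OF that])
      (simp add: P_eq[OF that] N'[OF that(1)] linear_sum[OF linear_reflection] linear_scale[OF linear_reflection])
  have P_inner: "P x z \<bullet> N' j x = z \<bullet> N j x" if "x \<in> V" "z \<in> normal_space X x" for x z j
    by (simp add: P_eq[OF that] M'.inner_N[OF that(1)])
  have P_normal: "P x z \<in> normal_space X' x" if "x \<in> V" "z \<in> normal_space X x" for x z
    by (simp add: P_eq[OF that] M'.sum_N_in_normal_space[OF that(1)])
  have P_smooth: "smooth_on V0 (\<lambda>x. P x (z x))" if "open V0" "V0 \<subseteq> V" "normal_field V0 X z" for V0 z
  proof (rule smooth_on_cong[OF that(1)])
    show "smooth_on V0 (\<lambda>x. \<Sum>j\<in>UNIV. (z x \<bullet> N j x) *\<^sub>R N' j x)"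
      using M'.normal_field_sum_N[OF that(1,2) M.normal_field_coeff_smooth[OF that]]
      by (simp add: normal_field_def)
    show "(\<Sum>j\<in>UNIV. (z x \<bullet> N j x) *\<^sub>R N' j x) = P x (z x)" if "x \<in> V0" for x
      using P_eq[of x "z x"] that \<open>V0 \<subseteq> V\<close> \<open>normal_field V0 X z\<close> by (auto simp: normal_field_def)
  qed
  have inv: "inv_into V (\<lambda>x. x) x = x" if "x \<in> V" for x
    using inv_into_f_f[of "\<lambda>x. x" V x] that by simp
  have iso: "normal_bundle_iso V X V X' (\<lambda>x. x) P"
    unfolding normal_bundle_iso_def
  proof (intro conjI ballI allI impI P)
    show "diffeomorphism_on V V (\<lambda>x. x)"
      unfolding diffeomorphism_on_def
      using smooth_on_id[OF M.U] smooth_on_cong[OF M.U, of "\<lambda>x. x" "inv_into V (\<lambda>x. x)"] inv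
      by (simp add: bij_betw_def)
  next
    fix x assume x: "x \<in> V"
    show "bij_betw (P x) (normal_space X x) (normal_space X' x)"
    proof (rule bij_betw_byWitness[where f' = "\<lambda>z. \<Sum>j\<in>UNIV. (z \<bullet> N' j x) *\<^sub>R N j x"])
      show "\<forall>z\<in>normal_space X x. (\<Sum>j\<in>UNIV. (P x z \<bullet> N' j x) *\<^sub>R N j x) = z"
        using M.normal_expansion[OF x] by (simp add: P_inner[OF x])
      show "\<forall>z\<in>normal_space X' x. P x (\<Sum>j\<in>UNIV. (z \<bullet> N' j x) *\<^sub>R N j x) = z"
        using M'.normal_expansion[OF x] x by (simp add: P_sum)
    qed (use x P_normal M.sum_N_in_normal_space in auto)
  next
    fix V0 z assume "open V0 \<and> V0 \<subseteq> V \<and> normal_field V0 X z"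
    then show "smooth_on V0 (\<lambda>x. P x (z x))" using P_smooth by blast
  qed
  have par: "parallel_normal_field V0 X' (\<lambda>y. P (inv_into V (\<lambda>x. x) y) (z (inv_into V (\<lambda>x. x) y)))"
    if V0: "open V0" "V0 \<subseteq> V" and z: "parallel_normal_field V0 X z" for V0 z
  proof -
    let ?Pz = "\<lambda>y. P (inv_into V (\<lambda>x. x) y) (z (inv_into V (\<lambda>x. x) y))"
    have Pz: "?Pz x = P x (z x)" if "x \<in> V0" for x
      using inv that V0 by (metis subsetD)
    have nz: "normal_field V0 X z" "\<And>x v j. x \<in> V0 \<Longrightarrow> dif (\<lambda>y. z y \<bullet> N j y) x v = 0"
      using z unfolding M.parallel_normal_field_iff[OF V0] by auto
    then have zn: "z x \<in> normal_space X x" if "x \<in> V0" for x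
      using that by (simp add: normal_field_def)
    have "normal_field V0 X' ?Pz"
      unfolding normal_field_def
    proof (intro conjI ballI)
      show "smooth_on V0 ?Pz"
        by (rule smooth_on_cong[OF V0(1) P_smooth[OF V0 nz(1)]]) (simp add: Pz)
    next
      fix x assume "x \<in> V0"
      then show "?Pz x \<in> normal_space X' x"
        using P_normal[of x "z x"] zn V0 Pz by auto
    qed
    moreover have "dif (\<lambda>y. ?Pz y \<bullet> N' j y) x v = 0" if "x \<in> V0" for x v j
    proof -
      have "((\<lambda>y. z y \<bullet> N j y) has_derivative dif (\<lambda>y. z y \<bullet> N j y) x) (at x)"
        using smooth_on_has_derivative[OF M.normal_field_coeff_smooth[OF V0 nz(1)] that] .
      then have "((\<lambda>y. ?Pz y \<bullet> N' j y) has_derivative dif (\<lambda>y. z y \<bullet> N j y) x) (at x)"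
        by (rule has_derivative_transform_within_open[OF _ V0(1) that])
          (use V0 zn P_inner Pz in \<open>auto simp: subset_iff\<close>)
      from fun_cong[OF frechet_derivative_at[OF this], of v] show ?thesis
        using nz(2)[OF that] by simp
    qed
    ultimately show ?thesis unfolding M'.parallel_normal_field_iff[OF V0] by blast
  qed
  have meet: "meet_equidistant (X x) z (X' x) (P x z)" if "x \<in> V" "z \<in> normal_space X x" for x z
    by (rule meet_equidistant_reflection[OF h[OF that(1)] X'[OF that(1)], of _ 1])
      (simp_all add: P_refl[OF that])
  have "sphere_congruence V X V X' (\<lambda>x. x) P"
    unfolding sphere_congruence_def
    using M.U M.immersion M'.immersion iso par meet by simp
  moreover have "dif (\<lambda>x. x) x u \<noteq> 0 \<and>
       (\<forall>\<zeta>\<in>normal_space X x. \<exists>\<kappa>. shape_op X' x (P x \<zeta>) *v dif (\<lambda>x. x) x u = \<kappa> *\<^sub>R dif (\<lambda>x. x) x u) \<and>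
       meet_equidistant (X x) (dif X x u) (X' x) (dif X' x (dif (\<lambda>x. x) x u))"
    if x: "x \<in> V" and u: "principal_direction X x u" for x u
  proof -
    obtain i c where ic: "c \<noteq> 0" "u = axis i c" by (rule M.principal_direction_axis[OF x u])
    have axis: "(\<Sum>l\<in>UNIV. (axis i c $ l * p l) *\<^sub>R t l) = (c * p i) *\<^sub>R t i" for p and t :: "'n \<Rightarrow> 'e"
    proof -
      have "(axis i c $ l * p l) *\<^sub>R t l = (if l = i then (c * p l) *\<^sub>R t l else 0)" for l
        by (simp add: axis_def)
      then show ?thesis by simp
    qed
    have d: "dif X x u = (c * b x $ i) *\<^sub>R T i x" "dif X' x u = (c * b' x $ i) *\<^sub>R T' i x"
      by (simp_all add: M.dif_X[OF x] M'.dif_X[OF x] ic axis)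
    \<comment> \<open>The factor \<open>b' / b\<close> may be negative, but it is not 0, and only
      the line spanned by the vector matters.\<close>
    have "dif X' x u = (b' x $ i / b x $ i) *\<^sub>R reflection (h x) (dif X x u)"
      using M.b[OF x, of i] by (simp add: d linear_scale[OF linear_reflection] T'[OF x])
    then have "meet_equidistant (X x) (dif X x u) (X' x) (dif X' x u)"
      by (rule meet_equidistant_reflection[OF h[OF x] X'[OF x]])
        (use M.b[OF x, of i] M'.b[OF x, of i] in simp)
    moreover have "\<exists>\<kappa>. shape_op X' x (P x z) *v u = \<kappa> *\<^sub>R u" if "z \<in> normal_space X x" for z
      unfolding ic by (rule M'.shape_op_axis[OF x P_normal[OF x that]])
    ultimately show ?thesis
      using u by (simp add: dif_ident principal_direction_def)
  qed
  ultimately show ?thesis unfolding ribaucour_transformation_def by simp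
qed

lemma (in moving_frame) flat_metricI:
  fixes Y :: "real^'n \<Rightarrow> real^'n"
  assumes Y: "smooth_on U Y" "\<And>x. x \<in> U \<Longrightarrow> has_pd Y (\<lambda>i. (b x $ i) *\<^sub>R S i x) x"
    and S: "\<And>x i k. x \<in> U \<Longrightarrow> S i x \<bullet> S k x = (if i = k then 1 else 0)"
  shows "flat_metric U X"
proof -
  have "dif X p u \<bullet> dif X p v = dif Y p u \<bullet> dif Y p v" if p: "p \<in> U" for p u v
    by (simp add: metric[OF p] has_pd_dif[OF Y(2)[OF p]] inner_sum_left inner_sum_right S[OF p]
        if_distrib power2_eq_square mult_ac cong: if_cong)
  then show ?thesis unfolding flat_metric_def using U Y(1) by blast
qed

text \<open>Reflections are isometries, so orthonormality and completeness are inherited. What has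
  to be supplied are smoothness, the derivative equations, the non-vanishing of \<open>b'\<close>
  and the orthonormal columns of \<open>A'\<close>.\<close>

lemma moving_frame_reflected:
  fixes X X' :: "real^'n::finite \<Rightarrow> 'e::euclidean_space"
    and N N' :: "'m::finite \<Rightarrow> real^'n \<Rightarrow> 'e"
  assumes frame: "moving_frame U X N T b A" and V: "open V" "V \<subseteq> U"
    and h: "\<And>x. x \<in> V \<Longrightarrow> h x \<noteq> 0"
    and N': "\<And>x j. x \<in> V \<Longrightarrow> N' j x = reflection (h x) (N j x)"
    and T': "\<And>x i. x \<in> V \<Longrightarrow> T' i x = reflection (h x) (T i x)"
    and smooth: "smooth_on V X'" "\<And>j. smooth_on V (N' j)" "smooth_on V b'"
    and dX': "\<And>x. x \<in> V \<Longrightarrow> has_pd X' (\<lambda>i. (b' x $ i) *\<^sub>R T' i x) x"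
    and dN': "\<And>x j. x \<in> V \<Longrightarrow> has_pd (N' j) (\<lambda>i. (A' x $ j $ i) *\<^sub>R T' i x) x"
    and b': "\<And>x i. x \<in> V \<Longrightarrow> b' x $ i \<noteq> 0"
    and A': "\<And>x. x \<in> V \<Longrightarrow> transpose (A' x) ** A' x = mat 1"
  shows "moving_frame V X' N' T' b' A'"
proof -
  interpret M: moving_frame U X N T b A by (rule frame)
  show ?thesis
  proof unfold_locales
    fix x assume x: "x \<in> V"
    then have xU: "x \<in> U" using V by blast
    note hx = h[OF x]
    show "T' i x \<bullet> T' k x = (if i = k then 1 else 0)" for i k
      by (simp add: T'[OF x] inner_reflection[OF hx] M.TT[OF xU])
    show "N' j x \<bullet> N' k x = (if j = k then 1 else 0)" for j k
      by (simp add: N'[OF x] inner_reflection[OF hx] M.NN[OF xU])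
    show "T' i x \<bullet> N' j x = 0" for i j
      by (simp add: T'[OF x] N'[OF x] inner_reflection[OF hx] M.TN[OF xU])
    fix w
    let ?R = "reflection (h x)"
    have "w = ?R (?R w)" by (simp add: reflection_reflection[OF hx])
    also have "\<dots> = ?R ((\<Sum>i\<in>UNIV. (?R w \<bullet> T i x) *\<^sub>R T i x) + (\<Sum>j\<in>UNIV. (?R w \<bullet> N j x) *\<^sub>R N j x))"
      by (subst M.complete[OF xU, of "?R w"]) simp
    also have "\<dots> = (\<Sum>i\<in>UNIV. (w \<bullet> T' i x) *\<^sub>R T' i x) + (\<Sum>j\<in>UNIV. (w \<bullet> N' j x) *\<^sub>R N' j x)"
      by (simp add: T'[OF x] N'[OF x] linear_add[OF linear_reflection] linear_sum[OF linear_reflection]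
          linear_scale[OF linear_reflection] inner_reflection_swap[OF hx])
    finally show "w = (\<Sum>i\<in>UNIV. (w \<bullet> T' i x) *\<^sub>R T' i x) + (\<Sum>j\<in>UNIV. (w \<bullet> N' j x) *\<^sub>R N' j x)" .
  qed (use V smooth dX' dN' b' A' in simp_all)
qed

section \<open>The dressing action in components\<close>

text \<open>Flatness of the Lax connection sorted by order in the spectral parameter: the first
  equation has order one, the other two have order zero. The latter are the Lame equations for the
  rotation coefficients of a flat diagonal metric.\<close>

definition system_I :: "(real^'n::finite) set \<Rightarrow> (real^'n \<Rightarrow> real^'n^'m::finite) \<Rightarrow> (real^'n \<Rightarrow> real^'n^'n) \<Rightarrow> bool"
  where "system_I U A F \<longleftrightarrow> (\<forall>x\<in>U.
    (\<forall>i k j. i \<noteq> k \<longrightarrow> pdif k (\<lambda>x. A x $ j $ i) x = F x $ i $ k * A x $ j $ k) \<and>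
    (\<forall>i j k. i \<noteq> j \<longrightarrow> j \<noteq> k \<longrightarrow> i \<noteq> k \<longrightarrow> pdif k (\<lambda>x. F x $ i $ j) x = F x $ i $ k * F x $ k $ j) \<and>
    (\<forall>i j. i \<noteq> j \<longrightarrow> pdif j (\<lambda>x. F x $ i $ j) x + pdif i (\<lambda>x. F x $ j $ i) x
       + (\<Sum>k\<in>UNIV. F x $ i $ k * F x $ j $ k) = 0))"

text \<open>The equations for y and z are those of \<open>(y, iz) = E\<^sup>I(x,-is)\<^sup>-\<^sup>1(W, iZ)\<close>.\<close>
locale dressing =
  fixes U :: "(real^'n::finite) set" and A :: "real^'n \<Rightarrow> real^'n^'m::finite" and F :: "real^'n \<Rightarrow> real^'n^'n"
    and y :: "real^'n \<Rightarrow> real^'m" and z :: "real^'n \<Rightarrow> real^'n" and s :: real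
  assumes U: "open U" and smooth_A: "smooth_on U A" and smooth_F: "smooth_on U F"
    and smooth_y: "smooth_on U y" and smooth_z: "smooth_on U z"
    and sys: "system_I U A F"
    and A: "\<And>x. x \<in> U \<Longrightarrow> transpose (A x) ** A x = mat 1"
    and F: "\<And>x i. x \<in> U \<Longrightarrow> F x $ i $ i = 0"
    and s: "s \<noteq> 0"
    and dy: "\<And>x j. x \<in> U \<Longrightarrow> has_pd (\<lambda>x. y x $ j) (\<lambda>i. s * z x $ i * A x $ j $ i) x"
    and dz: "\<And>x k. x \<in> U \<Longrightarrow> has_pd (\<lambda>x. z x $ k) (\<lambda>i. (if i = k then s * (\<Sum>j\<in>UNIV. A x $ j $ i * y x $ j)
        - (\<Sum>l\<in>UNIV. F x $ i $ l * z x $ l) else 0) + F x $ i $ k * z x $ i) x"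
    and norm_eq: "\<And>x. x \<in> U \<Longrightarrow> y x \<bullet> y x = z x \<bullet> z x"
    and y_nz: "\<And>x. x \<in> U \<Longrightarrow> y x \<noteq> 0"
begin

definition w :: "'n \<Rightarrow> real^'n \<Rightarrow> real"
  where "w i x = (\<Sum>j\<in>UNIV. A x $ j $ i * y x $ j)"

definition q :: "real^'n \<Rightarrow> real"
  where "q x = 2 / (y x \<bullet> y x)"

text \<open>Since \<open>q = 2/|y|^2\<close>, these are the columns of \<open>A\<close> reflected in
  the hyperplane orthogonal to \<open>y\<close>, hence orthonormal again.\<close>

definition A' :: "real^'n \<Rightarrow> real^'n^'m"
  where "A' x = (\<chi> j i. A x $ j $ i - q x * y x $ j * w i x)"

definition F' :: "real^'n \<Rightarrow> real^'n^'n"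
  where "F' x = (\<chi> i j. if i = j then 0 else F x $ i $ j - s * q x * w i x * z x $ j)"

lemma A_orthonormal: "x \<in> U \<Longrightarrow> (\<Sum>j\<in>UNIV. A x $ j $ i * A x $ j $ k) = (if i = k then 1 else 0)"
  using A[of x] by (simp add: vec_eq_iff matrix_matrix_mult_def transpose_def mat_def)

lemma yy: "y x \<bullet> y x = (\<Sum>j\<in>UNIV. y x $ j * y x $ j)"
  by (simp add: inner_vec_def)

lemma q_yy: "x \<in> U \<Longrightarrow> q x * (y x \<bullet> y x) = 2"
  using y_nz by (simp add: q_def)

lemma q_zz: "x \<in> U \<Longrightarrow> q x * (\<Sum>k\<in>UNIV. z x $ k * z x $ k) = 2"
  using q_yy norm_eq by (simp add: inner_vec_def)

lemma dA: "x \<in> U \<Longrightarrow> has_pd (\<lambda>x. A x $ j $ i) (\<lambda>k. pdif k (\<lambda>x. A x $ j $ i) x) x"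
  by (rule smooth_on_imp_has_pd[OF smooth_on_nth[OF U smooth_on_nth[OF U smooth_A]]])

lemma dF: "x \<in> U \<Longrightarrow> has_pd (\<lambda>x. F x $ i $ j) (\<lambda>k. pdif k (\<lambda>x. F x $ i $ j) x) x"
  by (rule smooth_on_imp_has_pd[OF smooth_on_nth[OF U smooth_on_nth[OF U smooth_F]]])

lemma pdif_A: "x \<in> U \<Longrightarrow> i \<noteq> k \<Longrightarrow> pdif k (\<lambda>x. A x $ j $ i) x = F x $ i $ k * A x $ j $ k"
  using sys by (simp add: system_I_def)

lemma smooth_w: "smooth_on U (w i)"
  unfolding w_def by (intro smooth_on_sum smooth_on_mult smooth_on_nth smooth_A smooth_y U)

lemma smooth_q: "smooth_on U q"
  unfolding q_def using y_nz by (intro smooth_on_divide smooth_on_const smooth_on_inner smooth_y U) simp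

lemma dw: "x \<in> U \<Longrightarrow> has_pd (w i) (\<lambda>k. pdif k (w i) x) x"
  by (rule smooth_on_imp_has_pd[OF smooth_w])

text \<open>The term from the derivative of \<open>y\<close> drops out because distinct columns of
  \<open>A\<close> are orthogonal. Off the diagonal \<open>w\<close> thus obeys the same linear
  system as \<open>b\<close>, which makes \<open>b + q \<phi> w\<close> a candidate for the new
  metric coefficients.\<close>

lemma pdif_w:
  assumes x: "x \<in> U" and "i \<noteq> k"
  shows "pdif k (w i) x = F x $ i $ k * w k x"
proof -
  have "has_pd (w i) (\<lambda>k. \<Sum>j\<in>UNIV. pdif k (\<lambda>x. A x $ j $ i) x * y x $ j + A x $ j $ i * (s * z x $ k * A x $ j $ k)) x"
    unfolding w_def by (intro has_pd_sum has_pd_mult dA dy x)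
  then have "pdif k (w i) x = (\<Sum>j\<in>UNIV. F x $ i $ k * A x $ j $ k * y x $ j + A x $ j $ i * (s * z x $ k * A x $ j $ k))"
    by (simp add: has_pd_pdif pdif_A[OF x \<open>i \<noteq> k\<close>])
  also have "\<dots> = F x $ i $ k * w k x + s * z x $ k * (\<Sum>j\<in>UNIV. A x $ j $ i * A x $ j $ k)"
    by (simp add: w_def sum.distrib sum_distrib_left mult_ac)
  finally show ?thesis using \<open>i \<noteq> k\<close> by (simp add: A_orthonormal[OF x])
qed

lemma pdif_z:
  assumes x: "x \<in> U"
  shows "i \<noteq> k \<Longrightarrow> pdif i (\<lambda>x. z x $ k) x = F x $ i $ k * z x $ i"
    and "pdif k (\<lambda>x. z x $ k) x = s * w k x - (\<Sum>l\<in>UNIV. F x $ k $ l * z x $ l)"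
  using has_pd_pdif[OF dz[OF x, of k]] F[OF x] by (simp_all add: w_def)

lemma dz': "x \<in> U \<Longrightarrow> has_pd (\<lambda>x. z x $ k) (\<lambda>i. pdif i (\<lambda>x. z x $ k) x) x"
  by (rule smooth_on_imp_has_pd[OF smooth_on_nth[OF U smooth_z]])

lemma dq:
  assumes x: "x \<in> U"
  shows "has_pd q (\<lambda>i. - ((q x)\<^sup>2 * s * z x $ i * w i x)) x"
proof -
  have "has_pd (\<lambda>x. y x \<bullet> y x) (\<lambda>i. \<Sum>j\<in>UNIV. (s * z x $ i * A x $ j $ i) * y x $ j + y x $ j * (s * z x $ i * A x $ j $ i)) x"
    unfolding yy by (intro has_pd_sum has_pd_mult dy x)
  then have "has_pd (\<lambda>x. y x \<bullet> y x) (\<lambda>i. 2 * s * z x $ i * w i x) x"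
    by (rule has_pd_cong) (simp add: w_def sum.distrib sum_distrib_left mult_ac)
  from has_pd_divide[OF has_pd_const this, of 2] y_nz[OF x]
  have "has_pd (\<lambda>x. 2 / (y x \<bullet> y x)) (\<lambda>i. 0 / (y x \<bullet> y x) - 2 * (2 * s * z x $ i * w i x) / (y x \<bullet> y x)\<^sup>2) x"
    by simp
  then show ?thesis
    unfolding q_def[abs_def] by (rule has_pd_cong) (simp add: power2_eq_square)
qed

lemma smooth_A': "smooth_on U A'"
  unfolding A'_def smooth_on_vec_iff[OF U]
  by (simp add: smooth_on_diff smooth_on_mult smooth_on_nth smooth_q smooth_w smooth_y smooth_A U)

lemma smooth_F': "smooth_on U F'"
  unfolding F'_def smooth_on_vec_iff[OF U]
proof (intro allI)
  fix i j
  show "smooth_on U (\<lambda>x. (\<chi> i j. if i = j then 0 else F x $ i $ j - s * q x * w i x * z x $ j) $ i $ j)"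
    by (cases "i = j")
      (simp_all add: smooth_on_const smooth_on_diff smooth_on_mult smooth_on_nth smooth_q smooth_w smooth_z smooth_F U)
qed

lemma A'_orthonormal:
  assumes x: "x \<in> U"
  shows "transpose (A' x) ** A' x = mat 1"
proof -
  have "(\<Sum>j\<in>UNIV. A' x $ j $ i * A' x $ j $ k) = (if i = k then 1 else 0)" for i k
  proof -
    have "(\<Sum>j\<in>UNIV. A' x $ j $ i * A' x $ j $ k)
      = (\<Sum>j\<in>UNIV. A x $ j $ i * A x $ j $ k - q x * w k x * (A x $ j $ i * y x $ j)
         - q x * w i x * (A x $ j $ k * y x $ j) + q x * w i x * w k x * (q x * (y x $ j * y x $ j)))"
      by (rule sum.cong) (simp_all add: A'_def algebra_simps)
    also have "\<dots> = (\<Sum>j\<in>UNIV. A x $ j $ i * A x $ j $ k) - q x * w k x * w i x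
         - q x * w i x * w k x + q x * w i x * w k x * (q x * (y x \<bullet> y x))"
      unfolding yy by (simp only: sum.distrib sum_subtractf w_def flip: sum_distrib_left)
    finally show ?thesis by (simp add: A_orthonormal[OF x] q_yy[OF x] algebra_simps)
  qed
  then show ?thesis by (simp add: vec_eq_iff matrix_matrix_mult_def transpose_def mat_def)
qed

lemma dF':
  assumes x: "x \<in> U" and "i \<noteq> j"
  shows "pdif k (\<lambda>x. F' x $ i $ j) x = pdif k (\<lambda>x. F x $ i $ j) x
     + s\<^sup>2 * (q x)\<^sup>2 * z x $ k * w k x * w i x * z x $ j
     - s * q x * pdif k (w i) x * z x $ j - s * q x * w i x * pdif k (\<lambda>x. z x $ j) x"
proof -
  have "has_pd (\<lambda>x. F x $ i $ j - s * (q x * (w i x * z x $ j)))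
    (\<lambda>k. pdif k (\<lambda>x. F x $ i $ j) x - s * (- ((q x)\<^sup>2 * s * z x $ k * w k x) * (w i x * z x $ j)
      + q x * (pdif k (w i) x * z x $ j + w i x * pdif k (\<lambda>x. z x $ j) x))) x"
    by (intro has_pd_diff has_pd_cmult has_pd_mult dF dq dw dz' x)
  from has_pd_pdif[OF this, of k] \<open>i \<noteq> j\<close> show ?thesis
    by (simp add: F'_def mult.assoc) (simp add: algebra_simps power2_eq_square)
qed

text \<open>The new data are inserted into the equations directly. The quadratic identities
  \<open>q |y|^2 = 2\<close> (in the columns) and \<open>q |z|^2 = 2\<close> (here) are what
  balances terms of different degree in \<open>q\<close>.\<close>

lemma system_I': "system_I U A' F'"
  unfolding system_I_def
proof (intro ballI conjI allI impI)
  fix x i k j assume x: "x \<in> U" and "i \<noteq> (k::'n)"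
  have "has_pd (\<lambda>x. A x $ j $ i - q x * (y x $ j * w i x))
    (\<lambda>k. pdif k (\<lambda>x. A x $ j $ i) x - (- ((q x)\<^sup>2 * s * z x $ k * w k x) * (y x $ j * w i x)
      + q x * ((s * z x $ k * A x $ j $ k) * w i x + y x $ j * pdif k (w i) x))) x"
    by (intro has_pd_diff has_pd_mult dA dq dw dy x)
  from has_pd_pdif[OF this, of k] show "pdif k (\<lambda>x. A' x $ j $ i) x = F' x $ i $ k * A' x $ j $ k"
    using \<open>i \<noteq> k\<close>
    by (simp add: A'_def F'_def mult.assoc pdif_A[OF x] pdif_w[OF x]) (simp add: algebra_simps power2_eq_square)
next
  fix x i j k assume x: "x \<in> U" and ijk: "i \<noteq> j" "j \<noteq> k" "i \<noteq> (k::'n)"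
  then have "pdif k (\<lambda>x. F x $ i $ j) x = F x $ i $ k * F x $ k $ j"
    using sys by (simp add: system_I_def)
  then show "pdif k (\<lambda>x. F' x $ i $ j) x = F' x $ i $ k * F' x $ k $ j"
    unfolding dF'[OF x ijk(1)]
    using ijk by (simp add: F'_def pdif_w[OF x] pdif_z[OF x]) (simp add: algebra_simps power2_eq_square)
next
  fix x i j assume x: "x \<in> U" and ij: "i \<noteq> (j::'n)"
  define S where "S i = (\<Sum>l\<in>UNIV. F x $ i $ l * z x $ l)" for i
  \<comment> \<open>Off the diagonal \<open>F'\<close> is the modification \<open>?g\<close> of
    \<open>F\<close> by a matrix of rank one. Forcing the diagonal to 0 changes only the summands
    with index i and j, which are split off.\<close>
  let ?g = "\<lambda>i k. F x $ i $ k - s * q x * w i x * z x $ k"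
  have F'g: "F' x $ i $ k = ?g i k + (if k = i then s * q x * w i x * z x $ i else 0)" for i k
    by (simp add: F'_def F[OF x])
  have "F' x $ i $ k * F' x $ j $ k = ?g i k * ?g j k
      + (if k = i then s * q x * w i x * z x $ i * ?g j i else 0)
      + (if k = j then s * q x * w j x * z x $ j * ?g i j else 0)" for k
    using ij by (simp add: F'g algebra_simps)
  then have "(\<Sum>k\<in>UNIV. F' x $ i $ k * F' x $ j $ k) = (\<Sum>k\<in>UNIV. ?g i k * ?g j k)
      + s * q x * w i x * z x $ i * ?g j i + s * q x * w j x * z x $ j * ?g i j"
    by (simp add: sum.distrib)
  also have "(\<Sum>k\<in>UNIV. ?g i k * ?g j k) = (\<Sum>k\<in>UNIV. F x $ i $ k * F x $ j $ k
      - s * q x * w j x * (F x $ i $ k * z x $ k) - s * q x * w i x * (F x $ j $ k * z x $ k)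
      + s\<^sup>2 * q x * w i x * w j x * (q x * (z x $ k * z x $ k)))"
    by (rule sum.cong) (simp_all add: algebra_simps power2_eq_square)
  \<comment> \<open>Here \<open>q |z|^2 = 2\<close> lowers the degree in \<open>q\<close>: the term
    becomes \<open>2 s^2 q w_i w_j\<close>, which cancels the two products with \<open>s w\<close>
    in the diagonal derivatives of \<open>z\<close>, while the sums \<open>S\<close> cancel among
    themselves.\<close>
  also have "\<dots> = (\<Sum>k\<in>UNIV. F x $ i $ k * F x $ j $ k) - s * q x * w j x * S i - s * q x * w i x * S j
      + s\<^sup>2 * q x * w i x * w j x * 2"
    unfolding q_zz[OF x, symmetric] S_def by (simp only: sum.distrib sum_subtractf flip: sum_distrib_left)
  finally have sum: "(\<Sum>k\<in>UNIV. F' x $ i $ k * F' x $ j $ k) = \<dots>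
      + s * q x * w i x * z x $ i * ?g j i + s * q x * w j x * z x $ j * ?g i j" .
  have "pdif j (\<lambda>x. F x $ i $ j) x + pdif i (\<lambda>x. F x $ j $ i) x + (\<Sum>k\<in>UNIV. F x $ i $ k * F x $ j $ k) = 0"
    using sys x ij unfolding system_I_def by blast
  then have e: "(\<Sum>k\<in>UNIV. F x $ i $ k * F x $ j $ k) = - pdif j (\<lambda>x. F x $ i $ j) x - pdif i (\<lambda>x. F x $ j $ i) x"
    by linarith
  have z: "pdif j (\<lambda>x. z x $ j) x = s * w j x - S j" "pdif i (\<lambda>x. z x $ i) x = s * w i x - S i"
    unfolding S_def by (rule pdif_z(2)[OF x])+
  show "pdif j (\<lambda>x. F' x $ i $ j) x + pdif i (\<lambda>x. F' x $ j $ i) x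
       + (\<Sum>k\<in>UNIV. F' x $ i $ k * F' x $ j $ k) = 0"
    unfolding dF'[OF x ij] dF'[OF x ij[symmetric]] sum pdif_w[OF x ij] pdif_w[OF x ij[symmetric]] z e
    by (simp add: algebra_simps power2_eq_square)
qed

text \<open>This is applied to the immersion and to an isometry from the induced metric to flat space.\<close>
lemma has_pd_transform_map:
  fixes Y h :: "real^'n \<Rightarrow> 'e::real_normed_vector"
  assumes x: "x \<in> U" and \<phi>: "has_pd \<phi> (\<lambda>i. - s * b x $ i * z x $ i) x"
    and Y: "has_pd Y (\<lambda>i. (b x $ i) *\<^sub>R S i) x" and h: "has_pd h (\<lambda>i. w i x *\<^sub>R S i) x"
  shows "has_pd (\<lambda>x. Y x + (q x * \<phi> x) *\<^sub>R h x)
    (\<lambda>i. (b x $ i + q x * \<phi> x * w i x) *\<^sub>R (S i - (q x * s * z x $ i) *\<^sub>R h x)) x"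
  by (rule has_pd_cong[OF has_pd_add[OF Y has_pd_scaleR[OF has_pd_mult[OF dq[OF x] \<phi>] h]]])
    (simp add: algebra_simps power2_eq_square)

text \<open>The bracket is the same vector as in \<open>has_pd_transform_map\<close>, so the
  transformed map and the transformed normals share one tangent frame.\<close>

lemma has_pd_transform_normal:
  fixes h :: "real^'n \<Rightarrow> 'e::real_normed_vector"
  assumes x: "x \<in> U" and N: "has_pd N (\<lambda>i. (A x $ j $ i) *\<^sub>R S i) x" and h: "has_pd h (\<lambda>i. w i x *\<^sub>R S i) x"
  shows "has_pd (\<lambda>x. N x - (q x * y x $ j) *\<^sub>R h x)
    (\<lambda>i. (A' x $ j $ i) *\<^sub>R (S i - (q x * s * z x $ i) *\<^sub>R h x)) x"
  by (rule has_pd_cong[OF has_pd_diff[OF N has_pd_scaleR[OF has_pd_mult[OF dq[OF x] dy[OF x]] h]]])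
    (simp add: A'_def algebra_simps power2_eq_square)

text \<open>This identifies \<open>F'\<close> with the rotation coefficients of the new
  metric.\<close>

lemma pdif_transformed_b:
  assumes x: "x \<in> U" and \<phi>: "has_pd \<phi> (\<lambda>i. - s * b x $ i * z x $ i) x" and b: "smooth_on U b"
    and db: "pdif k (\<lambda>x. b x $ i) x = F x $ i $ k * b x $ k" and "i \<noteq> k"
  shows "pdif k (\<lambda>x. b x $ i + q x * \<phi> x * w i x) x = F' x $ i $ k * (b x $ k + q x * \<phi> x * w k x)"
proof -
  have "has_pd (\<lambda>x. b x $ i + q x * (\<phi> x * w i x))
    (\<lambda>k. pdif k (\<lambda>x. b x $ i) x + (- ((q x)\<^sup>2 * s * z x $ k * w k x) * (\<phi> x * w i x)
      + q x * ((- s * b x $ k * z x $ k) * w i x + \<phi> x * pdif k (w i) x))) x"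
    by (intro has_pd_add has_pd_mult dq dw x \<phi> smooth_on_imp_has_pd[OF smooth_on_nth[OF U b]])
  from has_pd_pdif[OF this, of k] \<open>i \<noteq> k\<close> show ?thesis
    by (simp add: F'_def mult.assoc pdif_w[OF x] db) (simp add: algebra_simps power2_eq_square)
qed

end

section \<open>The Lax connection in components\<close>

lemma sum_UNIV_Plus:
  fixes f :: "'m::finite + 'n::finite \<Rightarrow> 'b::comm_monoid_add"
  shows "(\<Sum>k\<in>UNIV. f k) = (\<Sum>j\<in>UNIV. f (Inl j)) + (\<Sum>i\<in>UNIV. f (Inr i))"
  using sum.Plus[of "UNIV :: 'm set" "UNIV :: 'n set" f] by (simp add: o_def)

lemma block_nth [simp]:
  "block P Q R S $ Inl i $ Inl j = P $ i $ j" "block P Q R S $ Inl i $ Inr l = Q $ i $ l"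
  "block P Q R S $ Inr k $ Inl j = R $ k $ j" "block P Q R S $ Inr k $ Inr l = S $ k $ l"
  by (simp_all add: block_def)

lemma stack_vec_nth [simp]: "stack_vec p q $ Inl j = p $ j" "stack_vec p q $ Inr i = q $ i"
  by (simp_all add: stack_vec_def)

lemma mult_C_mat: "(M ** C_mat i) $ j $ k = (if k = i then M $ j $ i else 0)"
proof -
  have "M $ j $ l * C_mat i $ l $ k = (if l = i then (if k = i then M $ j $ i else 0) else 0)" for l
    by (simp add: C_mat_def)
  then show ?thesis by (simp add: matrix_matrix_mult_def)
qed

lemma C_mat_mult: "(C_mat i ** M) $ k $ j = (if k = i then M $ i $ j else 0)"
proof -
  have "C_mat i $ k $ l * M $ l $ j = (if l = i then (if k = i then M $ i $ j else 0) else 0)" for l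
    by (simp add: C_mat_def)
  then show ?thesis by (simp add: matrix_matrix_mult_def)
qed

text \<open>The entries of the skew block \<open>C_i F - F^t C_i\<close>, the only nonzero block of
  the Lax connection at parameter 0.\<close>

definition gauge_coeff :: "real^'n^'n \<Rightarrow> 'n::finite \<Rightarrow> 'n \<Rightarrow> 'n \<Rightarrow> real"
  where "gauge_coeff F i k l = (if k = i then F $ i $ l else 0) - (if l = i then F $ i $ k else 0)"

lemma lax_I_nth [simp]:
  "lax_I A F \<mu> i x $ Inl a $ Inl b = 0"
  "lax_I A F \<mu> i x $ Inl a $ Inr l = (if l = i then - (\<mu> * of_real (A x $ a $ i)) else 0)"
  "lax_I A F \<mu> i x $ Inr k $ Inl b = (if k = i then \<mu> * of_real (A x $ b $ i) else 0)"
  "lax_I A F \<mu> i x $ Inr k $ Inr l = of_real (gauge_coeff (F x) i k l)"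
  by (simp_all add: lax_I_def cscale_def map_matrix_def mult_C_mat C_mat_mult transpose_def gauge_coeff_def)

lemma smooth_on_if:
  "(c \<Longrightarrow> smooth_on U f) \<Longrightarrow> (\<not> c \<Longrightarrow> smooth_on U g) \<Longrightarrow> smooth_on U (\<lambda>x. if c then f x else g x)"
  by (cases c) simp_all

lemma smooth_on_of_real:
  "open U \<Longrightarrow> smooth_on U f \<Longrightarrow> smooth_on U (\<lambda>x. complex_of_real (f x))"
  by (rule smooth_on_bounded_linear[OF bounded_linear_of_real])

lemma has_pd_of_real:
  "has_pd f D x \<Longrightarrow> has_pd (\<lambda>x. complex_of_real (f x)) (\<lambda>i. complex_of_real (D i)) x"
  by (rule has_pd_bounded_linear[OF bounded_linear_of_real])

lemma smooth_gauge_coeff: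
  assumes U: "open U" and F: "smooth_on U F"
  shows "smooth_on U (\<lambda>x. gauge_coeff (F x) i k l)"
  unfolding gauge_coeff_def
  by (cases "k = i"; cases "l = i")
    (simp_all add: smooth_on_diff smooth_on_nth smooth_on_const smooth_on_minus U F)

lemma smooth_lax_I:
  assumes U: "open U" and A: "smooth_on U A" and F: "smooth_on U F"
  shows "smooth_on U (\<lambda>x. lax_I A F \<mu> i x $ k $ l)"
proof -
  have "smooth_on U (\<lambda>x. \<mu> * complex_of_real (A x $ a $ i))" for a
    by (intro smooth_on_mult smooth_on_const smooth_on_of_real smooth_on_nth U A)
  then show ?thesis
    by (cases k; cases l)
      (auto intro!: smooth_on_if smooth_on_const smooth_on_minus smooth_on_of_real smooth_gauge_coeff U F)
qed

lemma pdif_nth_nth: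
  fixes f :: "real^'n::finite \<Rightarrow> 'b::real_normed_vector^'l::finite^'k::finite"
  assumes "f differentiable at x"
  shows "pdif i f x $ k $ l = pdif i (\<lambda>x. f x $ k $ l) x"
  using has_pd_pdif[OF has_pd_nth[OF has_pd_nth[OF differentiable_imp_has_pd[OF assms]]]] by metis

lemma sum_if_mult:
  fixes f g :: "'k::finite \<Rightarrow> 'b::semiring_0"
  shows "(\<Sum>p\<in>UNIV. (if p = i then f p else 0) * g p) = f i * g i"
    "(\<Sum>p\<in>UNIV. g p * (if p = i then f p else 0)) = g i * f i"
  by (simp_all add: if_distrib[of "\<lambda>c. c * _"] if_distrib[of "\<lambda>c. _ * c"] cong: if_cong)

lemma gauge_coeff_mult:
  assumes "\<And>i. M $ i $ i = 0" "i \<noteq> j"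
  shows "(\<Sum>p\<in>UNIV. gauge_coeff M i k p * gauge_coeff M j p l)
    = (if k = i then M $ i $ j * M $ j $ l else 0)
      + (if l = j then M $ i $ k * M $ j $ i - (if k = i then \<Sum>p\<in>UNIV. M $ i $ p * M $ j $ p else 0) else 0)"
proof -
  have "gauge_coeff M i k p * gauge_coeff M j p l
    = (if p = j then (if k = i then M $ i $ j * M $ j $ l else 0) else 0)
      + (if p = i then (if l = j then M $ i $ k * M $ j $ i else 0) else 0)
      - (if k = i \<and> l = j then M $ i $ p * M $ j $ p else 0)" for p
    using assms by (auto simp: gauge_coeff_def)
  then show ?thesis by (simp add: sum.distrib sum_subtractf)
qed

context
  fixes U :: "(real^'n::finite) set" and A :: "real^'n \<Rightarrow> real^'n^'m::finite" and F :: "real^'n \<Rightarrow> real^'n^'n"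
  assumes U: "open U" and A: "smooth_on U A" and F: "smooth_on U F"
begin

lemma lax_I_differentiable: "x \<in> U \<Longrightarrow> lax_I A F \<mu> i differentiable at x"
proof -
  assume x: "x \<in> U"
  have "smooth_on U (lax_I A F \<mu> i)"
    by (simp add: smooth_on_vec_iff[OF U] smooth_lax_I[OF U A F])
  from smooth_on_has_derivative[OF this x] show ?thesis
    unfolding differentiable_def by blast
qed

lemma pdif_lax_I:
  assumes x: "x \<in> U"
  shows "pdif p (lax_I A F \<mu> i) x $ Inl a $ Inl b = 0"
  "pdif p (lax_I A F \<mu> i) x $ Inl a $ Inr l = (if l = i then - (\<mu> * of_real (pdif p (\<lambda>x. A x $ a $ i) x)) else 0)"
  "pdif p (lax_I A F \<mu> i) x $ Inr k $ Inl b = (if k = i then \<mu> * of_real (pdif p (\<lambda>x. A x $ b $ i) x) else 0)"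
  "pdif p (lax_I A F \<mu> i) x $ Inr k $ Inr l = of_real ((if k = i then pdif p (\<lambda>x. F x $ i $ l) x else 0)
     - (if l = i then pdif p (\<lambda>x. F x $ i $ k) x else 0))"
proof -
  note nth = pdif_nth_nth[OF lax_I_differentiable[OF x]]
  have "has_pd (\<lambda>x. A x $ a $ i) (\<lambda>p. pdif p (\<lambda>x. A x $ a $ i) x) x" for a
    by (rule smooth_on_imp_has_pd[OF smooth_on_nth[OF U smooth_on_nth[OF U A]] x])
  note dA = has_pd_cmult[OF has_pd_of_real[OF this], of \<mu>]
  have dF: "has_pd (\<lambda>x. F x $ i $ k) (\<lambda>p. pdif p (\<lambda>x. F x $ i $ k) x) x" for k
    by (rule smooth_on_imp_has_pd[OF smooth_on_nth[OF U smooth_on_nth[OF U F]] x])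
  have const: "pdif p (\<lambda>x. c) x = 0" for c :: complex
    by (rule has_pd_pdif[OF has_pd_const])
  show "pdif p (lax_I A F \<mu> i) x $ Inl a $ Inl b = 0"
    by (simp add: nth const)
  show "pdif p (lax_I A F \<mu> i) x $ Inl a $ Inr l = (if l = i then - (\<mu> * of_real (pdif p (\<lambda>x. A x $ a $ i) x)) else 0)"
    unfolding nth lax_I_nth by (auto simp: const has_pd_pdif[OF has_pd_minus[OF dA]])
  show "pdif p (lax_I A F \<mu> i) x $ Inr k $ Inl b = (if k = i then \<mu> * of_real (pdif p (\<lambda>x. A x $ b $ i) x) else 0)"
    unfolding nth lax_I_nth by (auto simp: const has_pd_pdif[OF dA])
  have "has_pd (\<lambda>x. gauge_coeff (F x) i k l) (\<lambda>p. (if k = i then pdif p (\<lambda>x. F x $ i $ l) x else 0)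
     - (if l = i then pdif p (\<lambda>x. F x $ i $ k) x else 0)) x"
    unfolding gauge_coeff_def
    by (cases "k = i"; cases "l = i") (simp_all add: has_pd_diff[OF dF dF] dF has_pd_minus[OF dF] has_pd_const)
  from has_pd_pdif[OF has_pd_of_real[OF this]]
  show "pdif p (lax_I A F \<mu> i) x $ Inr k $ Inr l = of_real ((if k = i then pdif p (\<lambda>x. F x $ i $ l) x else 0)
     - (if l = i then pdif p (\<lambda>x. F x $ i $ k) x else 0))"
    unfolding nth lax_I_nth .
qed

lemma lax_I_mult:
  assumes x: "x \<in> U" and AA: "transpose (A x) ** A x = mat 1" and "i \<noteq> j"
  shows "(lax_I A F \<mu> i x ** lax_I A F \<mu> j x) $ Inl a $ Inl b = 0"
  "(lax_I A F \<mu> i x ** lax_I A F \<mu> j x) $ Inl a $ Inr l = - (\<mu> * of_real (A x $ a $ i * gauge_coeff (F x) j i l))"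
  "(lax_I A F \<mu> i x ** lax_I A F \<mu> j x) $ Inr k $ Inl b = \<mu> * of_real (gauge_coeff (F x) i k j * A x $ b $ j)"
  "(lax_I A F \<mu> i x ** lax_I A F \<mu> j x) $ Inr k $ Inr l
    = of_real (\<Sum>p\<in>UNIV. gauge_coeff (F x) i k p * gauge_coeff (F x) j p l)"
proof -
  show "(lax_I A F \<mu> i x ** lax_I A F \<mu> j x) $ Inl a $ Inl b = 0"
    using \<open>i \<noteq> j\<close> by (simp add: matrix_matrix_mult_def sum_UNIV_Plus sum_if_mult)
  show "(lax_I A F \<mu> i x ** lax_I A F \<mu> j x) $ Inl a $ Inr l = - (\<mu> * of_real (A x $ a $ i * gauge_coeff (F x) j i l))"
    by (simp add: matrix_matrix_mult_def sum_UNIV_Plus sum_if_mult)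
  show "(lax_I A F \<mu> i x ** lax_I A F \<mu> j x) $ Inr k $ Inl b = \<mu> * of_real (gauge_coeff (F x) i k j * A x $ b $ j)"
    by (simp add: matrix_matrix_mult_def sum_UNIV_Plus sum_if_mult)
  \<comment> \<open>The part of order two in the parameter is an inner product of distinct columns
    of \<open>A\<close>.\<close>
  have "(\<Sum>a\<in>UNIV. A x $ a $ i * A x $ a $ j) = 0"
    using AA \<open>i \<noteq> j\<close> by (simp add: vec_eq_iff matrix_matrix_mult_def transpose_def mat_def)
  then have "(\<Sum>a\<in>UNIV. of_real (A x $ a $ i) * of_real (A x $ a $ j)) = (0::complex)"
    by (simp flip: of_real_mult of_real_sum)
  then have "(\<Sum>a\<in>UNIV. \<mu> * of_real (A x $ a $ i) * (\<mu> * of_real (A x $ a $ j))) = 0"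
    by (simp add: mult_ac flip: sum_distrib_left)
  then show "(lax_I A F \<mu> i x ** lax_I A F \<mu> j x) $ Inr k $ Inr l
    = of_real (\<Sum>p\<in>UNIV. gauge_coeff (F x) i k p * gauge_coeff (F x) j p l)"
    by (cases "k = i"; cases "l = j") (simp_all add: matrix_matrix_mult_def sum_UNIV_Plus sum_negf)
qed

text \<open>Parameter 1 already yields everything: in the curvature the order-two terms vanish, and
  the terms of orders one and zero lie in different blocks.\<close>

lemma flat_lax_I_imp_system_I:
  assumes AA: "\<And>x. x \<in> U \<Longrightarrow> transpose (A x) ** A x = mat 1"
    and F0: "\<And>x i. x \<in> U \<Longrightarrow> F x $ i $ i = 0"
    and flat: "\<And>\<mu>. flat_connection U (lax_I A F \<mu>)"
  shows "system_I U A F"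
  unfolding system_I_def
proof (intro ballI)
  fix x assume x: "x \<in> U"
  let ?\<theta> = "lax_I A F 1"
  have *: "(pdif i (?\<theta> j) x - pdif j (?\<theta> i) x + (?\<theta> i x ** ?\<theta> j x - ?\<theta> j x ** ?\<theta> i x)) $ k $ l = 0" for i j k l
    using flat[of 1] x unfolding flat_connection_def by simp
  have a: "pdif k (\<lambda>x. A x $ j $ i) x = F x $ i $ k * A x $ j $ k" if ik: "i \<noteq> k" for i k j
  proof -
    have "complex_of_real (- pdif k (\<lambda>x. A x $ j $ i) x + F x $ i $ k * A x $ j $ k) = 0"
      using *[of k i "Inl j" "Inr i"] ik F0[OF x]
      by (simp add: pdif_lax_I[OF x] lax_I_mult[OF x AA[OF x] ik] lax_I_mult[OF x AA[OF x] ik[symmetric]]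
          gauge_coeff_def)
    then show ?thesis by (simp only: of_real_eq_0_iff)
  qed
  have fc: "(if k = j then pdif i (\<lambda>x. F x $ j $ l) x else 0) - (if l = j then pdif i (\<lambda>x. F x $ j $ k) x else 0)
      - ((if k = i then pdif j (\<lambda>x. F x $ i $ l) x else 0) - (if l = i then pdif j (\<lambda>x. F x $ i $ k) x else 0))
      + ((\<Sum>p\<in>UNIV. gauge_coeff (F x) i k p * gauge_coeff (F x) j p l)
        - (\<Sum>p\<in>UNIV. gauge_coeff (F x) j k p * gauge_coeff (F x) i p l)) = 0" (is "?r = 0") if ij: "i \<noteq> j" for i j k l
  proof -
    have "complex_of_real ?r = 0"
      using *[where i=i and j=j and k="Inr k" and l="Inr l"]
      by (simp only: vector_add_component vector_minus_component pdif_lax_I[OF x] of_real_diff of_real_add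
          lax_I_mult[OF x AA[OF x] ij] lax_I_mult[OF x AA[OF x] ij[symmetric]])
    then show ?thesis by (simp only: of_real_eq_0_iff)
  qed
  have b: "pdif k (\<lambda>x. F x $ i $ j) x = F x $ i $ k * F x $ k $ j" if "i \<noteq> j" "j \<noteq> k" "i \<noteq> k" for i j k
    using fc[of k i i j] that F0[OF x] by (simp add: gauge_coeff_mult)
  have c: "pdif j (\<lambda>x. F x $ i $ j) x + pdif i (\<lambda>x. F x $ j $ i) x
       + (\<Sum>k\<in>UNIV. F x $ i $ k * F x $ j $ k) = 0" if "i \<noteq> j" for i j
    using fc[where i=i and j=j and k=i and l=j] that F0[OF x] by (simp add: gauge_coeff_mult)
  show "(\<forall>i k j. i \<noteq> k \<longrightarrow> pdif k (\<lambda>x. A x $ j $ i) x = F x $ i $ k * A x $ j $ k) \<and>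
    (\<forall>i j k. i \<noteq> j \<longrightarrow> j \<noteq> k \<longrightarrow> i \<noteq> k \<longrightarrow> pdif k (\<lambda>x. F x $ i $ j) x = F x $ i $ k * F x $ k $ j) \<and>
    (\<forall>i j. i \<noteq> j \<longrightarrow> pdif j (\<lambda>x. F x $ i $ j) x + pdif i (\<lambda>x. F x $ j $ i) x
       + (\<Sum>k\<in>UNIV. F x $ i $ k * F x $ j $ k) = 0)"
    using a b c by blast
qed

lemma system_I_imp_flat_lax_I:
  assumes AA: "\<And>x. x \<in> U \<Longrightarrow> transpose (A x) ** A x = mat 1"
    and F0: "\<And>x i. x \<in> U \<Longrightarrow> F x $ i $ i = 0"
    and sys: "system_I U A F"
  shows "flat_connection U (lax_I A F \<mu>)"
  unfolding flat_connection_def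
proof (intro conjI ballI allI lax_I_differentiable)
  fix x i j assume x: "x \<in> U"
  let ?\<theta> = "lax_I A F \<mu>"
  show "pdif i (?\<theta> j) x - pdif j (?\<theta> i) x + (?\<theta> i x ** ?\<theta> j x - ?\<theta> j x ** ?\<theta> i x) = 0"
  proof (cases "i = j")
    case ij: False
    have a: "pdif k (\<lambda>x. A x $ j $ i) x = F x $ i $ k * A x $ j $ k" if "i \<noteq> k" for i k j
      using sys x that unfolding system_I_def by blast
    have b: "pdif k (\<lambda>x. F x $ i $ j) x = F x $ i $ k * F x $ k $ j" if "i \<noteq> j" "j \<noteq> k" "i \<noteq> k" for i j k
      using sys x that unfolding system_I_def by blast
    have "pdif j (\<lambda>x. F x $ i $ j) x + pdif i (\<lambda>x. F x $ j $ i) x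
       + (\<Sum>k\<in>UNIV. F x $ i $ k * F x $ j $ k) = 0"
      using sys x ij unfolding system_I_def by blast
    then have c: "(\<Sum>k\<in>UNIV. F x $ i $ k * F x $ j $ k) = - pdif j (\<lambda>x. F x $ i $ j) x - pdif i (\<lambda>x. F x $ j $ i) x"
      by linarith
    have c': "(\<Sum>k\<in>UNIV. F x $ j $ k * F x $ i $ k) = - pdif j (\<lambda>x. F x $ i $ j) x - pdif i (\<lambda>x. F x $ j $ i) x"
      using c by (simp add: mult.commute)
    note mult = lax_I_mult[OF x AA[OF x] ij] lax_I_mult[OF x AA[OF x] ij[symmetric]]
    \<comment> \<open>A derivative on the diagonal of \<open>F\<close> occurs when both matrix
      indices coincide; it is 0 because the diagonal vanishes on the whole open set.\<close>
    have F_const: "pdif p (\<lambda>x. F x $ k $ k) x = 0" for p k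
      by (rule has_pd_pdif[OF has_pd_transform[OF U x has_pd_const[of 0]]]) (simp add: F0)
    have fc: "(if k = j then pdif i (\<lambda>x. F x $ j $ l) x else 0) - (if l = j then pdif i (\<lambda>x. F x $ j $ k) x else 0)
      - ((if k = i then pdif j (\<lambda>x. F x $ i $ l) x else 0) - (if l = i then pdif j (\<lambda>x. F x $ i $ k) x else 0))
      + ((\<Sum>p\<in>UNIV. gauge_coeff (F x) i k p * gauge_coeff (F x) j p l)
        - (\<Sum>p\<in>UNIV. gauge_coeff (F x) j k p * gauge_coeff (F x) i p l)) = 0" for k l
      using ij F0[OF x] b[of j l i] b[of j k i] b[of i l j] b[of i k j] F_const
      by (cases "k = i"; cases "k = j"; cases "l = i"; cases "l = j") (simp_all add: gauge_coeff_mult c c')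
    have "(pdif i (?\<theta> j) x - pdif j (?\<theta> i) x + (?\<theta> i x ** ?\<theta> j x - ?\<theta> j x ** ?\<theta> i x)) $ k $ l = 0" for k l
    proof (cases k; cases l)
      fix a b assume "k = Inl a" "l = Inl b"
      then show ?thesis by (simp add: pdif_lax_I[OF x] mult)
    next
      fix a l' assume "k = Inl a" "l = Inr l'"
      then show ?thesis
        using ij F0[OF x] a[of j i] a[of i j]
        by (cases "l' = i"; cases "l' = j") (simp_all add: pdif_lax_I[OF x] mult gauge_coeff_def)
    next
      fix a k' assume "k = Inr k'" "l = Inl a"
      then show ?thesis
        using ij F0[OF x] a[of j i] a[of i j]
        by (cases "k' = i"; cases "k' = j") (simp_all add: pdif_lax_I[OF x] mult gauge_coeff_def)
    next
      fix k' l' assume kl: "k = Inr k'" "l = Inr l'"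
      from arg_cong[OF fc[of k' l'], of complex_of_real] show ?thesis
        by (simp only: kl vector_add_component vector_minus_component pdif_lax_I[OF x] of_real_diff of_real_add
          mult of_real_0)
    qed
    then show ?thesis by (simp add: vec_eq_iff)
  qed simp
qed

end

section \<open>Frames in components\<close>

lemma frame_has_pd:
  assumes E: "frame_of U \<theta> E" and x: "x \<in> U"
  shows "has_pd (\<lambda>x. E x \<mu> $ r $ c) (\<lambda>i. \<Sum>l\<in>UNIV. E x \<mu> $ r $ l * \<theta> \<mu> i x $ l $ c) x"
proof -
  have "((\<lambda>y. E y \<mu>) has_derivative (\<lambda>v. E x \<mu> ** (\<Sum>i\<in>UNIV. v $ i *\<^sub>R \<theta> \<mu> i x))) (at x)"
    using E x by (simp add: frame_of_def)
  from has_pd_nth[OF has_pd_nth[OF has_derivative_imp_has_pd[OF this]], of r c]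
  show ?thesis by (simp add: sum_axis_scaleR matrix_matrix_mult_def)
qed

lemma sum_lax_I:
  "(\<Sum>l\<in>UNIV. f l * lax_I A F \<mu> i x $ l $ Inl j) = \<mu> * of_real (A x $ j $ i) * f (Inr i)"
  "(\<Sum>l\<in>UNIV. f l * lax_I A F \<mu> i x $ l $ Inr k) = of_real (F x $ i $ k) * f (Inr i)
      - (if k = i then \<mu> * (\<Sum>j\<in>UNIV. of_real (A x $ j $ i) * f (Inl j))
           + (\<Sum>l\<in>UNIV. of_real (F x $ i $ l) * f (Inr l)) else 0)"
proof -
  show "(\<Sum>l\<in>UNIV. f l * lax_I A F \<mu> i x $ l $ Inl j) = \<mu> * of_real (A x $ j $ i) * f (Inr i)"
    by (simp add: sum_UNIV_Plus sum_if_mult mult_ac)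
  have "f (Inr l) * complex_of_real (gauge_coeff (F x) i l k)
      = f (Inr l) * (if l = i then of_real (F x $ i $ k) else 0)
        - (if k = i then of_real (F x $ i $ l) * f (Inr l) else 0)" for l
    by (simp add: gauge_coeff_def algebra_simps)
  then have c: "(\<Sum>l\<in>UNIV. f (Inr l) * complex_of_real (gauge_coeff (F x) i l k))
    = of_real (F x $ i $ k) * f (Inr i) - (if k = i then \<Sum>l\<in>UNIV. of_real (F x $ i $ l) * f (Inr l) else 0)"
    by (simp add: sum_subtractf sum_if_mult(2)[where f = "\<lambda>_. of_real (F x $ i $ k)"])
  show "(\<Sum>l\<in>UNIV. f l * lax_I A F \<mu> i x $ l $ Inr k) = of_real (F x $ i $ k) * f (Inr i)
      - (if k = i then \<mu> * (\<Sum>j\<in>UNIV. of_real (A x $ j $ i) * f (Inl j))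
           + (\<Sum>l\<in>UNIV. of_real (F x $ i $ l) * f (Inr l)) else 0)"
    by (simp add: sum_UNIV_Plus c, simp add: sum_negf sum_distrib_left mult_ac)
qed

lemma frame_I_smooth:
  assumes E: "frame_of U (lax_I A F) E" and U: "open U" "smooth_on U A" "smooth_on U F"
  shows "smooth_on U (\<lambda>x. E x \<mu> $ r $ c)"
  by (rule linear_system_smooth_on[OF U(1), of "\<lambda>c x. E x \<mu> $ r $ c" "\<lambda>i l c x. lax_I A F \<mu> i x $ l $ c"])
    (rule frame_has_pd[OF E], assumption, rule smooth_lax_I[OF U])

text \<open>The row selection \<open>\<rho>\<close> allows two uses: \<open>id\<close> at parameter
  1 yields the adapted frame, and \<open>Inr\<close> at parameter 0 yields the frame
  \<open>B\<close> of R^n. At real parameters the Lax connection is real, so real parts satisfy the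
  same equations.\<close>

definition frame_col :: "('r::finite \<Rightarrow> 'm::finite + 'n::finite) \<Rightarrow> (real^'n \<Rightarrow> complex^('m+'n)^('m+'n))
    \<Rightarrow> 'm + 'n \<Rightarrow> real^'n \<Rightarrow> real^'r"
  where "frame_col \<rho> E c x = (\<chi> r. Re (E x $ \<rho> r $ c))"

lemma frame_col_has_pd:
  fixes \<rho> :: "'r::finite \<Rightarrow> 'm::finite + 'n::finite" and \<mu> :: real
  assumes E: "frame_of U (lax_I A F) E" and x: "x \<in> U"
  defines "col \<equiv> frame_col \<rho> (\<lambda>x. E x (complex_of_real \<mu>))"
  shows "has_pd (col (Inl j)) (\<lambda>i. (\<mu> * A x $ j $ i) *\<^sub>R col (Inr i) x) x"
    and "has_pd (col (Inr k)) (\<lambda>i. F x $ i $ k *\<^sub>R col (Inr i) x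
      - (if k = i then \<mu> *\<^sub>R (\<Sum>j\<in>UNIV. A x $ j $ i *\<^sub>R col (Inl j) x)
           + (\<Sum>l\<in>UNIV. F x $ i $ l *\<^sub>R col (Inr l) x) else 0)) x"
proof -
  note d = has_pd_bounded_linear[OF bounded_linear_Re frame_has_pd[OF E x]]
  have "has_pd (\<lambda>x. Re (E x (of_real \<mu>) $ r $ Inl j)) (\<lambda>i. (\<mu> * A x $ j $ i) * Re (E x (of_real \<mu>) $ r $ Inr i)) x" for r
    using d[of "of_real \<mu>" r "Inl j"] by (simp add: sum_lax_I flip: of_real_mult)
  then show "has_pd (col (Inl j)) (\<lambda>i. (\<mu> * A x $ j $ i) *\<^sub>R col (Inr i) x) x"
    by (simp add: has_pd_vec_iff col_def frame_col_def)
  have *: "has_pd (\<lambda>x. Re (E x (of_real \<mu>) $ r $ Inr k)) (\<lambda>i. F x $ i $ k * Re (E x (of_real \<mu>) $ r $ Inr i)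
      - (if k = i then \<mu> * (\<Sum>j\<in>UNIV. A x $ j $ i * Re (E x (of_real \<mu>) $ r $ Inl j))
           + (\<Sum>l\<in>UNIV. F x $ i $ l * Re (E x (of_real \<mu>) $ r $ Inr l)) else 0)) x" for r
    by (rule has_pd_cong[OF d[of "of_real \<mu>" r "Inr k"]]) (simp add: sum_lax_I)
  show "has_pd (col (Inr k)) (\<lambda>i. F x $ i $ k *\<^sub>R col (Inr i) x
      - (if k = i then \<mu> *\<^sub>R (\<Sum>j\<in>UNIV. A x $ j $ i *\<^sub>R col (Inl j) x)
           + (\<Sum>l\<in>UNIV. F x $ i $ l *\<^sub>R col (Inr l) x) else 0)) x"
    unfolding has_pd_vec_iff
  proof (intro allI)
    fix r
    have col: "col c x $ r = Re (E x (of_real \<mu>) $ \<rho> r $ c)" for c x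
      by (simp add: col_def frame_col_def)
    show "has_pd (\<lambda>x. col (Inr k) x $ r) (\<lambda>i. (F x $ i $ k *\<^sub>R col (Inr i) x
      - (if k = i then \<mu> *\<^sub>R (\<Sum>j\<in>UNIV. A x $ j $ i *\<^sub>R col (Inl j) x)
           + (\<Sum>l\<in>UNIV. F x $ i $ l *\<^sub>R col (Inr l) x) else 0)) $ r) x"
      unfolding col by (rule has_pd_cong[OF *[of "\<rho> r"]]) (simp add: col)
  qed
qed

lemma frame_col_smooth:
  assumes "frame_of U (lax_I A F) E" and U: "open U" "smooth_on U A" "smooth_on U F"
  shows "smooth_on U (frame_col \<rho> (\<lambda>x. E x \<mu>) c)"
  unfolding smooth_on_vec_iff[OF U(1)] frame_col_def
  using smooth_on_bounded_linear[OF bounded_linear_Re U(1) frame_I_smooth[OF assms]] by simp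

section \<open>Consequences of the reality condition\<close>

definition block_sign :: "'m + 'n \<Rightarrow> complex"
  where "block_sign k = (case k of Inl _ \<Rightarrow> 1 | Inr _ \<Rightarrow> - 1)"

lemma I_mn_nth: "I_mn $ k $ l = (if k = l then block_sign k else 0)"
  by (cases k; cases l) (auto simp: I_mn_def block_sign_def mat_def)

lemma block_sign_square [simp]: "block_sign k * block_sign k = 1"
  by (cases k) (auto simp: block_sign_def)

lemma I_mn_mult: "(I_mn ** M) $ k $ l = block_sign k * M $ k $ l"
proof -
  have "I_mn $ k $ p * M $ p $ l = (if p = k then block_sign k * M $ k $ l else 0)" for p
    by (simp add: I_mn_nth)
  then show ?thesis by (simp add: matrix_matrix_mult_def)
qed

lemma mult_I_mn: "(M ** I_mn) $ k $ l = M $ k $ l * block_sign l"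
proof -
  have "M $ k $ p * I_mn $ p $ l = (if p = l then M $ k $ l * block_sign l else 0)" for p
    by (simp add: I_mn_nth)
  then show ?thesis by (simp add: matrix_matrix_mult_def)
qed

lemma matrix_inv_eqI:
  fixes M :: "'a::semiring_1^'n::finite^'n"
  assumes "M ** M' = mat 1" "M' ** M = mat 1"
  shows "matrix_inv M = M'"
proof -
  have "M ** matrix_inv M = mat 1 \<and> matrix_inv M ** M = mat 1"
    unfolding matrix_inv_def by (rule someI[of _ M']) (use assms in blast)
  then have "M' ** (M ** matrix_inv M) = M'" by simp
  then show ?thesis by (simp add: matrix_mul_assoc assms)
qed

lemma matrix_inv_I_mn: "matrix_inv I_mn = I_mn"
proof (rule matrix_inv_eqI)
  show "I_mn ** I_mn = mat 1" by (simp add: vec_eq_iff I_mn_mult I_mn_nth mat_def)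
  then show "I_mn ** I_mn = mat 1" .
qed

lemma reality_conditionD:
  assumes "reality_condition U E" "x \<in> U"
  shows "cnj (E x (cnj \<mu>) $ k $ l) = E x \<mu> $ k $ l"
    and "block_sign k * E x \<mu> $ k $ l * block_sign l = E x (- \<mu>) $ k $ l"
    and "E x \<mu> ** transpose (E x \<mu>) = mat 1" "transpose (E x \<mu>) ** E x \<mu> = mat 1"
proof -
  have *: "(\<chi> k l. cnj (E x (cnj \<mu>) $ k $ l)) = E x \<mu>" "I_mn ** E x \<mu> ** I_mn = E x (- \<mu>)"
    "E x \<mu> ** transpose (E x \<mu>) = mat 1"
    using assms unfolding reality_condition_def matrix_inv_I_mn by blast+
  show "cnj (E x (cnj \<mu>) $ k $ l) = E x \<mu> $ k $ l"
    using arg_cong[OF *(1), of "\<lambda>M. M $ k $ l"] by simp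
  show "block_sign k * E x \<mu> $ k $ l * block_sign l = E x (- \<mu>) $ k $ l"
    using arg_cong[OF *(2), of "\<lambda>M. M $ k $ l"] by (simp add: I_mn_mult mult_I_mn)
  show "E x \<mu> ** transpose (E x \<mu>) = mat 1" by (rule *)
  then show "transpose (E x \<mu>) ** E x \<mu> = mat 1" by (simp add: matrix_left_right_inverse)
qed

text \<open>At an imaginary parameter the two involutions of the reality condition combine: entries
  are real in the diagonal blocks and imaginary in the off-diagonal ones. This preserves vectors of
  the form (real, i real).\<close>

lemma reality_imaginary:
  assumes "reality_condition U E" "x \<in> U" "cnj \<mu> = - \<mu>"
  shows "E x \<mu> $ k $ l = block_sign k * block_sign l * cnj (E x \<mu> $ k $ l)"
proof -
  have "cnj (E x \<mu> $ k $ l) = E x (- \<mu>) $ k $ l"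
    using reality_conditionD(1)[OF assms(1,2), of "- \<mu>" k l] assms(3) by simp
  also have "\<dots> = block_sign k * E x \<mu> $ k $ l * block_sign l"
    using reality_conditionD(2)[OF assms(1,2)] by simp
  finally have "block_sign k * block_sign l * cnj (E x \<mu> $ k $ l)
      = (block_sign k * block_sign k) * (block_sign l * block_sign l) * E x \<mu> $ k $ l"
    by (simp only: mult_ac)
  then show ?thesis by simp
qed

lemma matrix_inv_frame:
  "reality_condition U E \<Longrightarrow> x \<in> U \<Longrightarrow> matrix_inv (E x \<mu>) = transpose (E x \<mu>)"
  by (rule matrix_inv_eqI) (simp_all add: reality_conditionD)

section \<open>The dressed vectors\<close>

context dressing
begin

text \<open>The coefficient equations of \<open>z\<close> are dual to those of the frame, so all
  terms with \<open>F\<close> cancel. The remainder \<open>R i\<close> stands for the normal part of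
  the frame equation at parameter 1, and for 0 at parameter 0.\<close>

lemma has_pd_sum_z:
  fixes S :: "'n \<Rightarrow> real^'n \<Rightarrow> 'e::real_normed_vector"
  assumes x: "x \<in> U"
    and S: "\<And>k. has_pd (S k) (\<lambda>i. F x $ i $ k *\<^sub>R S i x
      - (if k = i then R i + (\<Sum>l\<in>UNIV. F x $ i $ l *\<^sub>R S l x) else 0)) x"
  shows "has_pd (\<lambda>x. \<Sum>k\<in>UNIV. z x $ k *\<^sub>R S k x) (\<lambda>i. (s * w i x) *\<^sub>R S i x - z x $ i *\<^sub>R R i) x"
proof (rule has_pd_cong[OF has_pd_sum[OF has_pd_scaleR[OF dz[OF x] S]]])
  fix i
  have "((if i = k then s * (\<Sum>j\<in>UNIV. A x $ j $ i * y x $ j) - (\<Sum>l\<in>UNIV. F x $ i $ l * z x $ l) else 0)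
        + F x $ i $ k * z x $ i) *\<^sub>R S k x
      + z x $ k *\<^sub>R (F x $ i $ k *\<^sub>R S i x - (if k = i then R i + (\<Sum>l\<in>UNIV. F x $ i $ l *\<^sub>R S l x) else 0))
    = (if k = i then (s * w i x - (\<Sum>l\<in>UNIV. F x $ i $ l * z x $ l)) *\<^sub>R S i x
         - z x $ i *\<^sub>R (R i + (\<Sum>l\<in>UNIV. F x $ i $ l *\<^sub>R S l x)) else 0)
      + z x $ i *\<^sub>R (F x $ i $ k *\<^sub>R S k x) + (F x $ i $ k * z x $ k) *\<^sub>R S i x" for k
    by (cases "k = i") (simp_all add: w_def algebra_simps)
  then show "(\<Sum>k\<in>UNIV. ((if i = k then s * (\<Sum>j\<in>UNIV. A x $ j $ i * y x $ j) - (\<Sum>l\<in>UNIV. F x $ i $ l * z x $ l) else 0)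
        + F x $ i $ k * z x $ i) *\<^sub>R S k x
      + z x $ k *\<^sub>R (F x $ i $ k *\<^sub>R S i x - (if k = i then R i + (\<Sum>l\<in>UNIV. F x $ i $ l *\<^sub>R S l x) else 0)))
    = (s * w i x) *\<^sub>R S i x - z x $ i *\<^sub>R R i"
    by (simp add: sum.distrib algebra_simps scaleR_sum_right scaleR_sum_left)
qed

text \<open>The weight \<open>s\<close> is what makes the normal terms cancel: the first sum gains
  \<open>s z_i a_ji N_j\<close>, and \<open>s\<close> times the second sum loses it. The tangential
  coefficients \<open>w_i\<close> and \<open>s^2 w_i\<close> remain.\<close>

lemma has_pd_sum_yz:
  fixes N :: "'m \<Rightarrow> real^'n \<Rightarrow> 'e::real_normed_vector"
  assumes x: "x \<in> U"
    and N: "\<And>j. has_pd (N j) (\<lambda>i. A x $ j $ i *\<^sub>R S i x) x"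
    and S: "\<And>k. has_pd (S k) (\<lambda>i. F x $ i $ k *\<^sub>R S i x
      - (if k = i then (\<Sum>j\<in>UNIV. A x $ j $ i *\<^sub>R N j x) + (\<Sum>l\<in>UNIV. F x $ i $ l *\<^sub>R S l x) else 0)) x"
  shows "has_pd (\<lambda>x. (\<Sum>j\<in>UNIV. y x $ j *\<^sub>R N j x) + s *\<^sub>R (\<Sum>k\<in>UNIV. z x $ k *\<^sub>R S k x))
    (\<lambda>i. ((1 + s\<^sup>2) * w i x) *\<^sub>R S i x) x"
proof (rule has_pd_cong[OF has_pd_add[OF has_pd_sum[OF has_pd_scaleR[OF dy[OF x] N]]
        has_pd_cscaleR[OF has_pd_sum_z[OF x S]]]])
  fix i
  show "(\<Sum>j\<in>UNIV. (s * z x $ i * A x $ j $ i) *\<^sub>R N j x + y x $ j *\<^sub>R A x $ j $ i *\<^sub>R S i x) +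
         s *\<^sub>R ((s * w i x) *\<^sub>R S i x - z x $ i *\<^sub>R (\<Sum>j\<in>UNIV. A x $ j $ i *\<^sub>R N j x))
    = ((1 + s\<^sup>2) * w i x) *\<^sub>R S i x"
    by (simp add: w_def sum.distrib algebra_simps power2_eq_square scaleR_sum_right scaleR_sum_left)
qed

end

context
  fixes U :: "(real^'n::finite) set" and A :: "real^'n \<Rightarrow> real^'n^'m::finite" and F :: "real^'n \<Rightarrow> real^'n^'n"
    and E :: "real^'n \<Rightarrow> complex \<Rightarrow> complex^('m+'n)^('m+'n)" and s :: real and W :: "real^'m" and Z :: "real^'n"
  assumes frame: "frame_of U (lax_I A F) E"
begin

abbreviation (input) "\<mu>s \<equiv> - \<i> * complex_of_real s"
abbreviation (input) "vs \<equiv> stack_vec (cvec W) (\<chi> i. \<i> * complex_of_real (Z $ i)) :: complex^('m+'n)"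

lemma reality: "reality_condition U E"
  using frame by (simp add: frame_of_def)

lemma dressed_nth:
  "x \<in> U \<Longrightarrow> dressed E s W Z x $ c = (\<Sum>r\<in>UNIV. E x \<mu>s $ r $ c * vs $ r)"
  by (simp add: dressed_def matrix_inv_frame[OF reality] matrix_vector_mult_def transpose_def)

lemma dressed_real:
  assumes x: "x \<in> U"
  shows "dressed E s W Z x $ Inl j = of_real (W_tilde E s W Z x $ j)"
    and "dressed E s W Z x $ Inr k = \<i> * of_real (Z_tilde E s W Z x $ k)"
proof -
  have vs: "cnj (vs $ r) = block_sign r * vs $ r" for r
    by (cases r) (simp_all add: block_sign_def cvec_def)
  have "cnj (E x \<mu>s $ r $ c * vs $ r) = block_sign c * (E x \<mu>s $ r $ c * vs $ r)" for r c
  proof -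
    have "cnj (E x \<mu>s $ r $ c) = cnj (block_sign r * block_sign c * cnj (E x \<mu>s $ r $ c))"
      by (subst reality_imaginary[OF reality x]) simp_all
    also have "\<dots> = block_sign r * block_sign c * E x \<mu>s $ r $ c"
      by (simp add: block_sign_def split: sum.split)
    finally have "cnj (E x \<mu>s $ r $ c * vs $ r)
        = (block_sign r * block_sign r) * (block_sign c * (E x \<mu>s $ r $ c * vs $ r))"
      unfolding complex_cnj_mult vs by (simp only: mult_ac)
    then show ?thesis by simp
  qed
  then have c: "cnj (dressed E s W Z x $ c) = block_sign c * dressed E s W Z x $ c" for c
    by (simp only: dressed_nth[OF x] cnj_sum sum_distrib_left)
  show "dressed E s W Z x $ Inl j = of_real (W_tilde E s W Z x $ j)"
    using c[of "Inl j"] by (simp add: W_tilde_def block_sign_def complex_eq_iff)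
  show "dressed E s W Z x $ Inr k = \<i> * of_real (Z_tilde E s W Z x $ k)"
    using c[of "Inr k"] by (simp add: Z_tilde_def block_sign_def complex_eq_iff)
qed

lemma dressed_has_pd:
  assumes x: "x \<in> U" and U: "open U"
  shows "has_pd (\<lambda>x. dressed E s W Z x $ c) (\<lambda>i. \<Sum>l\<in>UNIV. dressed E s W Z x $ l * lax_I A F \<mu>s i x $ l $ c) x"
proof (rule has_pd_transform[OF U x])
  have "has_pd (\<lambda>x. \<Sum>r\<in>UNIV. E x \<mu>s $ r $ c * vs $ r)
    (\<lambda>i. \<Sum>r\<in>UNIV. (\<Sum>l\<in>UNIV. E x \<mu>s $ r $ l * lax_I A F \<mu>s i x $ l $ c) * vs $ r) x"
    by (intro has_pd_sum has_pd_bounded_linear[OF bounded_linear_mult_left] frame_has_pd[OF frame x])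
  then show "has_pd (\<lambda>x. \<Sum>r\<in>UNIV. E x \<mu>s $ r $ c * vs $ r)
    (\<lambda>i. \<Sum>l\<in>UNIV. dressed E s W Z x $ l * lax_I A F \<mu>s i x $ l $ c) x"
  proof (rule has_pd_cong)
    fix i
    show "(\<Sum>r\<in>UNIV. (\<Sum>l\<in>UNIV. E x \<mu>s $ r $ l * lax_I A F \<mu>s i x $ l $ c) * vs $ r)
      = (\<Sum>l\<in>UNIV. dressed E s W Z x $ l * lax_I A F \<mu>s i x $ l $ c)"
      unfolding dressed_nth[OF x] sum_distrib_right
      by (subst sum.swap) (simp only: mult_ac)
  qed
qed (simp add: dressed_nth)

lemma dressing_of_frame:
  assumes U: "open U" and sol: "GmnI_solution U A F"
    and s: "s \<noteq> 0" and W: "norm W = 1" and Z: "norm Z = 1"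
  shows "dressing U A F (W_tilde E s W Z) (Z_tilde E s W Z) s"
proof -
  have smooth: "smooth_on U A" "smooth_on U F" and AA: "\<And>x. x \<in> U \<Longrightarrow> transpose (A x) ** A x = mat 1"
    and F0: "\<And>x i. x \<in> U \<Longrightarrow> F x $ i $ i = 0" and flat: "\<And>\<mu>. flat_connection U (lax_I A F \<mu>)"
    using sol by (auto simp: GmnI_solution_def)
  let ?d = "dressed E s W Z" and ?y = "W_tilde E s W Z" and ?z = "Z_tilde E s W Z"
  have smooth_d: "smooth_on U (\<lambda>x. ?d x $ c)" for c
  proof (rule smooth_on_cong[OF U])
    show "smooth_on U (\<lambda>x. \<Sum>r\<in>UNIV. E x \<mu>s $ r $ c * vs $ r)"
      by (intro smooth_on_sum smooth_on_mult smooth_on_const frame_I_smooth[OF frame] U smooth)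
  qed (simp add: dressed_nth)
  show ?thesis
  proof
    show "smooth_on U ?y"
      unfolding smooth_on_vec_iff[OF U] W_tilde_def
      using smooth_on_bounded_linear[OF bounded_linear_Re U smooth_d] by simp
    show "smooth_on U ?z"
      unfolding smooth_on_vec_iff[OF U] Z_tilde_def
      using smooth_on_bounded_linear[OF bounded_linear_Im U smooth_d] by simp
    show "system_I U A F"
      by (rule flat_lax_I_imp_system_I[OF U smooth AA F0 flat])
    fix x assume x: "x \<in> U"
    note d = dressed_has_pd[OF x U]
    note re = dressed_real[OF x]
    show "has_pd (\<lambda>x. ?y x $ j) (\<lambda>i. s * ?z x $ i * A x $ j $ i) x" for j
      using has_pd_bounded_linear[OF bounded_linear_Re d, of "Inl j"]
      by (simp add: sum_lax_I re) (simp add: W_tilde_def mult_ac)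
    have "Im (\<Sum>l\<in>UNIV. ?d x $ l * lax_I A F \<mu>s i x $ l $ Inr k)
      = (if i = k then s * (\<Sum>j\<in>UNIV. A x $ j $ i * ?y x $ j) - (\<Sum>l\<in>UNIV. F x $ i $ l * ?z x $ l) else 0)
        + F x $ i $ k * ?z x $ i" for i k
      by (simp add: sum_lax_I re)
    then show "has_pd (\<lambda>x. ?z x $ k) (\<lambda>i. (if i = k then s * (\<Sum>j\<in>UNIV. A x $ j $ i * ?y x $ j)
        - (\<Sum>l\<in>UNIV. F x $ i $ l * ?z x $ l) else 0) + F x $ i $ k * ?z x $ i) x" for k
      using has_pd_bounded_linear[OF bounded_linear_Im d, of "Inr k"] by (simp add: Z_tilde_def)
    have d: "?d x = transpose (E x \<mu>s) *v vs"
      by (simp add: dressed_def matrix_inv_frame[OF reality x])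
    have Ed: "E x \<mu>s *v ?d x = vs"
      by (simp only: d matrix_vector_mul_assoc reality_conditionD(3)[OF reality x] matrix_vector_mul_lid)
    have i: "\<i> * c * (\<i> * c) = - (c * c)" for c
      by (simp add: complex_eq_iff)
    have norm_vs: "(\<Sum>r\<in>UNIV. vs $ r * vs $ r) = 0"
    proof -
      have "W \<bullet> W = 1" "Z \<bullet> Z = 1"
        using W Z by (simp_all add: dot_square_norm)
      then have "complex_of_real (\<Sum>j\<in>UNIV. W $ j * W $ j) = 1" "complex_of_real (\<Sum>j\<in>UNIV. Z $ j * Z $ j) = 1"
        by (simp_all add: inner_vec_def)
      then show ?thesis by (simp add: sum_UNIV_Plus cvec_def sum_negf i)
    qed
    \<comment> \<open>A frame is complex orthogonal, so it preserves the bilinear form, not the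
      Hermitian one. For unit vectors W and Z the vector \<open>(W, iZ)\<close> is isotropic, hence
      so is \<open>(y, iz)\<close>, which is the equality of norms.\<close>
    have "(\<Sum>c\<in>UNIV. ?d x $ c * ?d x $ c) = (\<Sum>r\<in>UNIV. (E x \<mu>s *v ?d x) $ r * vs $ r)"
    proof -
      have "(\<Sum>c\<in>UNIV. ?d x $ c * ?d x $ c) = (\<Sum>c\<in>UNIV. \<Sum>r\<in>UNIV. ?d x $ c * (E x \<mu>s $ r $ c * vs $ r))"
        by (subst (2) dressed_nth[OF x]) (simp only: sum_distrib_left)
      also have "\<dots> = (\<Sum>r\<in>UNIV. \<Sum>c\<in>UNIV. ?d x $ c * (E x \<mu>s $ r $ c * vs $ r))"
        by (rule sum.swap)
      also have "\<dots> = (\<Sum>r\<in>UNIV. (E x \<mu>s *v ?d x) $ r * vs $ r)"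
        unfolding matrix_vector_mult_def vec_lambda_beta sum_distrib_right by (simp only: mult_ac)
      finally show ?thesis .
    qed
    then have "(\<Sum>c\<in>UNIV. ?d x $ c * ?d x $ c) = 0"
      by (simp only: Ed norm_vs)
    then have "complex_of_real (?y x \<bullet> ?y x - ?z x \<bullet> ?z x) = 0"
      by (simp add: sum_UNIV_Plus re inner_vec_def sum_negf i)
    then show yz: "?y x \<bullet> ?y x = ?z x \<bullet> ?z x"
      by (simp only: of_real_eq_0_iff)
    show "?y x \<noteq> 0"
    proof
      assume y0: "?y x = 0"
      then have "?z x = 0" using yz by simp
      then have "?d x $ c = 0" for c
        using y0 re by (cases c) simp_all
      then have "vs = 0"
        using Ed by (simp add: vec_eq_iff matrix_vector_mult_def)
      then have "W $ j = 0" for j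
        by (metis cvec_def of_real_eq_0_iff stack_vec_nth(1) vec_lambda_beta zero_index)
      then have "W = 0" by (simp add: vec_eq_iff)
      then show False using W by simp
    qed
  qed (use U s smooth AA F0 in auto)
qed

end

text \<open>The gauge factor is orthogonal, so its inverse acts on the dressed vector as the
  transpose and touches the first block only. This replaces \<open>E\<close> by
  \<open>EI\<close>.\<close>

lemma W_tilde_gauge:
  fixes E EI :: "real^'n::finite \<Rightarrow> complex \<Rightarrow> complex^('m::finite+'n)^('m+'n)"
  assumes A: "orthogonal_matrix M" and E: "reality_condition U E" "reality_condition U EI" and x: "x \<in> U"
    and gauge: "E x (- \<i> * complex_of_real s) = EI x (- \<i> * complex_of_real s) ** cmat (block M 0 0 (mat 1))"
  shows "W_tilde E s W Z x = transpose M *v W_tilde EI s W Z x" and "Z_tilde E s W Z x = Z_tilde EI s W Z x"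
proof -
  let ?B = "cmat (block M 0 0 (mat 1)) :: complex^('m+'n)^('m+'n)"
  have d: "dressed E s W Z x = transpose ?B *v dressed EI s W Z x"
    unfolding dressed_def matrix_inv_frame[OF E(1) x] matrix_inv_frame[OF E(2) x]
    by (simp only: gauge matrix_transpose_mul matrix_vector_mul_assoc)
  have "dressed E s W Z x $ Inl j = (\<Sum>l\<in>UNIV. of_real (M $ l $ j) * dressed EI s W Z x $ Inl l)" for j
    by (simp add: d matrix_vector_mult_def transpose_def map_matrix_def sum_UNIV_Plus)
  then show "W_tilde E s W Z x = transpose M *v W_tilde EI s W Z x"
    by (simp add: vec_eq_iff W_tilde_def matrix_vector_mult_def transpose_def)
  have "of_real (mat 1 $ l $ k) * c = (if l = k then c else 0)" for l k :: 'n and c :: complex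
    by (simp add: mat_def)
  then have "dressed E s W Z x $ Inr k = dressed EI s W Z x $ Inr k" for k
    by (simp add: d matrix_vector_mult_def transpose_def map_matrix_def sum_UNIV_Plus)
  then show "Z_tilde E s W Z x = Z_tilde EI s W Z x"
    by (simp add: Z_tilde_def)
qed

section \<open>The transformed immersion\<close>

lemma (in moving_frame) moving_frame_subset:
  assumes V: "open V" "V \<subseteq> U"
  shows "moving_frame V X N T b A"
proof unfold_locales
  show "smooth_on V X" "smooth_on V (N j)" "smooth_on V b" for j
    by (rule smooth_on_subset[OF _ V(2)], rule smooth_X smooth_N smooth_b)+
  fix x assume "x \<in> V"
  then have x: "x \<in> U" using V by blast
  show "has_pd X (\<lambda>i. b x $ i *\<^sub>R T i x) x" "has_pd (N j) (\<lambda>i. A x $ j $ i *\<^sub>R T i x) x" "b x $ i \<noteq> 0"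
    "T i x \<bullet> T k x = (if i = k then 1 else 0)" "N j x \<bullet> N l x = (if j = l then 1 else 0)" "T i x \<bullet> N j x = 0"
    "transpose (A x) ** A x = mat 1" for i k j l
    by (rule dX[OF x] dN[OF x] b[OF x] TT[OF x] NN[OF x] TN[OF x] A[OF x])+
  show "w = (\<Sum>i\<in>UNIV. (w \<bullet> T i x) *\<^sub>R T i x) + (\<Sum>j\<in>UNIV. (w \<bullet> N j x) *\<^sub>R N j x)" for w
    by (rule complete[OF x])
qed (rule V)

lemma has_pd_potential_real:
  fixes w :: "'n::finite \<Rightarrow> real^'n \<Rightarrow> real"
  assumes U: "open U" "simply_connected U" and w: "\<And>i. smooth_on U (w i)"
    and closed: "\<And>x i j. x \<in> U \<Longrightarrow> i \<noteq> j \<Longrightarrow> pdif j (w i) x = pdif i (w j) x"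
  shows "\<exists>\<phi>. \<forall>x\<in>U. has_pd \<phi> (\<lambda>i. w i x) x"
proof -
  define v where "v x = (\<chi> i. w i x)" for x
  have v: "smooth_on U v" by (simp add: v_def smooth_on_vec_iff[OF U(1)] w)
  have "dif v x a \<bullet> c = dif v x c \<bullet> a" if x: "x \<in> U" for x a c
  proof -
    have "has_pd v (\<lambda>i. \<chi> k. pdif i (w k) x) x"
      by (simp add: has_pd_vec_iff v_def smooth_on_imp_has_pd[OF w x])
    then have d: "dif v x a \<bullet> c = (\<Sum>i\<in>UNIV. \<Sum>k\<in>UNIV. a $ i * pdif i (w k) x * c $ k)" for a c
      by (simp add: has_pd_dif inner_sum_left) (simp add: inner_vec_def sum_distrib_left mult_ac)
    have sym: "pdif i (w k) x = pdif k (w i) x" for i k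
      by (cases "i = k") (simp_all add: closed[OF x, of k i])
    show ?thesis
      unfolding d by (subst sum.swap) (intro sum.cong refl, simp add: sym mult_ac)
  qed
  then obtain \<phi> where "\<forall>x\<in>U. (\<phi> has_derivative (\<lambda>c. v x \<bullet> c)) (at x)"
    using simply_connected_potential[OF U v] by blast
  moreover have "v x \<bullet> c = (\<Sum>i\<in>UNIV. c $ i *\<^sub>R w i x)" for x c
    by (simp add: v_def inner_vec_def mult.commute)
  ultimately show ?thesis unfolding has_pd_def by auto
qed

lemma has_pd_potential:
  fixes w :: "'n::finite \<Rightarrow> real^'n \<Rightarrow> real^'r::finite"
  assumes U: "open U" "simply_connected U" and w: "\<And>i. smooth_on U (w i)"
    and closed: "\<And>x i j. x \<in> U \<Longrightarrow> i \<noteq> j \<Longrightarrow> pdif j (w i) x = pdif i (w j) x"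
  shows "\<exists>\<phi>. \<forall>x\<in>U. has_pd \<phi> (\<lambda>i. w i x) x"
proof -
  have nth: "pdif j (\<lambda>x. w i x $ r) x = pdif j (w i) x $ r" if "x \<in> U" for i j r x
    by (rule has_pd_pdif[OF has_pd_nth[OF smooth_on_imp_has_pd[OF w that]]])
  have "\<exists>\<phi>. \<forall>x\<in>U. has_pd \<phi> (\<lambda>i. w i x $ r) x" for r
    by (rule has_pd_potential_real[OF U smooth_on_nth[OF U(1) w]]) (simp add: nth closed)
  then obtain \<phi> where "\<And>r x. x \<in> U \<Longrightarrow> has_pd (\<phi> r) (\<lambda>i. w i x $ r) x"
    by metis
  then show ?thesis
    by (intro exI[of _ "\<lambda>x. \<chi> r. \<phi> r x"]) (simp add: has_pd_vec_iff)
qed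

text \<open>B stands for the lower right block of \<open>E\<^sup>I(x,0)\<close>. It makes \<open>\<Sum>b\<^sub>i B\<^sub>i dx\<^sub>i\<close> closed.\<close>
locale dressed_immersion =
  M: moving_frame U X N T b A + D: dressing U A F y z s
  for U :: "(real^'n::finite) set" and X :: "real^'n \<Rightarrow> 'e::euclidean_space"
    and N :: "'m::finite \<Rightarrow> real^'n \<Rightarrow> 'e" and T b A F y z s +
  fixes B :: "'n \<Rightarrow> real^'n \<Rightarrow> real^'n"
  assumes simply_connected: "simply_connected U"
    and smooth_T: "\<And>i. smooth_on U (T i)"
    and dT: "\<And>x k. x \<in> U \<Longrightarrow> has_pd (T k) (\<lambda>i. F x $ i $ k *\<^sub>R T i x
      - (if k = i then (\<Sum>j\<in>UNIV. A x $ j $ i *\<^sub>R N j x) + (\<Sum>l\<in>UNIV. F x $ i $ l *\<^sub>R T l x) else 0)) x"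
    and db: "\<And>x i k. x \<in> U \<Longrightarrow> i \<noteq> k \<Longrightarrow> pdif k (\<lambda>x. b x $ i) x = F x $ i $ k * b x $ k"
    and smooth_B: "\<And>i. smooth_on U (B i)"
    and dB: "\<And>x k. x \<in> U \<Longrightarrow> has_pd (B k) (\<lambda>i. F x $ i $ k *\<^sub>R B i x
      - (if k = i then 0 + (\<Sum>l\<in>UNIV. F x $ i $ l *\<^sub>R B l x) else 0)) x"
    and BB: "\<And>x i k. x \<in> U \<Longrightarrow> B i x \<bullet> B k x = (if i = k then 1 else 0)"
begin

abbreviation "q \<equiv> D.q"
abbreviation "w \<equiv> D.w"

definition h :: "real^'n \<Rightarrow> 'e"
  where "h x = (1 / (1 + s\<^sup>2)) *\<^sub>R ((\<Sum>j\<in>UNIV. y x $ j *\<^sub>R N j x) + s *\<^sub>R (\<Sum>k\<in>UNIV. z x $ k *\<^sub>R T k x))"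

definition X' :: "(real^'n \<Rightarrow> real) \<Rightarrow> real^'n \<Rightarrow> 'e"
  where "X' \<phi> x = X x + (q x * \<phi> x) *\<^sub>R h x"

definition b' :: "(real^'n \<Rightarrow> real) \<Rightarrow> real^'n \<Rightarrow> real^'n"
  where "b' \<phi> x = (\<chi> i. b x $ i + q x * \<phi> x * w i x)"

text \<open>The form in which the product rule yields the new normals; \<open>N'_eq\<close>
  recognises it as a reflection.\<close>

definition N' :: "'m \<Rightarrow> real^'n \<Rightarrow> 'e"
  where "N' j x = N j x - (q x * y x $ j) *\<^sub>R h x"

definition T' :: "'n \<Rightarrow> real^'n \<Rightarrow> 'e"
  where "T' i x = T i x - (q x * s * z x $ i) *\<^sub>R h x"

definition potential :: "(real^'n \<Rightarrow> real) \<Rightarrow> bool"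
  where "potential \<phi> \<longleftrightarrow> smooth_on U \<phi> \<and> (\<forall>x\<in>U. \<forall>i. pdif i \<phi> x = - s * b x $ i * z x $ i)"

lemmas smooth_rules = smooth_on_add smooth_on_diff smooth_on_scaleR smooth_on_mult smooth_on_sum smooth_on_nth
  smooth_on_const D.U D.smooth_q D.smooth_w D.smooth_y D.smooth_z D.smooth_A M.smooth_X M.smooth_N M.smooth_b
  smooth_T smooth_B

lemma one_plus_s2_nz: "1 + s\<^sup>2 \<noteq> 0"
  using zero_le_power2[of s] by linarith

lemma dh: "x \<in> U \<Longrightarrow> has_pd h (\<lambda>i. w i x *\<^sub>R T i x) x"
  unfolding h_def[abs_def]
  by (rule has_pd_cong[OF has_pd_cscaleR[OF D.has_pd_sum_yz[OF _ M.dN dT]]]) (simp_all add: one_plus_s2_nz)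

lemma smooth_h: "smooth_on U h"
  unfolding h_def[abs_def] by (intro smooth_rules)

lemma smooth_N': "smooth_on U (N' j)"
  unfolding N'_def[abs_def] by (intro smooth_rules smooth_h)

lemma inner_T_h: "x \<in> U \<Longrightarrow> T i x \<bullet> h x = s * z x $ i / (1 + s\<^sup>2)"
  by (simp add: inner_commute[of "T i x"] h_def inner_add_left M.inner_T)

lemma inner_N_h: "x \<in> U \<Longrightarrow> N j x \<bullet> h x = y x $ j / (1 + s\<^sup>2)"
  by (simp add: inner_commute[of "N j x"] h_def inner_add_left M.inner_N)

text \<open>Equal norms of \<open>y\<close> and \<open>z\<close> give
  \<open>|h|^2 = (|y|^2 + s^2 |z|^2)/(1 + s^2)^2 = |y|^2/(1 + s^2)\<close>. It fixes the coefficient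
  in the reflection orthogonal to \<open>h\<close>.\<close>

lemma inner_h_h:
  assumes x: "x \<in> U"
  shows "q x * (h x \<bullet> h x) * (1 + s\<^sup>2) = 2"
proof -
  have "(1 + s\<^sup>2) * (h x \<bullet> h x) = (\<Sum>j\<in>UNIV. y x $ j * (N j x \<bullet> h x)) + s * (\<Sum>k\<in>UNIV. z x $ k * (T k x \<bullet> h x))"
    by (subst (1) h_def) (simp add: one_plus_s2_nz inner_add_left inner_sum_left)
  also have "\<dots> = (y x \<bullet> y x + s\<^sup>2 * (z x \<bullet> z x)) / (1 + s\<^sup>2)"
    by (simp add: inner_N_h[OF x] inner_T_h[OF x] inner_vec_def sum_divide_distrib sum_distrib_left
        add_divide_distrib power2_eq_square mult_ac)
  also have "\<dots> = y x \<bullet> y x"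
    using one_plus_s2_nz by (simp add: D.norm_eq[OF x, symmetric] field_simps)
  finally show ?thesis using D.q_yy[OF x] by (simp add: mult_ac)
qed

lemma h_nz: "x \<in> U \<Longrightarrow> h x \<noteq> 0"
  using inner_h_h by fastforce

lemma reflection_h:
  assumes x: "x \<in> U"
  shows "reflection (h x) v = v - (q x * (1 + s\<^sup>2) * (v \<bullet> h x)) *\<^sub>R h x"
proof -
  have "2 / (h x \<bullet> h x) = q x * (1 + s\<^sup>2)"
    using inner_h_h[OF x] h_nz[OF x] by (simp add: field_simps)
  then have "2 * (v \<bullet> h x) / (h x \<bullet> h x) = q x * (1 + s\<^sup>2) * (v \<bullet> h x)"
    by (metis times_divide_eq_left)
  then show ?thesis by (simp add: reflection_def)
qed

lemma N'_eq: "x \<in> U \<Longrightarrow> N' j x = reflection (h x) (N j x)"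
  using one_plus_s2_nz by (simp add: N'_def reflection_h inner_N_h)

lemma T'_eq: "x \<in> U \<Longrightarrow> T' i x = reflection (h x) (T i x)"
  using one_plus_s2_nz by (simp add: T'_def reflection_h inner_T_h)

text \<open>The form is closed because the j-th derivative of \<open>b_i z_i\<close> is
  \<open>F_ij b_j z_i + F_ji b_i z_j\<close>, symmetric in i and j.\<close>

lemma potential_exists: "\<exists>\<phi>. potential \<phi>"
proof -
  have smooth: "smooth_on U (\<lambda>x. - s * (b x $ i * z x $ i))" for i
    by (intro smooth_rules)
  have pd: "has_pd (\<lambda>x. - s * (b x $ i * z x $ i))
      (\<lambda>j. - s * (pdif j (\<lambda>x. b x $ i) x * z x $ i + b x $ i * pdif j (\<lambda>x. z x $ i) x)) x" if "x \<in> U" for x i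
    using that by (intro has_pd_cmult has_pd_mult D.dz' smooth_on_imp_has_pd[OF smooth_on_nth[OF D.U M.smooth_b]])
  have "\<exists>\<phi>. \<forall>x\<in>U. has_pd \<phi> (\<lambda>i. - s * (b x $ i * z x $ i)) x"
  proof (rule has_pd_potential_real[OF D.U simply_connected smooth])
    fix x i j assume x: "x \<in> U" and ij: "i \<noteq> (j::'n)"
    show "pdif j (\<lambda>x. - s * (b x $ i * z x $ i)) x = pdif i (\<lambda>x. - s * (b x $ j * z x $ j)) x"
      using ij by (simp only: has_pd_pdif[OF pd[OF x]] db[OF x ij] db[OF x ij[symmetric]]
          D.pdif_z(1)[OF x ij] D.pdif_z(1)[OF x ij[symmetric]]) (simp add: algebra_simps)
  qed
  then obtain \<phi> where \<phi>: "\<And>x. x \<in> U \<Longrightarrow> has_pd \<phi> (\<lambda>i. - s * (b x $ i * z x $ i)) x" by blast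
  have "smooth_on U \<phi>"
    by (rule smooth_on_has_pdI[OF D.U \<phi> smooth])
  then show ?thesis using has_pd_pdif[OF \<phi>] by (auto simp: potential_def mult.assoc)
qed

definition V :: "(real^'n \<Rightarrow> real) \<Rightarrow> (real^'n) set"
  where "V \<phi> = {x\<in>U. \<forall>i. b' \<phi> x $ i \<noteq> 0}"

lemma V_subset: "V \<phi> \<subseteq> U"
  by (auto simp: V_def)

context
  fixes \<phi> :: "real^'n \<Rightarrow> real"
  assumes \<phi>: "potential \<phi>"
begin

lemma smooth_potential: "smooth_on U \<phi>"
  using \<phi> by (simp add: potential_def)

lemma dpotential: "x \<in> U \<Longrightarrow> has_pd \<phi> (\<lambda>i. - s * b x $ i * z x $ i) x"
  using smooth_on_imp_has_pd[OF smooth_potential] \<phi> by (simp add: potential_def)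

lemma smooth_b': "smooth_on U (b' \<phi>)"
  unfolding smooth_on_vec_iff[OF D.U] b'_def by (simp add: smooth_rules smooth_potential)

lemma smooth_X': "smooth_on U (X' \<phi>)"
  unfolding X'_def[abs_def] by (intro smooth_rules smooth_potential smooth_h)

lemma dX': "x \<in> U \<Longrightarrow> has_pd (X' \<phi>) (\<lambda>i. (b' \<phi> x $ i) *\<^sub>R T' i x) x"
  unfolding X'_def[abs_def]
  by (rule has_pd_cong[OF D.has_pd_transform_map[OF _ dpotential M.dX dh]]) (simp_all add: b'_def T'_def)

lemma dN': "x \<in> U \<Longrightarrow> has_pd (N' j) (\<lambda>i. (D.A' x $ j $ i) *\<^sub>R T' i x) x"
  unfolding N'_def[abs_def]
  by (rule has_pd_cong[OF D.has_pd_transform_normal[OF _ M.dN dh]]) (simp_all add: T'_def)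

lemma db': "x \<in> U \<Longrightarrow> i \<noteq> k \<Longrightarrow> pdif k (\<lambda>x. b' \<phi> x $ i) x = D.F' x $ i $ k * b' \<phi> x $ k"
  unfolding b'_def using D.pdif_transformed_b[OF _ dpotential M.smooth_b db] by simp

lemma open_V: "open (V \<phi>)"
proof -
  have "open (U \<inter> (\<lambda>x. b' \<phi> x $ i) -` (- {0}))" for i
    by (rule continuous_open_preimage[OF smooth_on_imp_continuous_on[OF smooth_on_nth[OF D.U smooth_b']] D.U]) (simp add: open_Compl)
  then have "open (\<Inter>i. U \<inter> (\<lambda>x. b' \<phi> x $ i) -` (- {0}))"
    by (intro open_INT) auto
  moreover have "V \<phi> = (\<Inter>i. U \<inter> (\<lambda>x. b' \<phi> x $ i) -` (- {0}))"
    by (auto simp: V_def)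
  ultimately show ?thesis by simp
qed

lemma moving_frame_transformed: "moving_frame (V \<phi>) (X' \<phi>) N' T' (b' \<phi>) D.A'"
proof (rule moving_frame_reflected[OF M.moving_frame_axioms open_V V_subset])
  show "smooth_on (V \<phi>) (X' \<phi>)" "smooth_on (V \<phi>) (N' j)" "smooth_on (V \<phi>) (b' \<phi>)" for j
    by (rule smooth_on_subset[OF _ V_subset], rule smooth_X' smooth_N' smooth_b')+
next
  fix x assume "x \<in> V \<phi>"
  then have x: "x \<in> U" "\<And>i. b' \<phi> x $ i \<noteq> 0" by (auto simp: V_def)
  show "h x \<noteq> 0" "N' j x = reflection (h x) (N j x)" "T' i x = reflection (h x) (T i x)" "b' \<phi> x $ i \<noteq> 0"
    "has_pd (X' \<phi>) (\<lambda>i. b' \<phi> x $ i *\<^sub>R T' i x) x" "has_pd (N' j) (\<lambda>i. D.A' x $ j $ i *\<^sub>R T' i x) x"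
    "transpose (D.A' x) ** D.A' x = mat 1" for i j
    by (rule h_nz[OF x(1)] N'_eq[OF x(1)] T'_eq[OF x(1)] x(2) dX'[OF x(1)] dN'[OF x(1)] D.A'_orthonormal[OF x(1)])+
qed

text \<open>The partial derivatives of \<open>X'\<close> are \<open>b'_i T'_i\<close> with
  orthonormal \<open>T'\<close> on all of \<open>U\<close>, so injectivity fails exactly where some
  \<open>b'_i\<close> vanishes.\<close>

lemma V_eq: "V \<phi> = {x\<in>U. inj (dif (X' \<phi>) x)}"
proof -
  interpret M': moving_frame "V \<phi>" "X' \<phi>" N' T' "b' \<phi>" D.A' by (rule moving_frame_transformed)
  have "x \<in> V \<phi>" if x: "x \<in> U" and inj: "inj (dif (X' \<phi>) x)" for x
  proof -
    have "b' \<phi> x $ i \<noteq> 0" for i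
    proof
      assume "b' \<phi> x $ i = 0"
      then have "dif (X' \<phi>) x (axis i 1) = dif (X' \<phi>) x 0"
        by (simp only: has_pd_pdif[OF dX'[OF x]]) (simp add: has_pd_dif[OF dX'[OF x]])
      then show False using injD[OF inj, of "axis i 1" 0] by (simp add: axis_eq_0_iff)
    qed
    then show ?thesis using x by (simp add: V_def)
  qed
  then show ?thesis using M'.immersion V_subset by (auto simp: immersion_on_def)
qed

text \<open>Y' arises from an isometry Y of the metric of X to flat space in the same way as X' from X.\<close>
lemma flat_coordinates_transformed:
  obtains Y' :: "real^'n \<Rightarrow> real^'n" and S where "smooth_on U Y'"
    "\<And>x. x \<in> U \<Longrightarrow> has_pd Y' (\<lambda>i. b' \<phi> x $ i *\<^sub>R S i x) x"
    "\<And>x i l. x \<in> U \<Longrightarrow> S i x \<bullet> S l x = (if i = l then 1 else 0)"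
proof -
  have smooth: "smooth_on U (\<lambda>x. b x $ i *\<^sub>R B i x)" for i
    by (intro smooth_rules)
  have pd: "has_pd (\<lambda>x. b x $ i *\<^sub>R B i x) (\<lambda>j. pdif j (\<lambda>x. b x $ i) x *\<^sub>R B i x + b x $ i *\<^sub>R
      (F x $ j $ i *\<^sub>R B j x - (if i = j then 0 + (\<Sum>l\<in>UNIV. F x $ j $ l *\<^sub>R B l x) else 0))) x" if "x \<in> U" for x i
    using that by (intro has_pd_scaleR dB smooth_on_imp_has_pd[OF smooth_on_nth[OF D.U M.smooth_b]])
  have "\<exists>Y. \<forall>x\<in>U. has_pd Y (\<lambda>i. b x $ i *\<^sub>R B i x) x"
  proof (rule has_pd_potential[OF D.U simply_connected smooth])
    fix x i j assume x: "x \<in> U" and ij: "i \<noteq> (j::'n)"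
    show "pdif j (\<lambda>x. b x $ i *\<^sub>R B i x) x = pdif i (\<lambda>x. b x $ j *\<^sub>R B j x) x"
      using ij by (simp only: has_pd_pdif[OF pd[OF x]] db[OF x ij] db[OF x ij[symmetric]]) (simp add: mult_ac)
  qed
  then obtain Y where Y: "\<And>x. x \<in> U \<Longrightarrow> has_pd Y (\<lambda>i. b x $ i *\<^sub>R B i x) x" by blast
  \<comment> \<open>The counterpart of \<open>h\<close> in R^n. There is no normal part, so
    \<open>has_pd_sum_z\<close> with remainder 0 gives the derivative \<open>s w_i B_i\<close>; the
    factor \<open>1/s\<close> normalises it to the form required by
    \<open>has_pd_transform_map\<close>.\<close>
  define k where "k x = (1 / s) *\<^sub>R (\<Sum>k\<in>UNIV. z x $ k *\<^sub>R B k x)" for x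
  have dk: "has_pd k (\<lambda>i. w i x *\<^sub>R B i x) x" if "x \<in> U" for x
    unfolding k_def[abs_def]
    by (rule has_pd_cong[OF has_pd_cscaleR[OF D.has_pd_sum_z[OF that dB[OF that]]]]) (simp add: D.s)
  define S where "S i x = B i x - (q x * s * z x $ i) *\<^sub>R k x" for i x
  define Y' where "Y' x = Y x + (q x * \<phi> x) *\<^sub>R k x" for x
  have dY': "has_pd Y' (\<lambda>i. b' \<phi> x $ i *\<^sub>R S i x) x" if "x \<in> U" for x
    unfolding Y'_def[abs_def]
    by (rule has_pd_cong[OF D.has_pd_transform_map[where b = b, OF that dpotential[OF that] Y[OF that] dk[OF that]]])
      (simp add: b'_def S_def)
  have smooth_k: "smooth_on U k"
    unfolding k_def[abs_def] by (intro smooth_rules)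
  have smooth': "smooth_on U (\<lambda>x. b' \<phi> x $ i *\<^sub>R S i x)" for i
    unfolding S_def by (intro smooth_rules smooth_b' smooth_k)
  have "smooth_on U Y'"
    by (rule smooth_on_has_pdI[OF D.U dY' smooth'])
  moreover have "S i x \<bullet> S l x = (if i = l then 1 else 0)" if x: "x \<in> U" for i l x
  proof -
    have sum: "(\<Sum>k\<in>UNIV. z x $ k *\<^sub>R B k x) \<bullet> B i x = z x $ i" for i
      by (simp add: inner_sum_left BB[OF x] if_distrib cong: if_cong)
    have Bk: "B i x \<bullet> k x = z x $ i / s" for i
      by (simp add: inner_commute[of "B i x"] k_def sum)
    have "k x \<bullet> k x = (\<Sum>k\<in>UNIV. z x $ k * z x $ k) / s\<^sup>2"
      by (subst (1) k_def) (simp add: inner_sum_left Bk power2_eq_square sum_divide_distrib sum_distrib_left)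
    \<comment> \<open>From \<open>|k|^2 = |z|^2 / s^2\<close> and \<open>q |z|^2 = 2\<close>. It
      makes \<open>S i\<close> the reflection of \<open>B i\<close> orthogonal to \<open>k\<close>,
      so \<open>S\<close> stays orthonormal.\<close>
    then have kk: "q x * (k x \<bullet> k x) * s\<^sup>2 = 2"
      using D.q_zz[OF x] D.s by simp
    then have "k x \<noteq> 0" by auto
    moreover have "2 / (k x \<bullet> k x) = q x * s\<^sup>2"
      using kk \<open>k x \<noteq> 0\<close> by (simp add: field_simps)
    then have "2 / (k x \<bullet> k x) * (B i x \<bullet> k x) = q x * s * z x $ i" for i
      using D.s by (simp add: Bk power2_eq_square)
    then have "2 * (B i x \<bullet> k x) / (k x \<bullet> k x) = q x * s * z x $ i" for i
      by simp
    then have "S i x = reflection (k x) (B i x)" for i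
      by (simp add: S_def reflection_def)
    ultimately show ?thesis by (simp add: inner_reflection BB[OF x])
  qed
  ultimately show ?thesis using dY' that by blast
qed

end

text \<open>A singular value of \<open>\<phi> x\<close> solves one of n affine equations, none of
  which is trivial since \<open>b\<close> has no zeros. Potentials may be shifted by constants, so
  at each point all but finitely many shifts of a given one are admissible.\<close>

lemma finite_singular_values:
  assumes "x \<in> U"
  shows "finite {\<phi> x |\<phi>. potential \<phi> \<and> x \<notin> V \<phi>}"
proof (rule finite_subset)
  show "{\<phi> x |\<phi>. potential \<phi> \<and> x \<notin> V \<phi>} \<subseteq> range (\<lambda>i. - b x $ i / (q x * w i x))"
  proof clarify
    fix \<phi> assume "potential \<phi>" "x \<notin> V \<phi>"
    then obtain i where i: "b x $ i + q x * \<phi> x * w i x = 0"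
      using assms by (auto simp: V_def b'_def)
    then have "q x * w i x \<noteq> 0"
      using M.b[OF assms, of i] by auto
    with i have "\<phi> x = - b x $ i / (q x * w i x)"
      by (simp add: field_simps)
    then show "\<phi> x \<in> range (\<lambda>i. - b x $ i / (q x * w i x))" by blast
  qed
qed simp

end

section \<open>Transfer between functions that agree on an open set\<close>

lemma dif_cong:
  assumes "open V" "x \<in> V" "\<And>y. y \<in> V \<Longrightarrow> f y = g y"
  shows "dif f x = dif g x"
proof -
  have "(f has_derivative f') (at x) \<longleftrightarrow> (g has_derivative f') (at x)" for f'
    using has_derivative_transform_within_open[of f f' x UNIV V g]
      has_derivative_transform_within_open[of g f' x UNIV V f] assms by auto
  then show ?thesis by (simp add: frechet_derivative_def)
qed

lemma moving_frame_cong: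
  assumes frame: "moving_frame V X N T b A"
    and eq: "\<And>x. x \<in> V \<Longrightarrow> X x = X' x" "\<And>x j. x \<in> V \<Longrightarrow> N j x = N' j x"
      "\<And>x i. x \<in> V \<Longrightarrow> T i x = T' i x" "\<And>x. x \<in> V \<Longrightarrow> A x = A' x"
  shows "moving_frame V X' N' T' b A'"
proof -
  interpret M: moving_frame V X N T b A by (rule frame)
  show ?thesis
  proof unfold_locales
    show "smooth_on V X'"
      by (rule smooth_on_cong[OF M.U M.smooth_X eq(1)])
    show "smooth_on V (N' j)" for j
      by (rule smooth_on_cong[OF M.U M.smooth_N eq(2)])
  next
    fix x assume x: "x \<in> V"
    show "has_pd X' (\<lambda>i. b x $ i *\<^sub>R T' i x) x"
      using has_pd_transform[OF M.U x M.dX[OF x] eq(1)] by (simp add: eq(3)[OF x])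
    show "has_pd (N' j) (\<lambda>i. A' x $ j $ i *\<^sub>R T' i x) x" for j
      using has_pd_transform[OF M.U x M.dN[OF x] eq(2)] by (simp add: eq(3,4)[OF x])
    show "T' i x \<bullet> T' k x = (if i = k then 1 else 0)" for i k
      using M.TT[OF x] by (simp add: eq[OF x])
    show "N' i x \<bullet> N' k x = (if i = k then 1 else 0)" for i k
      using M.NN[OF x] by (simp add: eq[OF x])
    show "T' i x \<bullet> N' j x = 0" for i j
      using M.TN[OF x] by (simp add: eq[OF x])
    show "w = (\<Sum>i\<in>UNIV. (w \<bullet> T' i x) *\<^sub>R T' i x) + (\<Sum>j\<in>UNIV. (w \<bullet> N' j x) *\<^sub>R N' j x)" for w
      using M.complete[OF x, of w] by (simp add: eq[OF x])
    show "transpose (A' x) ** A' x = mat 1"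
      using M.A[OF x] by (simp add: eq[OF x])
  qed (rule M.U M.smooth_b M.b | assumption)+
qed

lemma system_I_cong:
  assumes V: "open V" "V \<subseteq> U" and sys: "system_I U A F"
    and eq: "\<And>x. x \<in> V \<Longrightarrow> A x = A' x" "\<And>x. x \<in> V \<Longrightarrow> F x = F' x"
  shows "system_I V A' F'"
proof -
  have dA: "dif (\<lambda>x. A x $ j $ i) x = dif (\<lambda>x. A' x $ j $ i) x" if "x \<in> V" for x i j
    by (rule dif_cong[OF V(1) that]) (simp add: eq)
  have dF: "dif (\<lambda>x. F x $ i $ j) x = dif (\<lambda>x. F' x $ i $ j) x" if "x \<in> V" for x i j
    by (rule dif_cong[OF V(1) that]) (simp add: eq)
  have "system_I V A F"
    unfolding system_I_def
    by (intro ballI bspec[OF sys[unfolded system_I_def]] subsetD[OF V(2)])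
  moreover have "system_I V A F \<longleftrightarrow> system_I V A' F'"
    unfolding system_I_def by (intro ball_cong refl) (simp only: dA dF eq)
  ultimately show ?thesis by simp
qed

lemma moving_frame_GmnI_data:
  fixes X :: "real^'n::finite \<Rightarrow> real^('m::finite+'n)"
  assumes "moving_frame U X N T b A"
    and F: "\<And>x i j. x \<in> U \<Longrightarrow> F x $ i $ j = (if i = j then 0 else pdif j (\<lambda>y. b y $ i) x / b x $ j)"
  shows "GmnI_data U X N b A F"
proof -
  interpret M: moving_frame U X N T b A by fact
  show ?thesis
    unfolding GmnI_data_def using M.parallel_N M.NN M.smooth_b M.b M.metric M.second_form_eq M.A F by simp
qed

section \<open>The adapted frame\<close>

lemma adapted_frame_mult:
  "adapted_frame X N b x *v p = (\<Sum>j\<in>UNIV. p $ Inl j *\<^sub>R N j x)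
     + (\<Sum>i\<in>UNIV. p $ Inr i *\<^sub>R ((1 / b x $ i) *\<^sub>R pdif i X x))"
  by (simp add: vec_eq_iff matrix_vector_mult_def adapted_frame_def sum_UNIV_Plus mult_ac)

context
  fixes U :: "(real^'n::finite) set" and X :: "real^'n \<Rightarrow> real^('m::finite+'n)"
    and N :: "'m \<Rightarrow> real^'n \<Rightarrow> real^('m+'n)" and b :: "real^'n \<Rightarrow> real^'n"
    and A :: "real^'n \<Rightarrow> real^'n^'m" and F :: "real^'n \<Rightarrow> real^'n^'n"
    and E :: "real^'n \<Rightarrow> complex \<Rightarrow> complex^('m+'n)^('m+'n)"
  assumes U: "open U" and X: "immersion_on U X" and data: "GmnI_data U X N b A F"
    and sol: "GmnI_solution U A F" and frame: "frame_of U (lax_I A F) E"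
    and E1: "\<And>x. x \<in> U \<Longrightarrow> E x 1 = cmat (adapted_frame X N b x)"
begin

abbreviation (input) "T \<equiv> \<lambda>i x. (1 / b x $ i) *\<^sub>R pdif i X x"
abbreviation (input) "B \<equiv> \<lambda>k. frame_col Inr (\<lambda>x. E x (of_real 0)) (Inr k)"

lemma reality_E: "reality_condition U E"
  using frame by (simp add: frame_of_def)

lemma frame_col_adapted:
  assumes "x \<in> U"
  shows "frame_col id (\<lambda>x. E x (of_real 1)) (Inl j) x = N j x"
    "frame_col id (\<lambda>x. E x (of_real 1)) (Inr i) x = T i x"
  using E1[OF assms] by (simp_all add: vec_eq_iff frame_col_def map_matrix_def adapted_frame_def)

text \<open>Both orthonormality and completeness of the moving frame come from
  \<open>E E^t = I\<close> at parameter 1; a square matrix needs only one of the two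
  products.\<close>

lemma adapted_frame_orthogonal:
  assumes x: "x \<in> U"
  shows "adapted_frame X N b x ** transpose (adapted_frame X N b x) = mat 1"
    "transpose (adapted_frame X N b x) ** adapted_frame X N b x = mat 1"
proof -
  let ?g = "adapted_frame X N b x"
  have "(cmat ?g ** transpose (cmat ?g)) $ k $ l = mat 1 $ k $ l" for k l
    using reality_conditionD(3)[OF reality_E x, of 1] by (simp add: E1[OF x])
  then have "complex_of_real ((?g ** transpose ?g) $ k $ l) = complex_of_real (mat 1 $ k $ l)" for k l
    by (simp add: matrix_matrix_mult_def transpose_def map_matrix_def mat_def)
  then show "?g ** transpose ?g = mat 1"
    by (simp only: of_real_eq_iff vec_eq_iff) blast
  then show "transpose ?g ** ?g = mat 1" by (simp add: matrix_left_right_inverse)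
qed

lemma smooth_adapted: "smooth_on U X" "smooth_on U b" "smooth_on U (N j)" "smooth_on U (T i)"
proof -
  show X': "smooth_on U X" and b: "smooth_on U b" and "smooth_on U (N j)"
    using X data by (auto simp: immersion_on_def GmnI_data_def parallel_normal_field_def normal_field_def)
  show "smooth_on U (T i)"
    by (intro smooth_on_scaleR smooth_on_divide smooth_on_const smooth_on_nth smooth_on_dif X' b U)
      (use data in \<open>auto simp: GmnI_data_def\<close>)
qed

lemma moving_frame_adapted: "moving_frame U X N T b A"
proof
  have b: "\<And>x i. x \<in> U \<Longrightarrow> b x $ i \<noteq> 0"
    using data by (simp add: GmnI_data_def)
  fix x assume x: "x \<in> U"
  let ?g = "adapted_frame X N b x"
  show "has_pd X (\<lambda>i. b x $ i *\<^sub>R T i x) x"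
    using smooth_on_imp_has_pd[OF smooth_adapted(1) x] b[OF x] by simp
  \<comment> \<open>The frame equation at parameter 1 already contains the Weingarten equation: the
    column of \<open>N j\<close> has only tangential derivatives.\<close>
  show "has_pd (N j) (\<lambda>i. A x $ j $ i *\<^sub>R T i x) x" for j
    using has_pd_transform[OF U x frame_col_has_pd(1)[OF frame x, of id 1 j] frame_col_adapted(1)]
    by (simp only: frame_col_adapted(2)[OF x] mult_1)
  have col: "(\<Sum>r\<in>UNIV. ?g $ r $ k * ?g $ r $ l) = (if k = l then 1 else 0)" for k l
    using adapted_frame_orthogonal(2)[OF x]
    by (simp add: vec_eq_iff matrix_matrix_mult_def transpose_def mat_def)
  show "T i x \<bullet> T k x = (if i = k then 1 else 0)" for i k
    using col[of "Inr i" "Inr k"] unfolding inner_vec_def by (simp add: adapted_frame_def)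
  show "N j x \<bullet> N k x = (if j = k then 1 else 0)" for j k
    using col[of "Inl j" "Inl k"] unfolding inner_vec_def by (simp add: adapted_frame_def)
  show "T i x \<bullet> N j x = 0" for i j
    using col[of "Inr i" "Inl j"] unfolding inner_vec_def by (simp add: adapted_frame_def)
  fix w
  have "w = ?g *v (transpose ?g *v w)"
    by (simp only: matrix_vector_mul_assoc adapted_frame_orthogonal(1)[OF x] matrix_vector_mul_lid)
  also have "\<dots> = (\<Sum>j\<in>UNIV. (w \<bullet> N j x) *\<^sub>R N j x) + (\<Sum>i\<in>UNIV. (w \<bullet> T i x) *\<^sub>R T i x)"
  proof -
    have "(transpose ?g *v w) $ Inl j = w \<bullet> N j x" "(transpose ?g *v w) $ Inr i = w \<bullet> T i x" for i j
      unfolding inner_vec_def matrix_vector_mult_def transpose_def adapted_frame_def by (simp_all add: mult_ac)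
    then show ?thesis by (simp only: adapted_frame_mult)
  qed
  finally show "w = (\<Sum>i\<in>UNIV. (w \<bullet> T i x) *\<^sub>R T i x) + (\<Sum>j\<in>UNIV. (w \<bullet> N j x) *\<^sub>R N j x)"
    by (simp only: add.commute)
qed (use U smooth_adapted data in \<open>auto simp: GmnI_data_def\<close>)

lemma dressed_immersion_adapted:
  assumes "simply_connected U" "s \<noteq> 0" "norm W = 1" "norm Z = 1"
  shows "dressed_immersion U X N T b A F (W_tilde E s W Z) (Z_tilde E s W Z) s B"
proof -
  interpret M: moving_frame U X N T b A by (rule moving_frame_adapted)
  have smooth: "smooth_on U A" "smooth_on U F" using sol by (simp_all add: GmnI_solution_def)
  show ?thesis
  proof (intro dressed_immersion.intro dressed_immersion_axioms.intro moving_frame_adapted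
      dressing_of_frame[OF frame U sol assms(2-4)] assms(1) smooth_adapted)
    fix x k assume x: "x \<in> U"
    show "has_pd (T k) (\<lambda>i. F x $ i $ k *\<^sub>R T i x
      - (if k = i then (\<Sum>j\<in>UNIV. A x $ j $ i *\<^sub>R N j x) + (\<Sum>l\<in>UNIV. F x $ i $ l *\<^sub>R T l x) else 0)) x"
      using has_pd_transform[OF U x frame_col_has_pd(2)[OF frame x, of id 1 k] frame_col_adapted(2)]
      by (simp only: frame_col_adapted[OF x] scaleR_one)
  next
    fix x i k assume "x \<in> U" "i \<noteq> (k::'n)"
    then show "pdif k (\<lambda>x. b x $ i) x = F x $ i $ k * b x $ k"
      using data by (simp add: GmnI_data_def)
  next
    show "smooth_on U (B i)" for i
      by (rule frame_col_smooth[OF frame U smooth])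
  next
    fix x k assume x: "x \<in> U"
    show "has_pd (B k) (\<lambda>i. F x $ i $ k *\<^sub>R B i x
      - (if k = i then 0 + (\<Sum>l\<in>UNIV. F x $ i $ l *\<^sub>R B l x) else 0)) x"
      using frame_col_has_pd(2)[OF frame x, of Inr 0 k] by (simp only: scaleR_zero_left)
  next
    fix x i k assume x: "x \<in> U"
    \<comment> \<open>Parameter 0 equals its negative, so conjugation by \<open>I_mn\<close> fixes
      the matrix and the off-diagonal blocks vanish. The lower right block is then orthogonal by
      itself, and real because 0 is its own conjugate.\<close>
    have E0: "E x 0 $ Inl j $ Inr l = 0" "cnj (E x 0 $ Inr k $ Inr l) = E x 0 $ Inr k $ Inr l" for j k l
      using reality_conditionD(2)[OF reality_E x, of "Inl j" 0 "Inr l"]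
        reality_conditionD(1)[OF reality_E x, of 0 "Inr k" "Inr l"] by (simp_all add: block_sign_def)
    have re: "E x 0 $ Inr k $ Inr l = of_real (B l x $ k)" for k l
      using E0(2)[of k l] by (simp add: frame_col_def complex_eq_iff)
    have "(transpose (E x 0) ** E x 0) $ Inr i $ Inr k = of_real (B i x \<bullet> B k x)"
      by (simp add: matrix_matrix_mult_def transpose_def sum_UNIV_Plus E0(1) re inner_vec_def del: of_real_0)
    moreover have "(transpose (E x 0) ** E x 0) $ Inr i $ Inr k = complex_of_real (if i = k then 1 else 0)"
      by (simp add: reality_conditionD(4)[OF reality_E x] mat_def)
    ultimately have "complex_of_real (B i x \<bullet> B k x) = complex_of_real (if i = k then 1 else 0)"
      by (simp only:)
    then show "B i x \<bullet> B k x = (if i = k then 1 else 0)"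
      by (simp only: of_real_eq_iff)
  qed
qed

end

section \<open>Translating the dressing action into the reflected frame\<close>

theorem theorem10p4:
  fixes \<iota> :: "'n::finite \<Rightarrow> 'm::finite"
    and U :: "(real^'n) set"
    and X :: "real^'n \<Rightarrow> real^('m+'n)"
    and N :: "'m \<Rightarrow> real^'n \<Rightarrow> real^('m+'n)"
    and b :: "real^'n \<Rightarrow> real^'n"
    and A1 :: "real^'n \<Rightarrow> real^'n^'m"
    and F :: "real^'n \<Rightarrow> real^'n^'n"
    and EI E :: "real^'n \<Rightarrow> complex \<Rightarrow> complex^('m+'n)^('m+'n)"
    and A :: "real^'n \<Rightarrow> real^'m^'m"
    and G :: "real^'n \<Rightarrow> real^'n^'m"
    and s \<rho> :: real
    and W :: "real^'m" and Z :: "real^'n"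
    and Wt Wh :: "real^'n \<Rightarrow> real^'m"
    and Zt Zh :: "real^'n \<Rightarrow> real^'n"
    and \<gamma> \<eta> :: "real^'n \<Rightarrow> real^('m+'n)"
    and N' :: "'m \<Rightarrow> real^'n \<Rightarrow> real^('m+'n)"
    and T' :: "'n \<Rightarrow> real^'n \<Rightarrow> real^('m+'n)"
    and potential :: "(real^'n \<Rightarrow> real) \<Rightarrow> bool"
    and X' :: "(real^'n \<Rightarrow> real) \<Rightarrow> real^'n \<Rightarrow> real^('m+'n)"
    and V :: "(real^'n \<Rightarrow> real) \<Rightarrow> (real^'n) set"
  assumes inj: "inj \<iota>"
    and U: "open U" "simply_connected U"
    (* the immersion X, its fundamental forms, and the solution (A1, F) *)
    and X: "immersion_on U X" "flat_metric U X" "flat_normal_bundle U X"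
           "nondegenerate_normal_bundle U X"
    and data: "GmnI_data U X N b A1 F"
    and sol_I: "GmnI_solution U A1 F"
    and frame_I: "frame_of U (lax_I A1 F) EI" "\<forall>x\<in>U. EI x 1 = cmat (adapted_frame X N b x)"
    (* A = (A1, A2), G and the frame E *)
    and A: "smooth_on U A" "\<forall>x\<in>U. orthogonal_matrix (A x)" "\<forall>x\<in>U. first_columns \<iota> (A x) = A1 x"
    and sol: "Gmn_solution \<iota> U (\<lambda>x. stack_mat \<iota> (F x) (G x))"
    and frame: "frame_of U (lax \<iota> (\<lambda>x. stack_mat \<iota> (F x) (G x))) E"
    and gauge: "\<forall>x\<in>U. \<forall>\<mu>. E x \<mu> = EI x \<mu> ** cmat (block (A x) 0 0 (mat 1))"
    and holo: "\<forall>x\<in>U. \<forall>k l. (\<lambda>\<mu>. E x \<mu> $ k $ l) holomorphic_on UNIV"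
    (* the action *)
    and s: "s \<noteq> 0" and W: "norm W = 1" and Z: "norm Z = 1"
    and Wt: "Wt = W_tilde E s W Z" and Zt: "Zt = Z_tilde E s W Z"
    and Wh: "Wh = (\<lambda>x. Wt x /\<^sub>R norm (Wt x))" and Zh: "Zh = (\<lambda>x. Zt x /\<^sub>R norm (Zt x))"
    and N': "N' = (\<lambda>j x. \<chi> k. Re (EI_tilde s EI A Wh Zh x 1 $ k $ Inl j))"
    and T': "T' = (\<lambda>i x. \<chi> k. Re (EI_tilde s EI A Wh Zh x 1 $ k $ Inr i))"
    (* rho = arccot s, for any branch of arccot *)
    and \<rho>: "cot \<rho> = s"
    and \<gamma>: "\<gamma> = (\<lambda>x. stack_vec (sin \<rho> *\<^sub>R (A x *v Wh x)) (cos \<rho> *\<^sub>R Zh x))"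
    and \<eta>: "\<eta> = (\<lambda>x. adapted_frame X N b x *v \<gamma> x)"
    and potential: "potential = (\<lambda>\<phi>. smooth_on U \<phi> \<and>
           (\<forall>x\<in>U. \<forall>i. pdif i \<phi> x = - s * b x $ i * Zt x $ i))"
    and X': "X' = (\<lambda>\<phi> x. X x + (2 * cos \<rho> / s * (\<phi> x / norm (Wt x))) *\<^sub>R \<eta> x)"
    (* the set where X' is immersive *)
    and V: "V = (\<lambda>\<phi>. {x\<in>U. inj (dif (X' \<phi>) x)})"
  shows "(\<exists>\<phi>. potential \<phi>) \<and>
    (\<forall>x\<in>U. finite {\<phi> x |\<phi>. potential \<phi> \<and> x \<notin> V \<phi>}) \<and>
    (\<forall>\<phi>. potential \<phi> \<longrightarrow>
      (open (V \<phi>) \<and> smooth_on U (X' \<phi>) \<and> immersion_on (V \<phi>) (X' \<phi>) \<and> flat_metric (V \<phi>) (X' \<phi>) \<and>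
       flat_normal_bundle (V \<phi>) (X' \<phi>) \<and> nondegenerate_normal_bundle (V \<phi>) (X' \<phi>)) \<and>
      (\<forall>P. fibre_linear (V \<phi>) X P \<and> (\<forall>x\<in>V \<phi>. \<forall>j. P x (N j x) = N' j x) \<longrightarrow>
         ribaucour_transformation (V \<phi>) X (V \<phi>) (X' \<phi>) (\<lambda>x. x) P) \<and>
      (GmnI_solution (V \<phi>) (A1_tilde \<iota> A Wh) (F_tilde \<iota> s F Wh Zh) \<and>
       (\<exists>b'. GmnI_data (V \<phi>) (X' \<phi>) N' b' (A1_tilde \<iota> A Wh) (F_tilde \<iota> s F Wh Zh) \<and>
          (\<forall>x\<in>V \<phi>. \<forall>i. T' i x = (1 / b' x $ i) *\<^sub>R pdif i (X' \<phi>) x))))"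
proof -
  let ?g = "adapted_frame X N b"
  define T where "T = (\<lambda>i x. (1 / b x $ i) *\<^sub>R pdif i X x)"
  define B where "B = (\<lambda>k. frame_col Inr (\<lambda>x. EI x (of_real 0)) (Inr k) :: real^'n \<Rightarrow> real^'n)"
  define y where "y = W_tilde EI s W Z"
  define z where "z = Z_tilde EI s W Z"
  interpret L: dressed_immersion U X N T b A1 F y z s B
    unfolding y_def z_def T_def B_def
    by (rule dressed_immersion_adapted[OF U(1) X(1) data sol_I frame_I(1) _ U(2) s W Z]) (use frame_I(2) in blast)
  have orthA: "A x ** transpose (A x) = mat 1" "transpose (A x) ** A x = mat 1" if "x \<in> U" for x
    using A(2) that by (simp_all add: orthogonal_matrix_def)
  have A1: "A x $ j $ \<iota> i = A1 x $ j $ i" if "x \<in> U" for x i j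
    using A(3) that by (auto simp: first_columns_def vec_eq_iff)
  have Wt_eq: "Wt x = transpose (A x) *v y x" and Zt_eq: "Zt x = z x" if x: "x \<in> U" for x
    using W_tilde_gauge[of "A x" U E EI x s W Z] A(2) frame frame_I(1) gauge x
    by (auto simp: Wt Zt y_def z_def frame_of_def)
  \<comment> \<open>The common norm of \<open>Wt\<close> and \<open>Zt\<close>, since
    \<open>A\<close> is orthogonal. Normalising by it turns the quadratic expressions in
    \<open>Wh\<close> and \<open>Zh\<close> into expressions with \<open>q = 2/r^2\<close>.\<close>
  define r where "r x = norm (y x)" for x
  have r: "r x \<noteq> 0" "L.q x = 2 * inverse (r x) * inverse (r x)" if "x \<in> U" for x
    using L.D.y_nz[OF that] by (simp_all add: r_def L.D.q_def dot_square_norm power2_eq_square divide_inverse)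
  have AWt: "A x *v Wt x = y x" if x: "x \<in> U" for x
    by (simp only: Wt_eq[OF x] matrix_vector_mul_assoc orthA(1)[OF x] matrix_vector_mul_lid)
  have norm_Wt: "norm (Wt x) = r x" if x: "x \<in> U" for x
  proof -
    have "Wt x \<bullet> Wt x = y x \<bullet> (A x *v Wt x)"
      by (simp add: Wt_eq[OF x] dot_lmul_matrix)
    then show ?thesis by (simp add: AWt[OF x] r_def norm_eq_sqrt_inner)
  qed
  have norm_Zt: "norm (Zt x) = r x" if "x \<in> U" for x
    using L.D.norm_eq[OF that] by (simp add: Zt_eq[OF that] r_def norm_eq_sqrt_inner)
  have Wh_eq: "Wh x = Wt x /\<^sub>R r x" if x: "x \<in> U" for x
    by (simp only: Wh norm_Wt[OF x])
  have AWh: "A x *v Wh x = y x /\<^sub>R r x" and Zh_eq: "Zh x = z x /\<^sub>R r x" if x: "x \<in> U" for x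
  proof -
    show "A x *v Wh x = y x /\<^sub>R r x"
      by (simp add: Wh_eq[OF x] AWt[OF x] matrix_vector_mult_scaleR)
    show "Zh x = z x /\<^sub>R r x"
      by (simp only: Zh norm_Zt[OF x]) (simp only: Zt_eq[OF x])
  qed
  have Wh_iota: "Wh x $ \<iota> i = L.w i x / r x" if x: "x \<in> U" for x i
    by (simp add: Wh_eq[OF x] Wt_eq[OF x] L.D.w_def matrix_vector_mult_def transpose_def A1[OF x] divide_inverse mult_ac)
  have g_mult: "?g x *v p = (\<Sum>j\<in>UNIV. p $ Inl j *\<^sub>R N j x) + (\<Sum>i\<in>UNIV. p $ Inr i *\<^sub>R T i x)" for x p
    by (simp only: adapted_frame_mult T_def)
  have g_nth: "?g x $ k $ Inl j = N j x $ k" "?g x $ k $ Inr i = T i x $ k" for x k i j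
    by (simp_all add: adapted_frame_def T_def)
  have h_eq: "(1 + s\<^sup>2) *\<^sub>R L.h x = ?g x *v stack_vec (y x) (s *\<^sub>R z x)" for x
    using L.one_plus_s2_nz by (simp add: L.h_def g_mult scaleR_sum_right)
  have potential_eq: "potential = L.potential"
    by (auto simp: potential L.potential_def Zt_eq fun_eq_iff)

  \<comment> \<open>These two relations hold on every branch of arccot; a change of branch at most
    flips the signs of sine and cosine together.\<close>
  have sin: "cos \<rho> = s * sin \<rho>" "sin \<rho> * sin \<rho> * (1 + s\<^sup>2) = 1"
  proof -
    have "sin \<rho> \<noteq> 0" using \<rho> s by (auto simp: cot_def)
    then show "cos \<rho> = s * sin \<rho>" using \<rho> by (simp add: cot_def field_simps)
    then show "sin \<rho> * sin \<rho> * (1 + s\<^sup>2) = 1"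
      using sin_cos_squared_add[of \<rho>] by (simp add: power2_eq_square algebra_simps)
  qed
  have \<eta>_eq: "\<eta> x = (sin \<rho> * (1 + s\<^sup>2) / r x) *\<^sub>R L.h x" if x: "x \<in> U" for x
  proof -
    have "\<gamma> x = (sin \<rho> / r x) *\<^sub>R stack_vec (y x) (s *\<^sub>R z x)"
      unfolding \<gamma> AWh[OF x] Zh_eq[OF x] sin(1)
      by (simp add: vec_eq_iff stack_vec_def divide_inverse mult_ac split: sum.split)
    then have "\<eta> x = (sin \<rho> / r x) *\<^sub>R ((1 + s\<^sup>2) *\<^sub>R L.h x)"
      unfolding h_eq \<eta> by (simp add: matrix_vector_mult_scaleR)
    then show ?thesis by simp
  qed
  \<comment> \<open>One sine comes from \<open>cos \<rho> / s\<close>, the other from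
    \<open>\<eta>\<close>. They enter as a square, which cancels \<open>1 + s^2\<close> and leaves
    \<open>q \<phi> h\<close>.\<close>
  have X'_eq: "L.X' \<phi> x = X' \<phi> x" if x: "x \<in> U" for \<phi> x
  proof -
    have "2 * cos \<rho> / s * (\<phi> x / r x) * (sin \<rho> * (1 + s\<^sup>2) / r x)
        = 2 * inverse (r x) * inverse (r x) * \<phi> x * (sin \<rho> * sin \<rho> * (1 + s\<^sup>2))"
      using s by (simp add: sin(1) divide_inverse)
    then show ?thesis
      unfolding X' L.X'_def norm_Wt[OF x] \<eta>_eq[OF x] r(2)[OF x] by (simp add: sin(2))
  qed

  \<comment> \<open>At parameter 1 the dressing factor is \<open>I - 2 p p^t / |p|^2\<close> for
    \<open>p = (A Wh, s Zh)\<close>, as \<open>Wh\<close> and \<open>Zh\<close> are unit vectors and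
    \<open>|p|^2 = 1 + s^2\<close>. The adapted frame carries \<open>p\<close> to a multiple of
    \<open>h\<close>, so the factor becomes the reflection orthogonal to \<open>h\<close>.\<close>
  have EI1: "EI_tilde s EI A Wh Zh x 1 $ k $ l
      = of_real (?g x $ k $ l - 2 / (1 + s\<^sup>2) * (?g x *v stack_vec (A x *v Wh x) (s *\<^sub>R Zh x)) $ k
          * stack_vec (A x *v Wh x) (s *\<^sub>R Zh x) $ l)" if x: "x \<in> U" for x k l
  proof -
    let ?p = "stack_vec (A x *v Wh x) (s *\<^sub>R Zh x)"
    have p: "stack_vec (1 *s cvec (A x *v Wh x)) (complex_of_real s *s cvec (Zh x)) = (\<chi> k. of_real (?p $ k))"
      by (auto simp: vec_eq_iff stack_vec_def cvec_def split: sum.split)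
    let ?M = "mat 1 - cscale (2 / (1\<^sup>2 + (complex_of_real s)\<^sup>2))
      (\<chi> k l. (\<chi> k. complex_of_real (?p $ k)) $ k * (\<chi> k. complex_of_real (?p $ k)) $ l)"
    have M: "?M $ c $ l = complex_of_real ((if c = l then 1 else 0) - 2 / (1 + s\<^sup>2) * ?p $ c * ?p $ l)" for c l
      by (simp add: mat_def cscale_def)
    have EI1: "EI x 1 = cmat (?g x)" using frame_I(2) x by blast
    have "EI_tilde s EI A Wh Zh x 1 = cmat (?g x) ** ?M"
      unfolding EI_tilde_def Let_def p EI1 ..
    moreover have "(P ** Q) $ k $ l = (\<Sum>c\<in>UNIV. P $ k $ c * Q $ c $ l)" for P Q :: "complex^('m+'n)^('m+'n)"
      by (simp add: matrix_matrix_mult_def)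
    moreover have "cmat (?g x) $ k $ c = of_real (?g x $ k $ c)" for c
      by (simp add: map_matrix_def)
    ultimately have "EI_tilde s EI A Wh Zh x 1 $ k $ l
      = (\<Sum>c\<in>UNIV. of_real (?g x $ k $ c) * complex_of_real ((if c = l then 1 else 0) - 2 / (1 + s\<^sup>2) * ?p $ c * ?p $ l))"
      by (simp only: M)
    also have "\<dots> = of_real (\<Sum>c\<in>UNIV. ?g x $ k $ c * (if c = l then 1 else 0)
        - 2 / (1 + s\<^sup>2) * (?g x $ k $ c * ?p $ c) * ?p $ l)"
      unfolding of_real_sum by (rule sum.cong) (simp_all only: of_real_mult[symmetric] right_diff_distrib mult_ac)
    also have "(\<Sum>c\<in>UNIV. ?g x $ k $ c * (if c = l then 1 else 0) - 2 / (1 + s\<^sup>2) * (?g x $ k $ c * ?p $ c) * ?p $ l)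
        = ?g x $ k $ l - 2 / (1 + s\<^sup>2) * (?g x *v ?p) $ k * ?p $ l"
    proof -
      have "(P *v p) $ k = (\<Sum>c\<in>UNIV. P $ k $ c * p $ c)" for P :: "real^('m+'n)^('m+'n)" and p
        by (simp add: matrix_vector_mult_def)
      then show ?thesis
        by (simp only: sum_subtractf sum_if_mult(2)[where f = "\<lambda>_. 1"] mult_1_right sum_distrib_left sum_distrib_right)
    qed
    finally show ?thesis .
  qed
  have gp: "2 / (1 + s\<^sup>2) * (?g x *v stack_vec (A x *v Wh x) (s *\<^sub>R Zh x)) $ k = 2 / r x * L.h x $ k" if x: "x \<in> U" for x k
  proof -
    have "stack_vec (A x *v Wh x) (s *\<^sub>R Zh x) = (1 / r x) *\<^sub>R stack_vec (y x) (s *\<^sub>R z x)"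
      by (simp add: AWh[OF x] Zh_eq[OF x] vec_eq_iff stack_vec_def divide_inverse mult_ac split: sum.split)
    then have "?g x *v stack_vec (A x *v Wh x) (s *\<^sub>R Zh x) = (1 / r x) *\<^sub>R ((1 + s\<^sup>2) *\<^sub>R L.h x)"
      by (simp only: h_eq matrix_vector_mult_scaleR)
    then show ?thesis using L.one_plus_s2_nz by simp
  qed
  have N'_eq: "L.N' j x = N' j x" if x: "x \<in> U" for j x
    unfolding N' EI1[OF x] gp[OF x]
    using r(1)[OF x] by (simp add: vec_eq_iff L.N'_def g_nth AWh[OF x] r(2)[OF x] field_simps)
  have T'_eq: "L.T' i x = T' i x" if x: "x \<in> U" for i x
    unfolding T' EI1[OF x] gp[OF x]
    using r(1)[OF x] by (simp add: vec_eq_iff L.T'_def g_nth Zh_eq[OF x] r(2)[OF x] field_simps)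
  have A'_eq: "L.D.A' x = A1_tilde \<iota> A Wh x" if x: "x \<in> U" for x
  proof -
    have "(A x ** (mat 1 - 2 *\<^sub>R (\<chi> k l. Wh x $ k * Wh x $ l))) $ j $ \<iota> i = A1 x $ j $ i - 2 * (A x *v Wh x) $ j * Wh x $ \<iota> i" for i j
    proof -
      have "A x $ j $ c * (mat 1 - 2 *\<^sub>R (\<chi> k l. Wh x $ k * Wh x $ l)) $ c $ \<iota> i
        = (if c = \<iota> i then A x $ j $ c else 0) - 2 * (A x $ j $ c * Wh x $ c) * Wh x $ \<iota> i" for c
        by (simp add: mat_def algebra_simps)
      then show ?thesis
        by (simp add: matrix_matrix_mult_def matrix_vector_mult_def sum_subtractf A1[OF x] flip: sum_distrib_left sum_distrib_right)
    qed
    then show ?thesis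
      using r(1)[OF x]
      by (simp add: vec_eq_iff A1_tilde_def first_columns_def L.D.A'_def AWh[OF x] Wh_iota[OF x] r(2)[OF x]
          field_simps)
  qed
  have F'_eq: "L.D.F' x = F_tilde \<iota> s F Wh Zh x" if x: "x \<in> U" for x
    using r(1)[OF x] by (simp add: vec_eq_iff F_tilde_def L.D.F'_def Wh_iota[OF x] Zh_eq[OF x] r(2)[OF x] field_simps)

  have V_eq: "L.V \<phi> = V \<phi>" if "L.potential \<phi>" for \<phi>
  proof -
    have "dif (X' \<phi>) x = dif (L.X' \<phi>) x" if "x \<in> U" for x
      by (rule dif_cong[OF U(1) that]) (simp add: X'_eq)
    then show ?thesis unfolding V L.V_eq[OF that] by auto
  qed

  have main: "(open (V \<phi>) \<and> smooth_on U (X' \<phi>) \<and> immersion_on (V \<phi>) (X' \<phi>) \<and> flat_metric (V \<phi>) (X' \<phi>) \<and>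
       flat_normal_bundle (V \<phi>) (X' \<phi>) \<and> nondegenerate_normal_bundle (V \<phi>) (X' \<phi>)) \<and>
      (\<forall>P. fibre_linear (V \<phi>) X P \<and> (\<forall>x\<in>V \<phi>. \<forall>j. P x (N j x) = N' j x) \<longrightarrow>
         ribaucour_transformation (V \<phi>) X (V \<phi>) (X' \<phi>) (\<lambda>x. x) P) \<and>
      (GmnI_solution (V \<phi>) (A1_tilde \<iota> A Wh) (F_tilde \<iota> s F Wh Zh) \<and>
       (\<exists>b'. GmnI_data (V \<phi>) (X' \<phi>) N' b' (A1_tilde \<iota> A Wh) (F_tilde \<iota> s F Wh Zh) \<and>
          (\<forall>x\<in>V \<phi>. \<forall>i. T' i x = (1 / b' x $ i) *\<^sub>R pdif i (X' \<phi>) x)))" if \<phi>: "L.potential \<phi>" for \<phi>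
  proof -
    have V: "open (V \<phi>)" "V \<phi> \<subseteq> U"
      using L.open_V[OF \<phi>] L.V_subset[of \<phi>] by (simp_all add: V_eq[OF \<phi>])
    then have inU: "x \<in> V \<phi> \<Longrightarrow> x \<in> U" for x by blast
    have frame': "moving_frame (V \<phi>) (X' \<phi>) N' T' (L.b' \<phi>) (A1_tilde \<iota> A Wh)"
      using moving_frame_cong[OF L.moving_frame_transformed[OF \<phi>, unfolded V_eq[OF \<phi>]]
          X'_eq[OF inU] N'_eq[OF inU] T'_eq[OF inU] A'_eq[OF inU]] .
    interpret M': moving_frame "V \<phi>" "X' \<phi>" N' T' "L.b' \<phi>" "A1_tilde \<iota> A Wh" by (rule frame')
    have smooth_X': "smooth_on U (X' \<phi>)"
      by (rule smooth_on_cong[OF U(1) L.smooth_X'[OF \<phi>] X'_eq])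
    have flat: "flat_metric (V \<phi>) (X' \<phi>)"
    proof -
      obtain Y :: "real^'n \<Rightarrow> real^'n" and S where Y: "smooth_on U Y" "\<And>x. x \<in> U \<Longrightarrow> has_pd Y (\<lambda>i. L.b' \<phi> x $ i *\<^sub>R S i x) x"
        and S: "\<And>x i l. x \<in> U \<Longrightarrow> S i x \<bullet> S l x = (if i = l then 1 else 0)"
        by (rule L.flat_coordinates_transformed[OF \<phi>]) (rule that)
      show ?thesis
        by (rule M'.flat_metricI[OF smooth_on_subset[OF Y(1) V(2)] Y(2)[OF inU] S[OF inU]])
    qed
    have rib: "ribaucour_transformation (V \<phi>) X (V \<phi>) (X' \<phi>) (\<lambda>x. x) P"
      if P: "fibre_linear (V \<phi>) X P" "\<forall>x\<in>V \<phi>. \<forall>j. P x (N j x) = N' j x" for P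
    proof (rule ribaucour_of_reflected_frames[OF L.M.moving_frame_subset[OF V] frame', where h = L.h])
      show "X' \<phi> x = X x + (L.q x * \<phi> x) *\<^sub>R L.h x" if "x \<in> V \<phi>" for x
        using X'_eq[OF inU[OF that], of \<phi>] by (simp add: L.X'_def)
      show "N' j x = reflection (L.h x) (N j x)" "T' j' x = reflection (L.h x) (T j' x)" if "x \<in> V \<phi>" for x j j'
        using N'_eq[OF inU[OF that], of j] T'_eq[OF inU[OF that], of j'] L.N'_eq[OF inU[OF that], of j]
          L.T'_eq[OF inU[OF that], of j'] by simp_all
    qed (use P L.h_nz inU in auto)
    have smooth_A': "smooth_on (V \<phi>) (A1_tilde \<iota> A Wh)"
      by (rule smooth_on_cong[OF V(1) smooth_on_subset[OF L.D.smooth_A' V(2)] A'_eq[OF inU]])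
    have smooth_F': "smooth_on (V \<phi>) (F_tilde \<iota> s F Wh Zh)"
      by (rule smooth_on_cong[OF V(1) smooth_on_subset[OF L.D.smooth_F' V(2)] F'_eq[OF inU]])
    have F'0: "F_tilde \<iota> s F Wh Zh x $ i $ i = 0" for x i
      by (simp add: F_tilde_def)
    have sys': "system_I (V \<phi>) (A1_tilde \<iota> A Wh) (F_tilde \<iota> s F Wh Zh)"
      by (rule system_I_cong[OF V L.D.system_I' A'_eq[OF inU] F'_eq[OF inU]])
    have sol': "GmnI_solution (V \<phi>) (A1_tilde \<iota> A Wh) (F_tilde \<iota> s F Wh Zh)"
      unfolding GmnI_solution_def
      using smooth_A' smooth_F' M'.A F'0 system_I_imp_flat_lax_I[OF V(1) smooth_A' smooth_F' M'.A F'0 sys'] by blast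
    have data': "GmnI_data (V \<phi>) (X' \<phi>) N' (L.b' \<phi>) (A1_tilde \<iota> A Wh) (F_tilde \<iota> s F Wh Zh)"
    proof (rule moving_frame_GmnI_data[OF frame'])
      fix x i j assume x: "x \<in> V \<phi>"
      show "F_tilde \<iota> s F Wh Zh x $ i $ j = (if i = j then 0 else pdif j (\<lambda>y. L.b' \<phi> y $ i) x / L.b' \<phi> x $ j)"
        using L.db'[OF \<phi> inU[OF x], of i j] M'.b[OF x, of j] F'0 by (simp add: F'_eq[OF inU[OF x]])
    qed
    have "T' i x = (1 / L.b' \<phi> x $ i) *\<^sub>R pdif i (X' \<phi>) x" if "x \<in> V \<phi>" for i x
      using M'.b[OF that, of i] by (simp add: has_pd_pdif[OF M'.dX[OF that]])
    then show ?thesis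
      using V(1) smooth_X' M'.immersion flat M'.flat_normal M'.nondegenerate rib sol' data' by blast
  qed
  have "finite {\<phi> x |\<phi>. potential \<phi> \<and> x \<notin> V \<phi>}" if "x \<in> U" for x
  proof -
    have "{\<phi> x |\<phi>. potential \<phi> \<and> x \<notin> V \<phi>} = {\<phi> x |\<phi>. L.potential \<phi> \<and> x \<notin> L.V \<phi>}"
      using V_eq unfolding potential_eq by blast
    then show ?thesis using L.finite_singular_values[OF that] by simp
  qed
  then show ?thesis
    using L.potential_exists main unfolding potential_eq by blast
qed

end
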